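(* Let $V$ be a complex vector space of complex dimension $2$ with a Hermitian inner product. Let $P=P(V\times\mathbf C)\approx\mathbf{CP}^2$, so that $P=V\cup H$ with $H\approx\mathbf{CP}^1$ the projective line at infinity, let $S=V\cup\{\infty\}\approx S^4$, and let $\mathrm{pr}:P\to S$ be the projection that sends $H$ to $\infty$ and equals the identity on $V$. Then the oriented closed real surfaces pseudoholomorphically embedded in $S$ are all diffeomorphic to $S^2$, and they coincide with the $\mathrm{pr}$-images of complex projective lines other than $H$ in the projective space $P$.
   Context: **Compactifications of $V$.** $P$ is the complex projective space of all complex lines through $0$ in $V\times\mathbf C$; $[y,z]\in P$ denotes the line spanned by $(y,z)\ne(0,0)$. $V$ is treated as a subset of $P$ by identifying $y\in V$ with $[y,1]$, and $H=\{[y,0]:y\in V\smallsetminus\{0\}\}$. The projection is given by $\mathrm{pr}([y,z])=y/z$ if $z\ne0$ and $\mathrm{pr}([y,0])=\infty$. The set $S=V\cup\{\infty\}$ is a $C^\infty$ manifold (diffeomorphic to $S^4$) with the atlas of two $V$-valued charts: $\mathrm{Id}:S\smallsetminus\{\infty\}=V\to V$ and $\Phi:S\smallsetminus\{0\}\to V$, where $\Phi(y)=y/|y|^2$ for $y\in V\smallsetminus\{0\}$ and $\Phi(\infty)=0$. The map $\mathrm{pr}:P\to S$ is $C^\infty$. **Pseudoholomorphic immersions.** An immersion $f:\Sigma\to N$ of an oriented real surface in an almost complex manifold $N$ of real dimension $4$ is pseudoholomorphic if, for every $x\in\Sigma$, $df_x(T_x\Sigma)$ is a complex line in $T_{f(x)}N$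 and $df_x$ maps the orientation of $T_x\Sigma$ to the complex-line orientation (the one in which $(e,ie)$ is positive). An immersion $f:\Sigma\to S$ of an oriented real surface $\Sigma$ is called pseudoholomorphic if its restriction to $\Sigma\smallsetminus f^{-1}(\infty)$ is a pseudoholomorphic immersion in the complex plane $V=S\smallsetminus\{\infty\}$. A surface is pseudoholomorphically embedded in $S$ if it is an embedded submanifold whose inclusion mapping is pseudoholomorphic. All manifolds are smooth and connected; "closed" means compact without boundary. *)

theory Defs
  imports "HOL-Analysis.Analysis"
begin

section \<open>Smooth maps between Euclidean spaces\<close>

text \<open>These notions are only meant for open sets \<^term>\<open>U\<close>. By definition, \<^term>\<open>f\<close> is
  \<open>C\<^sup>k\<^sup>+\<^sup>1\<close> if it is differentiable and all its directional derivatives are \<open>C\<^sup>k\<close>.\<close>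

primrec Ck_on :: "nat \<Rightarrow> ('a::euclidean_space \<Rightarrow> 'b::euclidean_space) \<Rightarrow> 'a set \<Rightarrow> bool" where
  "Ck_on 0 f U \<longleftrightarrow> continuous_on U f"
| "Ck_on (Suc k) f U \<longleftrightarrow>
     (\<forall>x\<in>U. f differentiable (at x)) \<and> (\<forall>v. Ck_on k (\<lambda>x. frechet_derivative f (at x) v) U)"

definition smooth_on :: "('a::euclidean_space \<Rightarrow> 'b::euclidean_space) \<Rightarrow> 'a set \<Rightarrow> bool" where
  "smooth_on f U \<longleftrightarrow> (\<forall>k. Ck_on k f U)"


section \<open>Manifolds given by atlases\<close>

text \<open>A chart is a pair of a domain and a coordinate map, whose values outside the domain are
  irrelevant. A manifold is represented by any one of its atlases: the underlying set is the union
  of the chart domains, and the topology is the one determined by the charts.\<close>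

type_synonym ('a, 'e) chart = "'a set \<times> ('a \<Rightarrow> 'e)"
type_synonym ('a, 'e) atlas = "('a, 'e) chart set"

definition carrier_of :: "('a, 'e) atlas \<Rightarrow> 'a set" where
  "carrier_of A = (\<Union>(U, \<phi>)\<in>A. U)"

definition local_rep ::
    "('a, 'd) chart \<Rightarrow> ('b, 'e) chart \<Rightarrow> ('a \<Rightarrow> 'b) \<Rightarrow> 'd \<Rightarrow> 'e" where
  "local_rep c d f = snd d \<circ> f \<circ> inv_into (fst c) (snd c)"

definition transition :: "('a, 'd) chart \<Rightarrow> ('a, 'e) chart \<Rightarrow> 'd \<Rightarrow> 'e" where
  "transition c d = local_rep c d id"

definition smooth_atlas :: "('a, 'e::euclidean_space) atlas \<Rightarrow> bool" where
  "smooth_atlas A \<longleftrightarrow>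
     (\<forall>(U, \<phi>)\<in>A. inj_on \<phi> U) \<and>
     (\<forall>(U, \<phi>)\<in>A. \<forall>(W, \<psi>)\<in>A.
        open (\<phi> ` (U \<inter> W)) \<and> smooth_on (transition (U, \<phi>) (W, \<psi>)) (\<phi> ` (U \<inter> W)))"

definition atlas_topology :: "('a, 'e::euclidean_space) atlas \<Rightarrow> 'a topology" where
  "atlas_topology A =
     topology (\<lambda>X. X \<subseteq> carrier_of A \<and> (\<forall>(U, \<phi>)\<in>A. open (\<phi> ` (X \<inter> U))))"

lemma openin_atlas_topology:
  assumes "smooth_atlas A"
  shows "openin (atlas_topology A) X \<longleftrightarrow>
    X \<subseteq> carrier_of A \<and> (\<forall>(U, \<phi>)\<in>A. open (\<phi> ` (X \<inter> U)))"
proof -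
  have inj: "inj_on \<phi> U" if "(U, \<phi>) \<in> A" for U \<phi>
    using assms that by (auto simp: smooth_atlas_def)
  have Int: "open (\<phi> ` ((X \<inter> Y) \<inter> U))"
    if "(U, \<phi>) \<in> A" "open (\<phi> ` (X \<inter> U))" "open (\<phi> ` (Y \<inter> U))" for U \<phi> X Y
  proof -
    have "\<phi> ` ((X \<inter> Y) \<inter> U) = \<phi> ` (X \<inter> U) \<inter> \<phi> ` (Y \<inter> U)"
      using inj[OF that(1)] by (auto simp: inj_on_def)
    with that show ?thesis
      by auto
  qed
  have Union: "open (\<phi> ` (\<Union>\<K> \<inter> U))"
    if "\<forall>X\<in>\<K>. open (\<phi> ` (X \<inter> U))" for U \<phi> \<K>
  proof -
    have "\<phi> ` (\<Union>\<K> \<inter> U) = (\<Union>X\<in>\<K>. \<phi> ` (X \<inter> U))"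
      by auto
    with that show ?thesis
      by auto
  qed
  have "istopology (\<lambda>X. X \<subseteq> carrier_of A \<and> (\<forall>(U, \<phi>)\<in>A. open (\<phi> ` (X \<inter> U))))"
    unfolding istopology_def
  proof (intro conjI allI impI ballI)
    show "S \<inter> T \<subseteq> carrier_of A"
      if "S \<subseteq> carrier_of A \<and> (\<forall>(U, \<phi>)\<in>A. open (\<phi> ` (S \<inter> U)))" for S T
      using that by blast
    show "case c of (U, \<phi>) \<Rightarrow> open (\<phi> ` (S \<inter> T \<inter> U))"
      if "S \<subseteq> carrier_of A \<and> (\<forall>(U, \<phi>)\<in>A. open (\<phi> ` (S \<inter> U)))"
        "T \<subseteq> carrier_of A \<and> (\<forall>(U, \<phi>)\<in>A. open (\<phi> ` (T \<inter> U)))" "c \<in> A" for S T c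
      using that Int by (cases c) fastforce
    show "\<Union>\<K> \<subseteq> carrier_of A"
      if "\<forall>S\<in>\<K>. S \<subseteq> carrier_of A \<and> (\<forall>(U, \<phi>)\<in>A. open (\<phi> ` (S \<inter> U)))" for \<K>
      using that by blast
    show "case c of (U, \<phi>) \<Rightarrow> open (\<phi> ` (\<Union>\<K> \<inter> U))"
      if "\<forall>S\<in>\<K>. S \<subseteq> carrier_of A \<and> (\<forall>(U, \<phi>)\<in>A. open (\<phi> ` (S \<inter> U)))" "c \<in> A" for \<K> c
    proof (cases c)
      case (Pair U \<phi>)
      then show ?thesis
        using Union[of \<K> \<phi> U] that by fastforce
    qed
  qed
  then show ?thesis
    by (simp add: atlas_topology_def topology_inverse')
qed

lemma topspace_atlas_topology:
  assumes "smooth_atlas A"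
  shows "topspace (atlas_topology A) = carrier_of A"
proof -
  have "open (\<phi> ` (carrier_of A \<inter> U))" if "(U, \<phi>) \<in> A" for U \<phi>
  proof -
    have "open (\<phi> ` (U \<inter> U))"
      using assms that unfolding smooth_atlas_def by fast
    moreover have "carrier_of A \<inter> U = U"
      using that by (auto simp: carrier_of_def)
    ultimately show ?thesis
      by simp
  qed
  then have "openin (atlas_topology A) (carrier_of A)"
    using assms by (auto simp: openin_atlas_topology)
  then show ?thesis
    using assms by (metis openin_atlas_topology openin_subset openin_topspace subset_antisym)
qed

definition manifold :: "('a, 'e::euclidean_space) atlas \<Rightarrow> bool" where
  "manifold A \<longleftrightarrow> smooth_atlas A \<and> carrier_of A \<noteq> {} \<and>
     Hausdorff_space (atlas_topology A) \<and> second_countable (atlas_topology A) \<and>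
     connected_space (atlas_topology A)"

definition smooth_map ::
    "('a, 'd::euclidean_space) atlas \<Rightarrow> ('b, 'e::euclidean_space) atlas \<Rightarrow> ('a \<Rightarrow> 'b) \<Rightarrow> bool" where
  "smooth_map A B f \<longleftrightarrow>
     continuous_map (atlas_topology A) (atlas_topology B) f \<and>
     (\<forall>(U, \<phi>)\<in>A. \<forall>(W, \<psi>)\<in>B.
        smooth_on (local_rep (U, \<phi>) (W, \<psi>) f) (\<phi> ` {p \<in> U. f p \<in> W}))"

definition immersion ::
    "('a, 'd::euclidean_space) atlas \<Rightarrow> ('b, 'e::euclidean_space) atlas \<Rightarrow> ('a \<Rightarrow> 'b) \<Rightarrow> bool" where
  "immersion A B f \<longleftrightarrow> smooth_map A B f \<and>
     (\<forall>(U, \<phi>)\<in>A. \<forall>(W, \<psi>)\<in>B. \<forall>p\<in>U. f p \<in> W \<longrightarrow>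
        inj (frechet_derivative (local_rep (U, \<phi>) (W, \<psi>) f) (at (\<phi> p))))"

text \<open>The manifold \<^term>\<open>A\<close> lies in \<^term>\<open>B\<close> as a subset, with its own smooth structure and
  topology being those of an embedded submanifold.\<close>

definition embedded_submanifold ::
    "('a, 'd::euclidean_space) atlas \<Rightarrow> ('a, 'e::euclidean_space) atlas \<Rightarrow> bool" where
  "embedded_submanifold A B \<longleftrightarrow>
     carrier_of A \<subseteq> carrier_of B \<and> immersion A B id \<and>
     embedding_map (atlas_topology A) (atlas_topology B) id"

definition diffeomorphism ::
    "('a, 'd::euclidean_space) atlas \<Rightarrow> ('b, 'e::euclidean_space) atlas \<Rightarrow> ('a \<Rightarrow> 'b) \<Rightarrow> bool" where
  "diffeomorphism A B f \<longleftrightarrow>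
     bij_betw f (carrier_of A) (carrier_of B) \<and> smooth_map A B f \<and>
     smooth_map B A (inv_into (carrier_of A) f)"

definition diffeomorphic ::
    "('a, 'd::euclidean_space) atlas \<Rightarrow> ('b, 'e::euclidean_space) atlas \<Rightarrow> bool" where
  "diffeomorphic A B \<longleftrightarrow> (\<exists>f. diffeomorphism A B f)"

text \<open>An oriented surface is given by an oriented atlas: the orientation of each tangent plane is
  the one making the coordinate frame of every chart positive.\<close>

definition oriented_surface :: "('a, real^2) atlas \<Rightarrow> bool" where
  "oriented_surface A \<longleftrightarrow> manifold A \<and>
     (\<forall>(U, \<phi>)\<in>A. \<forall>(W, \<psi>)\<in>A. \<forall>p\<in>U \<inter> W.
        det (matrix (frechet_derivative (transition (U, \<phi>) (W, \<psi>)) (at (\<phi> p)))) > 0)"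

definition closed_oriented_surface :: "('a, real^2) atlas \<Rightarrow> bool" where
  "closed_oriented_surface A \<longleftrightarrow> oriented_surface A \<and> compact_space (atlas_topology A)"

text \<open>The unit sphere in \<open>\<real>\<^sup>3\<close>, with the two stereographic projections as charts.\<close>

definition S2_atlas :: "(real^3, real^2) atlas" where
  "S2_atlas =
     {(sphere 0 1 - {axis 3 1},  \<lambda>x. vector [x$1 / (1 - x$3), x$2 / (1 - x$3)]),
      (sphere 0 1 - {- axis 3 1}, \<lambda>x. vector [x$1 / (1 + x$3), x$2 / (1 + x$3)])}"


section \<open>The complex plane \<open>V\<close>\<close>

text \<open>The type \<^typ>\<open>'v\<close> plays the role of \<open>V\<close>. Its real vector space structure and real inner
  product are those underlying the complex scalar multiplication and the Hermitian inner product
  (which is complex linear in its first argument), so that \<^term>\<open>norm y\<close> is \<open>|y|\<close>.\<close>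

locale hermitian_plane = vector_space scaleC
  for scaleC :: "complex \<Rightarrow> 'v::euclidean_space \<Rightarrow> 'v" +
  fixes herm :: "'v \<Rightarrow> 'v \<Rightarrow> complex"
  assumes scaleC_of_real: "scaleC (of_real r) x = r *\<^sub>R x"
    and herm_add_left: "herm (x + y) z = herm x z + herm y z"
    and herm_scale_left: "herm (scaleC c x) y = c * herm x y"
    and herm_cnj: "herm y x = cnj (herm x y)"
    and Re_herm: "Re (herm x y) = x \<bullet> y"
    and dim_2: "dim UNIV = 2"


section \<open>The sphere \<open>S = V \<union> {\<infinity>}\<close>\<close>

text \<open>\<open>S\<close> is the type \<^typ>\<open>'v option\<close>, where \<^term>\<open>None\<close> stands for \<open>\<infinity>\<close>.\<close>

fun inversion_chart :: "'v::euclidean_space option \<Rightarrow> 'v" where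
  "inversion_chart None = 0"
| "inversion_chart (Some y) = y /\<^sub>R (norm y)\<^sup>2"

definition S_atlas :: "('v::euclidean_space option, 'v) atlas" where
  "S_atlas = {(UNIV - {None}, the), (UNIV - {Some 0}, inversion_chart)}"


section \<open>Pseudoholomorphically embedded surfaces in \<open>S\<close>\<close>

definition cline :: "(complex \<Rightarrow> 'w \<Rightarrow> 'w) \<Rightarrow> 'w \<Rightarrow> 'w set" where
  "cline smul w = range (\<lambda>c. smul c w)"

text \<open>\<^term>\<open>(u, v)\<close> is a basis of a complex line, seen as a real plane, that differs by a positive
  determinant from a basis of the form \<open>(e, ie)\<close>.\<close>

definition complex_oriented ::
    "(complex \<Rightarrow> 'v::euclidean_space \<Rightarrow> 'v) \<Rightarrow> 'v \<Rightarrow> 'v \<Rightarrow> bool" where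
  "complex_oriented scaleC u v \<longleftrightarrow>
     (\<exists>e a b c d. e \<noteq> 0 \<and> u = a *\<^sub>R e + b *\<^sub>R scaleC \<i> e \<and> v = c *\<^sub>R e + d *\<^sub>R scaleC \<i> e \<and>
        a * d - b * c > 0)"

definition pseudoholomorphic_immersion ::
    "(complex \<Rightarrow> 'v::euclidean_space \<Rightarrow> 'v) \<Rightarrow> ('a, real^2) atlas \<Rightarrow> ('a \<Rightarrow> 'v option) \<Rightarrow> bool" where
  "pseudoholomorphic_immersion scaleC A f \<longleftrightarrow>
     immersion A S_atlas f \<and>
     (\<forall>(U, \<phi>)\<in>A. \<forall>p\<in>U. f p \<noteq> None \<longrightarrow>
        (let D = frechet_derivative (local_rep (U, \<phi>) (UNIV - {None}, the) f) (at (\<phi> p)) in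
          (\<exists>e. e \<noteq> 0 \<and> range D = cline scaleC e) \<and>
          complex_oriented scaleC (D (axis 1 1)) (D (axis 2 1))))"

definition pseudoholomorphically_embedded ::
    "(complex \<Rightarrow> 'v::euclidean_space \<Rightarrow> 'v) \<Rightarrow> ('v option, real^2) atlas \<Rightarrow> bool" where
  "pseudoholomorphically_embedded scaleC A \<longleftrightarrow>
     embedded_submanifold A S_atlas \<and> pseudoholomorphic_immersion scaleC A id"


section \<open>The projective plane \<open>P\<close>\<close>

definition scale_VC :: "(complex \<Rightarrow> 'v \<Rightarrow> 'v) \<Rightarrow> complex \<Rightarrow> 'v \<times> complex \<Rightarrow> 'v \<times> complex" where
  "scale_VC scaleC c w = (scaleC c (fst w), c * snd w)"

definition proj_point :: "(complex \<Rightarrow> 'v \<Rightarrow> 'v) \<Rightarrow> 'v \<Rightarrow> complex \<Rightarrow> ('v \<times> complex) set" where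
  "proj_point scaleC y z = cline (scale_VC scaleC) (y, z)"

definition proj_plane :: "(complex \<Rightarrow> 'v::zero \<Rightarrow> 'v) \<Rightarrow> ('v \<times> complex) set set" where
  "proj_plane scaleC = {proj_point scaleC y z |y z. (y, z) \<noteq> (0, 0)}"

definition line_at_infinity :: "(complex \<Rightarrow> 'v::zero \<Rightarrow> 'v) \<Rightarrow> ('v \<times> complex) set set" where
  "line_at_infinity scaleC = {proj_point scaleC y 0 |y. y \<noteq> 0}"

definition projective_line ::
    "(complex \<Rightarrow> 'v::ab_group_add \<Rightarrow> 'v) \<Rightarrow> ('v \<times> complex) set set \<Rightarrow> bool" where
  "projective_line scaleC L \<longleftrightarrow>
     (\<exists>W. module.subspace (scale_VC scaleC) W \<and> vector_space.dim (scale_VC scaleC) W = 2 \<and>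
        L = {l \<in> proj_plane scaleC. l \<subseteq> W})"

definition pr :: "(complex \<Rightarrow> 'v::zero \<Rightarrow> 'v) \<Rightarrow> ('v \<times> complex) set \<Rightarrow> 'v option" where
  "pr scaleC l = (THE s. \<exists>y z. (y, z) \<noteq> (0, 0) \<and> l = proj_point scaleC y z \<and>
     s = (if z \<noteq> 0 then Some (scaleC (1 / z) y) else None))"

lemma (in hermitian_plane) pr_proj_point:
  assumes "(y, z) \<noteq> (0, 0)"
  shows "pr scaleC (proj_point scaleC y z) = (if z \<noteq> 0 then Some (scaleC (1 / z) y) else None)"
proof -
  have unique: "(if w \<noteq> 0 then Some (scaleC (1 / w) x) else None) =
      (if z \<noteq> 0 then Some (scaleC (1 / z) y) else None)"
    if xw: "(x, w) \<noteq> (0, 0)" and eq: "proj_point scaleC y z = proj_point scaleC x w" for x w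
  proof -
    have "(x, w) \<in> proj_point scaleC x w"
      by (auto simp: proj_point_def cline_def scale_VC_def intro: range_eqI[of _ _ 1])
    then obtain c where c: "x = scaleC c y" "w = c * z"
      unfolding eq[symmetric] by (auto simp: proj_point_def cline_def scale_VC_def)
    then have "c \<noteq> 0"
      using xw by auto
    with c show ?thesis
      by simp
  qed
  show ?thesis
    unfolding pr_def by (rule the_equality) (use assms unique in blast)+
qed

lemma (in hermitian_plane) vector_space_VC: "vector_space (scale_VC scaleC)"
  by unfold_locales
    (auto simp: scale_VC_def prod_eq_iff scale_right_distrib scale_left_distrib algebra_simps)

end

theory Submission
  imports Defs "HOL-Complex_Analysis.Conformal_Mappings"
begin

text \<open>Away from \<open>\<infinity>\<close>, a closed surface pseudoholomorphically embedded in \<open>S\<close> is a closed subset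
  \<open>M\<close> of \<open>V\<close> that is locally the image of a holomorphic embedding of a disc. A maximum principle
  argument shows that \<open>M\<close> has no nonempty compact open subset; in particular the surface passes
  through \<open>\<infinity>\<close>. In the chart \<open>\<Phi>\<close> its tangent plane \<open>T\<close> at \<open>\<infinity>\<close> is a limit of complex lines,
  hence a complex line. Let \<open>z\<close> and \<open>w\<close> be the coordinates along \<open>T\<close> and along its orthogonal
  complement. In the chart \<open>\<Phi>\<close> the coordinate \<open>w\<close> vanishes to second order at \<open>\<infinity>\<close>, and
  \<open>w(y) = |y|\<^sup>2 w(\<Phi>(y))\<close>, so \<open>w\<close> is bounded on \<open>M\<close>. By a Phragmen-Lindelof argument \<open>|w|\<close>
  attains its maximum, and the maximum principle makes \<open>w\<close> constant: \<open>M\<close> is an affine complex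
  line. Conversely, with the charts \<open>z\<close> and \<open>1/z\<close>, each affine complex line together with \<open>\<infinity>\<close> is
  an embedded surface, and these sets are the \<open>pr\<close>-images of the projective lines other than \<open>H\<close>.\<close>

section \<open>Smooth maps\<close>

text \<open>Nothing is assumed about complex structure at infinity, and \<Phi> is not holomorphic:
  its differential is a scaled reflection. Near infinity the tangent planes of M are therefore
  reflected images of the planes seen in \<Phi>. Along a path entering infinity in a direction e of
  T, the reflections converge to the one that negates e. The reflected T is thus a complex line
  containing e, so it is the complex span of e; that span is preserved by the reflection and hence
  equals T. M is not compact, so a bounded w need not attain its maximum modulus. Dividing w^n by z
  forces decay at infinity, and a large n makes the quotient outweigh its values on an inner
  boundary |z| = r. Embeddedness supplies a single end: all far points of M lie in the image of one
  punctured disc. A level set of w that reaches this end contains it, and the rest of M is then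
  compact and relatively open, hence empty. The atlas of a given surface is arbitrary, so knowing
  its underlying set does not yet give a diffeomorphism with the sphere. The inverse function
  theorem is applied in its own charts.\<close>

lemma Ck_on_cong:
  assumes "open U" "\<And>x. x \<in> U \<Longrightarrow> f x = g x" "Ck_on k f U"
  shows "Ck_on k g U"
  using assms(2,3)
proof (induction k arbitrary: f g)
  case 0
  then show ?case by (simp cong: continuous_on_cong)
next
  case (Suc k)
  have g: "(g has_derivative frechet_derivative f (at x)) (at x)" if "x \<in> U" for x
    using Suc.prems that has_derivative_transform_within_open[OF _ assms(1) that, of f _ UNIV g]
    by (simp add: frechet_derivative_works)
  then have "frechet_derivative g (at x) = frechet_derivative f (at x)" if "x \<in> U" for x
    using frechet_derivative_at that by metis
  moreover have "g differentiable (at x)" if "x \<in> U" for x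
    using g[OF that] differentiable_def by blast
  ultimately show ?case
    using Suc.prems by (auto intro: Suc.IH[rotated])
qed

text \<open>Lets the inductions below use an explicit derivative formula in place of
  \<open>frechet_derivative\<close>; agreement on the open set \<open>U\<close> suffices because the
  condition is local there.\<close>

lemma Ck_on_SucI:
  assumes "open U" "\<And>x. x \<in> U \<Longrightarrow> (f has_derivative f' x) (at x)" "\<And>v. Ck_on k (\<lambda>x. f' x v) U"
  shows "Ck_on (Suc k) f U"
proof -
  have "frechet_derivative f (at x) = f' x" if "x \<in> U" for x
    using assms(2)[OF that] frechet_derivative_at by metis
  moreover have "f differentiable (at x)" if "x \<in> U" for x
    using assms(2)[OF that] differentiable_def by blast
  ultimately show ?thesis
    using Ck_on_cong[OF assms(1) _ assms(3)] by auto
qed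

lemma Ck_on_Suc_has_derivative:
  "Ck_on (Suc k) f U \<Longrightarrow> x \<in> U \<Longrightarrow> (f has_derivative frechet_derivative f (at x)) (at x)"
  by (simp add: frechet_derivative_works)

lemma Ck_on_Suc_imp: "Ck_on (Suc k) f U \<Longrightarrow> Ck_on k f U"
proof (induction k arbitrary: f)
  case 0
  then show ?case
    by (auto intro!: differentiable_imp_continuous_on differentiable_at_imp_differentiable_on)
next
  case (Suc k)
  then show ?case by (metis Ck_on.simps(2))
qed

lemma Ck_on_subset: "Ck_on k f U \<Longrightarrow> W \<subseteq> U \<Longrightarrow> Ck_on k f W"
  by (induction k arbitrary: f) (auto intro: continuous_on_subset)

lemma Ck_on_const: "open U \<Longrightarrow> Ck_on k (\<lambda>x. c) U"
proof (induction k arbitrary: c)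
  case (Suc k)
  show ?case
    by (rule Ck_on_SucI[where f' = "\<lambda>_ _. 0"]) (use Suc in auto)
qed auto

lemma Ck_on_add:
  "open U \<Longrightarrow> Ck_on k f U \<Longrightarrow> Ck_on k g U \<Longrightarrow> Ck_on k (\<lambda>x. f x + g x) U"
proof (induction k arbitrary: f g)
  case (Suc k)
  show ?case
  proof (rule Ck_on_SucI)
    show "((\<lambda>x. f x + g x) has_derivative
        (\<lambda>v. frechet_derivative f (at x) v + frechet_derivative g (at x) v)) (at x)"
      if "x \<in> U" for x
      using Suc.prems that by (intro has_derivative_add Ck_on_Suc_has_derivative)
  qed (use Suc in auto)
qed (auto intro: continuous_intros)

lemma Ck_on_sum:
  "open U \<Longrightarrow> (\<And>i. i \<in> I \<Longrightarrow> Ck_on k (f i) U) \<Longrightarrow> Ck_on k (\<lambda>x. \<Sum>i\<in>I. f i x) U"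
  by (induction I rule: infinite_finite_induct) (auto intro: Ck_on_const Ck_on_add)

lemma Ck_on_bounded_linear:
  "bounded_linear L \<Longrightarrow> open U \<Longrightarrow> Ck_on k f U \<Longrightarrow> Ck_on k (\<lambda>x. L (f x)) U"
proof (induction k arbitrary: f)
  case 0
  then show ?case by (simp add: bounded_linear.continuous_on)
next
  case (Suc k)
  show ?case
  proof (rule Ck_on_SucI)
    show "((\<lambda>x. L (f x)) has_derivative (\<lambda>v. L (frechet_derivative f (at x) v))) (at x)"
      if "x \<in> U" for x
      using bounded_linear.has_derivative[OF Suc.prems(1) Ck_on_Suc_has_derivative[OF Suc.prems(3) that]] .
  qed (use Suc in auto)
qed

lemma Ck_on_bounded_bilinear:
  assumes "bounded_bilinear B"
  shows "open U \<Longrightarrow> Ck_on k f U \<Longrightarrow> Ck_on k g U \<Longrightarrow> Ck_on k (\<lambda>x. B (f x) (g x)) U"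
proof (induction k arbitrary: f g)
  case 0
  then show ?case by (simp add: bounded_bilinear.continuous_on[OF assms])
next
  case (Suc k)
  show ?case
  proof (rule Ck_on_SucI)
    show "((\<lambda>x. B (f x) (g x)) has_derivative (\<lambda>v. B (f x) (frechet_derivative g (at x) v) +
        B (frechet_derivative f (at x) v) (g x))) (at x)"
      if "x \<in> U" for x
      using Suc.prems that
      by (intro bounded_bilinear.FDERIV[OF assms] Ck_on_Suc_has_derivative)
    show "Ck_on k (\<lambda>x. B (f x) (frechet_derivative g (at x) v) +
        B (frechet_derivative f (at x) v) (g x)) U" for v
      using Suc.prems Ck_on_Suc_imp[OF Suc.prems(2)] Ck_on_Suc_imp[OF Suc.prems(3)]
      by (intro Ck_on_add Suc.IH) auto
  qed (use Suc in auto)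
qed

lemma Ck_on_id: "open U \<Longrightarrow> Ck_on k (\<lambda>x. x) U"
proof (cases k)
  case (Suc j)
  assume "open U"
  then show ?thesis
    unfolding Suc by (intro Ck_on_SucI[where f' = "\<lambda>_ v. v"] Ck_on_const) auto
qed auto

lemma Ck_on_compose:
  assumes "open U" "open W"
  shows "f ` U \<subseteq> W \<Longrightarrow> Ck_on k f U \<Longrightarrow> Ck_on k g W \<Longrightarrow> Ck_on k (\<lambda>x. g (f x)) U"
proof (induction k arbitrary: g)
  case 0
  then show ?case by (auto intro: continuous_on_compose2)
next
  case (Suc k)
  let ?Df = "\<lambda>x. frechet_derivative f (at x)" and ?Dg = "\<lambda>y. frechet_derivative g (at y)"
  show ?case
  proof (rule Ck_on_SucI[OF assms(1)])
    fix x assume x: "x \<in> U"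
    then have fx: "f x \<in> W" using Suc.prems(1) by auto
    have lin: "linear (?Dg (f x))"
      using Ck_on_Suc_has_derivative[OF Suc.prems(3) fx] has_derivative_linear by blast
    \<comment> \<open>The direction \<open>?Df x v\<close> varies with \<open>x\<close>, whereas the
      induction hypothesis speaks of fixed directions only. Expanding it in the basis separates the
      two dependences.\<close>
    have "?Dg (f x) (?Df x v) = (\<Sum>b\<in>Basis. (?Df x v \<bullet> b) *\<^sub>R ?Dg (f x) b)" for v
      by (subst euclidean_representation[of "?Df x v", symmetric])
        (simp add: linear_sum[OF lin] linear_scale[OF lin])
    moreover have "((\<lambda>x. g (f x)) has_derivative (\<lambda>v. ?Dg (f x) (?Df x v))) (at x)"
      using has_derivative_compose[OF Ck_on_Suc_has_derivative[OF Suc.prems(2) x]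
          Ck_on_Suc_has_derivative[OF Suc.prems(3) fx]] .
    ultimately show "((\<lambda>x. g (f x)) has_derivative
        (\<lambda>v. \<Sum>b\<in>Basis. (?Df x v \<bullet> b) *\<^sub>R ?Dg (f x) b)) (at x)"
      by simp
  next
    fix v
    have "Ck_on k (\<lambda>x. ?Df x v \<bullet> b) U" for b
      using Suc.prems(2) by (intro Ck_on_bounded_linear[OF bounded_linear_inner_left] assms) auto
    moreover have "Ck_on k (\<lambda>x. ?Dg (f x) b) U" for b
      using Suc.prems Ck_on_Suc_imp[OF Suc.prems(2)] by (intro Suc.IH) auto
    ultimately show "Ck_on k (\<lambda>x. \<Sum>b\<in>Basis. (?Df x v \<bullet> b) *\<^sub>R ?Dg (f x) b) U"
      by (intro Ck_on_sum Ck_on_bounded_bilinear[OF bounded_bilinear_scaleR] assms)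
  qed
qed

lemma Ck_on_inverse:
  fixes f :: "'a::euclidean_space \<Rightarrow> real"
  assumes "open U"
  shows "(\<And>x. x \<in> U \<Longrightarrow> f x \<noteq> 0) \<Longrightarrow> Ck_on k f U \<Longrightarrow> Ck_on k (\<lambda>x. inverse (f x)) U"
proof (induction k)
  case 0
  then show ?case by (auto intro: continuous_intros)
next
  case (Suc k)
  show ?case
  proof (rule Ck_on_SucI[OF assms])
    \<comment> \<open>The sign is kept as a factor -1, so that the product rule alone covers the
      derivative.\<close>
    show "((\<lambda>x. inverse (f x)) has_derivative
        (\<lambda>v. (-1) * (inverse (f x) * frechet_derivative f (at x) v * inverse (f x)))) (at x)"
      if "x \<in> U" for x
      using Deriv.has_derivative_inverse[OF Suc.prems(1) Ck_on_Suc_has_derivative[OF Suc.prems(2) that]]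
        that by simp
    show "Ck_on k (\<lambda>x. (-1) * (inverse (f x) * frechet_derivative f (at x) v * inverse (f x))) U"
      for v
      using Suc Ck_on_Suc_imp[OF Suc.prems(2)] assms
      by (intro Ck_on_bounded_bilinear[OF bounded_bilinear_mult] Ck_on_const) auto
  qed
qed

lemma smooth_on_cong:
  "open U \<Longrightarrow> (\<And>x. x \<in> U \<Longrightarrow> f x = g x) \<Longrightarrow> smooth_on f U \<longleftrightarrow> smooth_on g U"
  unfolding smooth_on_def using Ck_on_cong[of U f g] Ck_on_cong[of U g f] by auto

lemma smooth_on_subset: "smooth_on f U \<Longrightarrow> W \<subseteq> U \<Longrightarrow> smooth_on f W"
  unfolding smooth_on_def using Ck_on_subset by blast

lemma smooth_on_const: "open U \<Longrightarrow> smooth_on (\<lambda>x. c) U"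
  unfolding smooth_on_def using Ck_on_const by blast

lemma smooth_on_id: "open U \<Longrightarrow> smooth_on (\<lambda>x. x) U"
  unfolding smooth_on_def using Ck_on_id by blast

lemma smooth_on_add:
  "open U \<Longrightarrow> smooth_on f U \<Longrightarrow> smooth_on g U \<Longrightarrow> smooth_on (\<lambda>x. f x + g x) U"
  unfolding smooth_on_def using Ck_on_add by blast

lemma smooth_on_bounded_linear:
  "bounded_linear L \<Longrightarrow> open U \<Longrightarrow> smooth_on f U \<Longrightarrow> smooth_on (\<lambda>x. L (f x)) U"
  unfolding smooth_on_def using Ck_on_bounded_linear by blast

lemma smooth_on_bounded_bilinear:
  "bounded_bilinear B \<Longrightarrow> open U \<Longrightarrow> smooth_on f U \<Longrightarrow> smooth_on g U \<Longrightarrow>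
    smooth_on (\<lambda>x. B (f x) (g x)) U"
  unfolding smooth_on_def using Ck_on_bounded_bilinear by blast

lemmas smooth_on_scaleR = smooth_on_bounded_bilinear[OF bounded_bilinear_scaleR]
lemmas smooth_on_mult = smooth_on_bounded_bilinear[OF bounded_bilinear_mult[where 'a=real]]
lemmas smooth_on_inner = smooth_on_bounded_bilinear[OF bounded_bilinear_inner]

lemma smooth_on_diff:
  assumes "open U" "smooth_on f U" "smooth_on g U"
  shows "smooth_on (\<lambda>x. f x - g x) U"
  using smooth_on_add[OF assms(1,2) smooth_on_bounded_linear[OF bounded_linear_minus[OF bounded_linear_ident] assms(1,3)]]
  by simp

lemma smooth_on_compose:
  "open U \<Longrightarrow> open W \<Longrightarrow> f ` U \<subseteq> W \<Longrightarrow> smooth_on f U \<Longrightarrow> smooth_on g W \<Longrightarrow>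
    smooth_on (\<lambda>x. g (f x)) U"
  unfolding smooth_on_def using Ck_on_compose by blast

lemma smooth_on_inverse:
  fixes f :: "'a::euclidean_space \<Rightarrow> real"
  shows "open U \<Longrightarrow> (\<And>x. x \<in> U \<Longrightarrow> f x \<noteq> 0) \<Longrightarrow> smooth_on f U \<Longrightarrow>
    smooth_on (\<lambda>x. inverse (f x)) U"
  unfolding smooth_on_def using Ck_on_inverse[of U f] by blast

lemma smooth_on_linear: "linear f \<Longrightarrow> open U \<Longrightarrow> smooth_on f U"
  using smooth_on_bounded_linear[OF _ _ smooth_on_id] by (simp add: linear_conv_bounded_linear)

lemma smooth_on_has_derivative:
  "smooth_on f U \<Longrightarrow> x \<in> U \<Longrightarrow> (f has_derivative frechet_derivative f (at x)) (at x)"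
  unfolding smooth_on_def using Ck_on_Suc_has_derivative by blast

lemma smooth_on_frechet_derivative:
  "smooth_on f U \<Longrightarrow> smooth_on (\<lambda>x. frechet_derivative f (at x) v) U"
  unfolding smooth_on_def by (metis Ck_on.simps(2))

lemma smooth_on_continuous: "smooth_on f U \<Longrightarrow> continuous_on U f"
  unfolding smooth_on_def by (metis Ck_on.simps(1))

text \<open>The inverse of an injective smooth map with invertible derivatives gains regularity one
  order at a time, because its derivative is a rational expression in the derivative of the map
  at the preimage.\<close>

lemma smooth_on_inv_into_plane:
  fixes u :: "real^2 \<Rightarrow> real^2"
  assumes U: "open U" and u: "smooth_on u U" and inj: "inj_on u U"
    and D: "\<And>x. x \<in> U \<Longrightarrow> inj (frechet_derivative u (at x))"
  shows "open (u ` U)" and "smooth_on (inv_into U u) (u ` U)"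
proof -
  have cont: "continuous_on U u" using u by (rule smooth_on_continuous)
  show opn: "open (u ` U)"
    using invariance_of_domain[OF cont U inj] .
  define k where "k = inv_into U u"
  have kc: "continuous_on (u ` U) k"
  proof -
    obtain g where g: "homeomorphism U (u ` U) u g"
      using invariance_of_domain_homeomorphism[OF U cont _ inj] by auto
    then have "k y = g y" if "y \<in> u ` U" for y
      using that inj by (auto simp: k_def homeomorphism_def)
    then show ?thesis
      using g by (simp add: homeomorphism_def cong: continuous_on_cong)
  qed
  have ku: "k (u x) = x" if "x \<in> U" for x
    using that inj by (simp add: k_def)
  have kU: "k y \<in> U" "u (k y) = y" if "y \<in> u ` U" for y
    using that by (auto simp: k_def inv_into_into f_inv_into_f)
  define d where "d i x = frechet_derivative u (at x) (axis i 1)" for i :: 2 and x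
  have du: "smooth_on (\<lambda>x. d i x $ j) U" for i j
    unfolding d_def using u
    by (intro smooth_on_bounded_linear[OF bounded_linear_vec_nth] U smooth_on_frechet_derivative)
  \<comment> \<open>The Jacobian determinant; \<open>d 1 x\<close> and \<open>d 2 x\<close> are the
    columns of the Jacobian matrix.\<close>
  define e where "e x = d 1 x $ 1 * d 2 x $ 2 + (-1) * (d 1 x $ 2 * d 2 x $ 1)" for x
  have Du: "frechet_derivative u (at x) v = v $ 1 *\<^sub>R d 1 x + v $ 2 *\<^sub>R d 2 x" if "x \<in> U" for x and v :: "real^2"
  proof -
    have lin: "linear (frechet_derivative u (at x))"
      using smooth_on_has_derivative[OF u that] has_derivative_linear by blast
    have "v = v $ 1 *\<^sub>R axis 1 1 + v $ 2 *\<^sub>R axis 2 1"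
      by (simp add: vec_eq_iff forall_2 axis_def)
    then show ?thesis
      unfolding d_def by (metis linear_add[OF lin] linear_scale[OF lin])
  qed
  have e0: "e x \<noteq> 0" if "x \<in> U" for x
  proof
    assume e: "e x = 0"
    have sol: "v = 0" if "v $ 1 *\<^sub>R d 1 x + v $ 2 *\<^sub>R d 2 x = 0" for v :: "real^2"
    proof -
      have "frechet_derivative u (at x) v = frechet_derivative u (at x) 0"
        using Du[OF \<open>x \<in> U\<close>] that by simp
      then show ?thesis using D[OF \<open>x \<in> U\<close>] by (auto dest: injD)
    qed
    \<comment> \<open>If the determinant vanishes, the columns of the adjugate matrix lie in the
      kernel. They are zero by injectivity, so the first column of the Jacobian is zero, and then
      \<open>axis 1 1\<close> lies in the kernel.\<close>
    have "vector [d 2 x $ 1, - d 1 x $ 1] = (0::real^2)"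
      by (rule sol) (use e in \<open>simp add: vec_eq_iff forall_2 e_def algebra_simps\<close>)
    moreover have "vector [d 2 x $ 2, - d 1 x $ 2] = (0::real^2)"
      by (rule sol) (use e in \<open>simp add: vec_eq_iff forall_2 e_def algebra_simps\<close>)
    ultimately have "d 1 x = 0"
      by (simp add: vec_eq_iff forall_2)
    then have "axis 1 1 = (0::real^2)"
      by - (rule sol, simp add: axis_def)
    then show False by (simp add: axis_eq_0_iff)
  qed
  have e: "smooth_on e U"
    unfolding e_def using du U by (intro smooth_on_add smooth_on_mult smooth_on_const)
  \<comment> \<open>Cramer's rule: the adjugate divided by the determinant, that is, the inverse of
    the derivative at \<open>x\<close>.\<close>
  define L where "L x v = (inverse (e x) * (d 2 x $ 2 * v $ 1 + (-1) * (d 2 x $ 1 * v $ 2))) *\<^sub>R axis 1 1 +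
     (inverse (e x) * (d 1 x $ 1 * v $ 2 + (-1) * (d 1 x $ 2 * v $ 1))) *\<^sub>R (axis 2 1 :: real^2)" for x and v :: "real^2"
  have L: "smooth_on (\<lambda>x. L x v) U" for v
    unfolding L_def using e du U e0
    by (intro smooth_on_add smooth_on_scaleR smooth_on_mult smooth_on_const smooth_on_inverse)
  have LD: "L x (frechet_derivative u (at x) v) = v" if "x \<in> U" for x and v :: "real^2"
  proof -
    let ?w = "frechet_derivative u (at x) v"
    have "d 2 x $ 2 * ?w $ 1 + (-1) * (d 2 x $ 1 * ?w $ 2) = e x * v $ 1"
      "d 1 x $ 1 * ?w $ 2 + (-1) * (d 1 x $ 2 * ?w $ 1) = e x * v $ 2"
      by (simp_all add: Du[OF that] e_def algebra_simps)
    then show ?thesis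
      unfolding L_def using e0[OF that] by (simp add: vec_eq_iff forall_2 axis_def)
  qed
  have linL: "bounded_linear (L x)" for x
    unfolding L_def by (intro bounded_linear_intros bounded_linear_vec_nth)
  have kder: "(k has_derivative L (k y)) (at y)" if "y \<in> u ` U" for y
  proof -
    have "(k has_derivative L (k y)) (at (u (k y)))"
    proof (rule has_derivative_inverse_basic_x[where f = u and x = "k y" and T = "u ` U"])
      show "(u has_derivative frechet_derivative u (at (k y))) (at (k y))"
        using smooth_on_has_derivative[OF u] kU that by blast
      show "L (k y) \<circ> frechet_derivative u (at (k y)) = id"
        using LD kU that by (auto simp: fun_eq_iff)
      show "continuous (at (u (k y))) k"
        using kc opn that kU(2)[OF that] by (metis continuous_on_eq_continuous_at)
    qed (use linL opn that ku kU in auto)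
    then show ?thesis
      using kU that by simp
  qed
  have "Ck_on n k (u ` U)" for n
  proof (induction n)
    case 0
    show ?case using kc by simp
  next
    case (Suc n)
    show ?case
    proof (rule Ck_on_SucI[OF opn kder])
      show "Ck_on n (\<lambda>y. L (k y) v) (u ` U)" for v
        using L[of v] kU by (intro Ck_on_compose[OF opn U _ Suc]) (auto simp: smooth_on_def)
    qed
  qed
  then show "smooth_on (inv_into U u) (u ` U)"
    by (auto simp: smooth_on_def k_def)
qed

section \<open>Local estimates and local injectivity from the derivative\<close>

lemma has_derivative_directional_limit:
  assumes "(f has_derivative D) (at x)" "f x = 0"
  shows "((\<lambda>t. f (x + t *\<^sub>R w) /\<^sub>R t) \<longlongrightarrow> D w) (at_right 0)"
proof -
  have "(f has_derivative D) (at (x + 0 *\<^sub>R w))"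
    using assms(1) by simp
  moreover have "((\<lambda>t. x + t *\<^sub>R w) has_derivative (\<lambda>s. s *\<^sub>R w)) (at 0)"
    by (auto intro!: derivative_eq_intros)
  ultimately have "((\<lambda>t. f (x + t *\<^sub>R w)) has_derivative (\<lambda>s. D (s *\<^sub>R w))) (at 0)"
    using has_derivative_compose[of "\<lambda>t. x + t *\<^sub>R w" _ 0 UNIV f D] by simp
  then have "(\<lambda>h. norm (f (x + h *\<^sub>R w) - D (h *\<^sub>R w)) / norm h) \<midarrow>0\<rightarrow> 0"
    using assms(2) by (simp add: has_derivative_at)
  moreover have "norm (f (x + h *\<^sub>R w) - D (h *\<^sub>R w)) / norm h = norm (f (x + h *\<^sub>R w) /\<^sub>R h - D w)"
    if "h \<noteq> 0" for h
  proof -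
    have "D (h *\<^sub>R w) = h *\<^sub>R D w"
      using assms(1) has_derivative_linear linear_scale by blast
    then have "f (x + h *\<^sub>R w) - D (h *\<^sub>R w) = h *\<^sub>R (f (x + h *\<^sub>R w) /\<^sub>R h - D w)"
      using that by (simp add: scaleR_diff_right)
    then show ?thesis
      using that by simp
  qed
  ultimately have "(\<lambda>h. norm (f (x + h *\<^sub>R w) /\<^sub>R h - D w)) \<midarrow>0\<rightarrow> 0"
    by (auto intro: Lim_transform_eventually simp: eventually_at_filter)
  then have "(\<lambda>h. f (x + h *\<^sub>R w) /\<^sub>R h - D w) \<midarrow>0\<rightarrow> 0"
    by (rule tendsto_norm_zero_cancel)
  then have "(\<lambda>h. f (x + h *\<^sub>R w) /\<^sub>R h) \<midarrow>0\<rightarrow> D w"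
    by (rule LIM_zero_cancel)
  then show ?thesis
    by (rule filterlim_mono) (auto simp: at_within_le_at)
qed

text \<open>By the chain rule, the derivative of a local left inverse is a left inverse of the
  derivative.\<close>

lemma inj_frechet_derivative_left_inverse:
  assumes "(f has_derivative f') (at x)" "(h has_derivative h') (at (f x))"
    and "open T" "x \<in> T" "\<And>y. y \<in> T \<Longrightarrow> h (f y) = y"
  shows "inj f'"
proof -
  have "((\<lambda>y. h (f y)) has_derivative (\<lambda>v. h' (f' v))) (at x)"
    by (rule has_derivative_compose[OF assms(1,2)])
  moreover have "((\<lambda>y. h (f y)) has_derivative (\<lambda>v. v)) (at x)"
    by (rule has_derivative_transform_within_open[OF has_derivative_ident assms(3,4)])
      (simp add: assms(5))
  ultimately have "(\<lambda>v. h' (f' v)) = (\<lambda>v. v)"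
    by (rule has_derivative_unique)
  then show ?thesis
    by (metis injI)
qed

lemma has_derivative_local_upper_bound:
  assumes "(f has_derivative f') (at x0)"
  shows "\<exists>K \<rho>. \<rho> > 0 \<and> (\<forall>x\<in>ball x0 \<rho>. norm (f x - f x0) \<le> K * norm (x - x0))"
proof -
  have bl: "bounded_linear f'"
    and *: "\<forall>e>0. \<exists>d>0. \<forall>y. norm (y - x0) < d \<longrightarrow> norm (f y - f x0 - f' (y - x0)) \<le> e * norm (y - x0)"
    using assms by (auto simp: has_derivative_at_alt)
  obtain d where d: "d > 0" "\<And>y. norm (y - x0) < d \<Longrightarrow>
      norm (f y - f x0 - f' (y - x0)) \<le> 1 * norm (y - x0)"
    using * zero_less_one by blast
  obtain K where K: "\<And>v. norm (f' v) \<le> norm v * K"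
    using bounded_linear.bounded[OF bl] by blast
  have "norm (f x - f x0) \<le> (1 + K) * norm (x - x0)" if "x \<in> ball x0 d" for x
  proof -
    have "norm (f x - f x0 - f' (x - x0)) \<le> norm (x - x0)"
      using d(2)[of x] that by (simp add: dist_norm norm_minus_commute)
    then show ?thesis
      using K[of "x - x0"] norm_triangle_sub[of "f x - f x0" "f' (x - x0)"]
      by (simp add: algebra_simps)
  qed
  then show ?thesis
    using d(1) by blast
qed

text \<open>An injective linear map of finite-dimensional spaces is bounded below by some
  \<open>B\<close>, and close to \<open>x0\<close> the remainder uses up at most half of
  \<open>B\<close>.\<close>

lemma has_derivative_local_lower_bound:
  fixes f :: "'a::euclidean_space \<Rightarrow> 'b::euclidean_space"
  assumes "(f has_derivative f') (at x0)" "inj f'"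
  shows "\<exists>c \<rho>. c > 0 \<and> \<rho> > 0 \<and> (\<forall>x\<in>ball x0 \<rho>. c * norm (x - x0) \<le> norm (f x - f x0))"
proof -
  have lin: "linear f'"
    and *: "\<forall>e>0. \<exists>d>0. \<forall>y. norm (y - x0) < d \<longrightarrow> norm (f y - f x0 - f' (y - x0)) \<le> e * norm (y - x0)"
    using assms by (auto simp: has_derivative_at_alt linear_conv_bounded_linear)
  obtain B where B: "B > 0" "\<And>v. B * norm v \<le> norm (f' v)"
    using linear_inj_bounded_below_pos[OF lin assms(2)] by blast
  obtain d where d: "d > 0" "\<And>y. norm (y - x0) < d \<Longrightarrow>
      norm (f y - f x0 - f' (y - x0)) \<le> B / 2 * norm (y - x0)"
    using * B(1) half_gt_zero by blast
  have "B / 2 * norm (x - x0) \<le> norm (f x - f x0)" if "x \<in> ball x0 d" for x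
  proof -
    have "norm (f x - f x0 - f' (x - x0)) \<le> B / 2 * norm (x - x0)"
      using d(2)[of x] that by (simp add: dist_norm norm_minus_commute)
    then show ?thesis
      using B(2)[of "x - x0"] norm_triangle_sub[of "f' (x - x0)" "f x - f x0"]
      by (simp add: norm_minus_commute)
  qed
  then show ?thesis
    using d(1) B(1) half_gt_zero by blast
qed

lemma linear_norm_le_sum_Basis:
  fixes L :: "'a::euclidean_space \<Rightarrow> 'b::real_normed_vector"
  assumes "linear L"
  shows "norm (L v) \<le> (\<Sum>b\<in>Basis. norm (L b)) * norm v"
proof -
  have "L v = (\<Sum>b\<in>Basis. (v \<bullet> b) *\<^sub>R L b)"
    by (subst euclidean_representation[of v, symmetric])
      (simp add: linear_sum[OF assms] linear_scale[OF assms])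
  also have "norm \<dots> \<le> (\<Sum>b\<in>Basis. norm (L b) * norm v)"
    by (rule sum_norm_le) (metis Basis_le_norm mult.commute mult_left_mono norm_ge_zero norm_scaleR)
  finally show ?thesis
    by (simp add: sum_distrib_right)
qed

text \<open>The derivative depends continuously on the point in operator norm, so the local
  injectivity theorem for continuously differentiable maps applies. Derivatives within half the
  lower bound of the one at \<open>x0\<close> stay injective.\<close>

lemma smooth_on_locally_injective:
  fixes u :: "'a::euclidean_space \<Rightarrow> 'b::euclidean_space"
  assumes U: "open U" "x0 \<in> U" and u: "smooth_on u U"
    and inj: "inj (frechet_derivative u (at x0))"
  obtains r where "r > 0" "ball x0 r \<subseteq> U" "inj_on u (ball x0 r)"
    "\<And>x. x \<in> ball x0 r \<Longrightarrow> inj (frechet_derivative u (at x))"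
proof -
  let ?D = "\<lambda>x. frechet_derivative u (at x)"
  have lin: "linear (?D x)" if "x \<in> U" for x
    using smooth_on_has_derivative[OF u that] has_derivative_linear by blast
  obtain g' where g': "linear g'" "g' \<circ> ?D x0 = id"
    using linear_injective_left_inverse[OF lin[OF U(2)] inj] by blast
  obtain B where B: "B > 0" "\<And>v. B * norm v \<le> norm (?D x0 v)"
    using linear_inj_bounded_below_pos[OF lin[OF U(2)] inj] by blast
  \<comment> \<open>Only directional derivatives are known to be continuous; summing over the
    finitely many basis directions makes the estimate uniform in \<open>v\<close>.\<close>
  have close: "\<exists>d>0. ball x0 d \<subseteq> U \<and> (\<forall>x\<in>ball x0 d. \<forall>v. norm (?D x v - ?D x0 v) \<le> e * norm v)"
    if e: "e > 0" for e
  proof -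
    let ?S = "\<lambda>x. \<Sum>b\<in>Basis. norm (?D x b - ?D x0 b)"
    have "continuous_on U (\<lambda>x. ?D x b)" for b
      using u by (intro smooth_on_continuous smooth_on_frechet_derivative)
    then have "continuous_on U ?S"
      by (intro continuous_intros)
    then have "open (U \<inter> ?S -` {..<e})"
      using U(1) by (intro continuous_open_preimage) auto
    moreover have "x0 \<in> U \<inter> ?S -` {..<e}"
      using U(2) e by simp
    ultimately obtain d where d: "d > 0" "ball x0 d \<subseteq> U \<inter> ?S -` {..<e}"
      using open_contains_ball by blast
    have "norm (?D x v - ?D x0 v) \<le> e * norm v" if x: "x \<in> ball x0 d" for x v
    proof -
      have "x \<in> U" "?S x < e"
        using x d(2) by auto
      then have "norm (?D x v - ?D x0 v) \<le> ?S x * norm v"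
        using linear_norm_le_sum_Basis[OF linear_compose_sub[OF lin lin], of x x0 v] U(2) by simp
      also have "\<dots> \<le> e * norm v"
        using \<open>?S x < e\<close> by (intro mult_right_mono) auto
      finally show ?thesis .
    qed
    then show ?thesis
      using d by blast
  qed
  obtain r1 where r1: "r1 > 0" "ball x0 r1 \<subseteq> U" "inj_on u (ball x0 r1)"
  proof (rule has_derivative_locally_injective[OF U(2,1), of g' ?D u])
    show "bounded_linear g'"
      using g'(1) by (simp add: linear_conv_bounded_linear)
    show "(u has_derivative ?D x) (at x)" if "x \<in> U" for x
      using smooth_on_has_derivative[OF u that] .
    show "\<exists>d>0. \<forall>x. dist x0 x < d \<longrightarrow> onorm (\<lambda>v. ?D x v - ?D x0 v) < e" if "e > 0" for e
    proof -
      obtain d where "d > 0" "\<And>x v. x \<in> ball x0 d \<Longrightarrow> norm (?D x v - ?D x0 v) \<le> e / 2 * norm v"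
        using close[of "e / 2"] \<open>e > 0\<close> by (metis half_gt_zero)
      then have "onorm (\<lambda>v. ?D x v - ?D x0 v) \<le> e / 2" if "dist x0 x < d" for x
        using that \<open>e > 0\<close> by (intro onorm_bound) auto
      then show ?thesis
        using \<open>d > 0\<close> \<open>e > 0\<close> by (intro exI[of _ d]) fastforce
    qed
  qed (use g'(2) in auto)
  obtain r2 where r2: "r2 > 0" "ball x0 r2 \<subseteq> U"
    "\<And>x v. x \<in> ball x0 r2 \<Longrightarrow> norm (?D x v - ?D x0 v) \<le> B / 2 * norm v"
    using close[of "B / 2"] B(1) by auto
  show ?thesis
  proof (rule that[of "min r1 r2"])
    show "inj_on u (ball x0 (min r1 r2))"
      using r1(3) by (rule inj_on_subset) auto
    fix x assume x: "x \<in> ball x0 (min r1 r2)"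
    then have "x \<in> U"
      using r1(2) by auto
    moreover have "v = 0" if v: "?D x v = 0" for v
    proof -
      have "norm (?D x0 v) \<le> B / 2 * norm v"
        using r2(3)[of x v] x v by simp
      then have "B / 2 * norm v \<le> 0"
        using B(2)[of v] by simp
      then show ?thesis
        using B(1) by (simp add: mult_le_0_iff)
    qed
    ultimately show "inj (?D x)"
      using lin[OF \<open>x \<in> U\<close>] linear_injective_0 by blast
  qed (use r1 r2 in auto)
qed

text \<open>The derivative vanishes at \<open>x0\<close> and is itself differentiable there, so its
  norm is at most a multiple of the distance to \<open>x0\<close>. The mean value inequality on a
  closed ball contributes the second factor.\<close>

lemma smooth_on_quadratic_bound:
  fixes g :: "'a::euclidean_space \<Rightarrow> 'b::euclidean_space"
  assumes U: "open U" "x0 \<in> U" and g: "smooth_on g U"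
    and 0: "g x0 = 0" "\<And>v. frechet_derivative g (at x0) v = 0"
  obtains C \<rho> where "\<rho> > 0" "\<And>x. x \<in> ball x0 \<rho> \<Longrightarrow> norm (g x) \<le> C * (norm (x - x0))\<^sup>2"
proof -
  let ?D = "\<lambda>x. frechet_derivative g (at x)"
  have "\<exists>K \<rho>. \<rho> > 0 \<and> (\<forall>x\<in>ball x0 \<rho>. norm (?D x b) \<le> K * norm (x - x0))" for b
    using has_derivative_local_upper_bound[OF
        smooth_on_has_derivative[OF smooth_on_frechet_derivative[OF g] U(2)], of b]
    by (simp add: 0(2))
  then obtain K \<rho> where K: "\<And>b. \<rho> b > 0"
    "\<And>b x. x \<in> ball x0 (\<rho> b) \<Longrightarrow> norm (?D x b) \<le> K b * norm (x - x0)"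
    by metis
  obtain r where r: "r > 0" "ball x0 r \<subseteq> U"
    using U open_contains_ball by blast
  define R where "R = Min (insert r (\<rho> ` Basis))"
  have "finite (insert r (\<rho> ` Basis))"
    by simp
  from Min_le[OF this] have R: "R \<le> r" "\<And>b. b \<in> Basis \<Longrightarrow> R \<le> \<rho> b"
    unfolding R_def by blast+
  have "R > 0"
    unfolding R_def using r(1) K(1) by (subst Min_gr_iff) auto
  note R = this R
  define C where "C = (\<Sum>b\<in>Basis. max 0 (K b))"
  have C: "C \<ge> 0"
    by (auto simp: C_def intro: sum_nonneg)
  have D: "norm (?D x v) \<le> C * norm (x - x0) * norm v" if x: "x \<in> ball x0 R" for x v
  proof -
    have "x \<in> U"
      using x R(2) r(2) by auto
    then have "linear (?D x)"
      using smooth_on_has_derivative[OF g] has_derivative_linear by blast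
    then have "norm (?D x v) \<le> (\<Sum>b\<in>Basis. norm (?D x b)) * norm v"
      by (rule linear_norm_le_sum_Basis)
    also have "(\<Sum>b\<in>Basis. norm (?D x b)) \<le> (\<Sum>b\<in>Basis. max 0 (K b) * norm (x - x0))"
    proof (rule sum_mono)
      fix b :: 'a assume "b \<in> Basis"
      then have "norm (?D x b) \<le> K b * norm (x - x0)"
        using K(2)[of x b] x R(3)[of b] by auto
      also have "\<dots> \<le> max 0 (K b) * norm (x - x0)"
        by (intro mult_right_mono) auto
      finally show "norm (?D x b) \<le> max 0 (K b) * norm (x - x0)" .
    qed
    finally show ?thesis
      by (simp add: C_def sum_distrib_right mult_right_mono)
  qed
  have "norm (g x) \<le> C * (norm (x - x0))\<^sup>2" if x: "x \<in> ball x0 R" for x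
  proof -
    have sub: "y \<in> ball x0 R" "y \<in> U" "norm (y - x0) \<le> norm (x - x0)"
      if "y \<in> cball x0 (norm (x - x0))" for y
      using that x R(2) r(2) by (auto simp: dist_norm norm_minus_commute)
    have "norm (g x - g x0) \<le> (C * norm (x - x0)) * norm (x - x0)"
    proof (rule differentiable_bound[where S = "cball x0 (norm (x - x0))" and f' = ?D])
      show "convex (cball x0 (norm (x - x0)))" by simp
      show "(g has_derivative ?D y) (at y within cball x0 (norm (x - x0)))"
        if "y \<in> cball x0 (norm (x - x0))" for y
        using smooth_on_has_derivative[OF g sub(2)[OF that]] by (rule has_derivative_at_withinI)
      show "onorm (?D y) \<le> C * norm (x - x0)" if "y \<in> cball x0 (norm (x - x0))" for y
      proof (rule onorm_bound)
        show "norm (?D y v) \<le> C * norm (x - x0) * norm v" for v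
          using D[OF sub(1)[OF that], of v] sub(3)[OF that] C
          by (meson mult_left_mono mult_right_mono norm_ge_zero order_trans)
      qed (use C in auto)
    qed (auto simp: dist_norm norm_minus_commute)
    then show ?thesis
      by (simp add: 0(1) power2_eq_square mult.assoc)
  qed
  then show ?thesis
    using that R(1) by blast
qed

section \<open>Inversion and complex coordinates\<close>

text \<open>Division by zero sends the origin to itself, so the involution law and the reciprocal
  law for norms hold without exceptions. Away from 0 this is the chart \<Phi>.\<close>

definition invert :: "'a::real_inner \<Rightarrow> 'a" where
  "invert v = v /\<^sub>R (norm v)\<^sup>2"

lemma norm_invert: "norm (invert v) = inverse (norm v)"
  by (cases "v = 0") (simp_all add: invert_def power2_eq_square)

lemma invert_0 [simp]: "invert 0 = 0"
  by (simp add: invert_def)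

lemma invert_eq_0_iff [simp]: "invert v = 0 \<longleftrightarrow> v = 0"
  by (simp add: invert_def)

lemma invert_invert [simp]: "invert (invert v) = v"
proof (cases "v = 0")
  case False
  then have "(norm v * norm v) * (inverse (norm v) * inverse (norm v)) = 1"
    by (simp add: field_simps)
  then show ?thesis
    unfolding invert_def[of "invert v"] norm_invert by (simp add: invert_def power2_eq_square)
qed simp

lemma smooth_on_norm_power2: "open U \<Longrightarrow> smooth_on f U \<Longrightarrow> smooth_on (\<lambda>x. (norm (f x))\<^sup>2) U"
  unfolding power2_norm_eq_inner by (rule smooth_on_inner)

lemma smooth_on_invert: "smooth_on (invert :: 'a::euclidean_space \<Rightarrow> 'a) (UNIV - {0})"
  unfolding invert_def
  by (intro smooth_on_scaleR smooth_on_inverse smooth_on_norm_power2 smooth_on_id) auto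

lemma has_derivative_invert:
  fixes q :: "'a::euclidean_space"
  assumes "q \<noteq> 0"
  shows "(invert has_derivative (\<lambda>v. (v - (2 * (q \<bullet> v) / (norm q)\<^sup>2) *\<^sub>R q) /\<^sub>R (norm q)\<^sup>2)) (at q)"
proof -
  have "((\<lambda>v. inverse (v \<bullet> v) *\<^sub>R v) has_derivative
      (\<lambda>v. inverse (q \<bullet> q) *\<^sub>R v + (- (inverse (q \<bullet> q) * (q \<bullet> v + v \<bullet> q) * inverse (q \<bullet> q))) *\<^sub>R q)) (at q)"
    using assms by (intro has_derivative_scaleR Deriv.has_derivative_inverse has_derivative_inner
        has_derivative_ident) auto
  moreover have "(\<lambda>v. inverse (v \<bullet> v) *\<^sub>R v) = (invert :: 'a \<Rightarrow> 'a)"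
    by (simp add: fun_eq_iff invert_def power2_norm_eq_inner)
  moreover have "(\<lambda>v. inverse (q \<bullet> q) *\<^sub>R v +
      (- (inverse (q \<bullet> q) * (q \<bullet> v + v \<bullet> q) * inverse (q \<bullet> q))) *\<^sub>R q) =
      (\<lambda>v. (v - (2 * (q \<bullet> v) / (norm q)\<^sup>2) *\<^sub>R q) /\<^sub>R (norm q)\<^sup>2)"
  proof
    fix v
    have "v \<bullet> q = q \<bullet> v"
      by (rule inner_commute)
    then show "inverse (q \<bullet> q) *\<^sub>R v +
      (- (inverse (q \<bullet> q) * (q \<bullet> v + v \<bullet> q) * inverse (q \<bullet> q))) *\<^sub>R q =
      (v - (2 * (q \<bullet> v) / (norm q)\<^sup>2) *\<^sub>R q) /\<^sub>R (norm q)\<^sup>2"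
      by (simp add: power2_norm_eq_inner scaleR_diff_right divide_inverse)
  qed
  ultimately show ?thesis
    by simp
qed

lemma norm_power2_vec2: "(norm (x :: real^2))\<^sup>2 = (x$1)\<^sup>2 + (x$2)\<^sup>2"
  unfolding power2_norm_eq_inner by (simp add: inner_vec_def sum_2 power2_eq_square)

section \<open>The coordinate plane identified with the complex numbers\<close>

definition c2v :: "complex \<Rightarrow> real^2" where
  "c2v c = vector [Re c, Im c]"

lemma linear_c2v: "linear c2v"
  by (auto simp: linear_iff c2v_def vec_eq_iff forall_2)

lemma bounded_linear_c2v: "bounded_linear c2v"
  using linear_c2v by (simp add: linear_conv_bounded_linear)

lemma norm_c2v: "norm (c2v c) = cmod c"
proof -
  have "(norm (c2v c))\<^sup>2 = (cmod c)\<^sup>2"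
    by (simp add: norm_power2_vec2 cmod_power2 c2v_def)
  then show ?thesis
    by (simp add: power2_eq_iff_nonneg)
qed

lemma c2v_eq_iff: "c2v a = c2v b \<longleftrightarrow> a = b"
  by (auto simp: c2v_def vec_eq_iff forall_2 complex_eq_iff)

lemma surj_c2v: "\<exists>c. x = c2v c"
  by (rule exI[of _ "Complex (x$1) (x$2)"]) (simp add: c2v_def vec_eq_iff forall_2)

lemma vec2_eq_axis: "v = v$1 *\<^sub>R axis 1 1 + v$2 *\<^sub>R axis 2 1" for v :: "real^2"
  by (simp add: vec_eq_iff forall_2 axis_def)

definition v2c :: "real^2 \<Rightarrow> complex" where
  "v2c x = Complex (x$1) (x$2)"

lemma c2v_v2c [simp]: "c2v (v2c x) = x" and v2c_c2v [simp]: "v2c (c2v c) = c"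
  by (simp_all add: c2v_def v2c_def vec_eq_iff forall_2)

lemma linear_v2c: "linear v2c"
  by (auto simp: linear_iff v2c_def complex_eq_iff)

lemma bounded_linear_v2c: "bounded_linear v2c"
  using linear_v2c by (simp add: linear_conv_bounded_linear)

lemma norm_v2c: "cmod (v2c x) = norm x"
  using norm_c2v[of "v2c x"] by simp

lemma v2c_eq_0_iff: "v2c x = 0 \<longleftrightarrow> x = 0"
  using norm_v2c[of x] by (metis norm_eq_zero)

text \<open>Inversion in the unit circle reverses orientation. Following it by conjugation turns it
  into the holomorphic map z -> 1/z, the gluing suited to an oriented atlas.\<close>

definition cnj_vec :: "real^2 \<Rightarrow> real^2" where
  "cnj_vec x = vector [x$1, - x$2]"

lemma linear_cnj_vec: "linear cnj_vec"
  by (auto simp: linear_iff cnj_vec_def vec_eq_iff forall_2)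

lemma cnj_vec_cnj_vec [simp]: "cnj_vec (cnj_vec x) = x"
  by (simp add: cnj_vec_def vec_eq_iff forall_2)

lemma v2c_cnj_vec: "v2c (cnj_vec x) = cnj (v2c x)"
  by (simp add: cnj_vec_def v2c_def complex_eq_iff)

lemma norm_cnj_vec: "norm (cnj_vec x) = norm x"
  by (simp add: norm_v2c[symmetric] v2c_cnj_vec)

lemma v2c_invert: "v2c (invert x) = v2c x / (of_real (norm x))\<^sup>2"
  using linear_scale[OF linear_v2c, of "inverse ((norm x)\<^sup>2)" x]
  by (simp add: invert_def scaleR_conv_of_real[where ?'a = complex] divide_inverse mult.commute)

lemma v2c_cnj_vec_invert: "v2c (cnj_vec (invert x)) = inverse (v2c x)"
proof (cases "x = 0")
  case False
  then have "v2c x \<noteq> 0"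
    by (simp add: v2c_eq_0_iff)
  moreover have "(complex_of_real (norm x))\<^sup>2 = v2c x * cnj (v2c x)"
    by (simp add: norm_v2c[symmetric] complex_norm_square[symmetric])
  ultimately show ?thesis
    by (simp add: v2c_cnj_vec v2c_invert field_simps)
qed (simp add: linear_0[OF linear_cnj_vec] linear_0[OF linear_v2c])

lemma cnj_vec_invert_has_derivative:
  assumes "x \<noteq> 0"
  shows "((\<lambda>x. cnj_vec (invert x)) has_derivative (\<lambda>v. c2v (- inverse ((v2c x)\<^sup>2) * v2c v))) (at x)"
proof -
  have "((\<lambda>x. v2c x) has_derivative v2c) (at x)"
    by (rule bounded_linear_imp_has_derivative[OF bounded_linear_v2c])
  then have "((\<lambda>x. inverse (v2c x)) has_derivative (\<lambda>v. - (inverse (v2c x) * v2c v * inverse (v2c x)))) (at x)"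
    using assms by (intro Deriv.has_derivative_inverse) (simp_all add: v2c_eq_0_iff)
  from bounded_linear.has_derivative[OF bounded_linear_c2v this]
  have "((\<lambda>x. c2v (inverse (v2c x))) has_derivative
      (\<lambda>v. c2v (- (inverse (v2c x) * v2c v * inverse (v2c x))))) (at x)" .
  moreover have "c2v (inverse (v2c x)) = cnj_vec (invert x)" for x
    by (metis c2v_v2c v2c_cnj_vec_invert)
  ultimately show ?thesis
    by (simp add: power2_eq_square mult_ac)
qed

text \<open>The real determinant of multiplication by \<open>c\<close> is the squared modulus of
  \<open>c\<close>; holomorphic coordinate changes therefore preserve orientation.\<close>

lemma det_c2v_mult_pos:
  assumes "c \<noteq> 0"
  shows "det (matrix (\<lambda>v. c2v (c * v2c v))) > 0"
proof -
  have "det (matrix (\<lambda>v. c2v (c * v2c v))) = (Re c)\<^sup>2 + (Im c)\<^sup>2"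
    by (simp add: det_2 matrix_def c2v_def v2c_def axis_def power2_eq_square)
  then show ?thesis
    using assms by (simp add: complex_eq_iff sum_power2_gt_zero_iff)
qed

section \<open>Atlases, and spheres glued by an inversion\<close>

text \<open>Openness in the atlas topology is tested in every chart, but transitions are continuous,
  so for subsets of one chart domain the test in that chart implies all others.\<close>

lemma openin_chart:
  assumes "smooth_atlas A" "(U, \<phi>) \<in> A" "X \<subseteq> U"
  shows "openin (atlas_topology A) X \<longleftrightarrow> open (\<phi> ` X)"
proof
  assume "openin (atlas_topology A) X"
  then have "open (\<phi> ` (X \<inter> U))"
    using assms by (auto simp: openin_atlas_topology)
  then show "open (\<phi> ` X)"
    using assms by (simp add: Int_absorb2)
next
  assume X: "open (\<phi> ` X)"
  have "open (\<psi> ` (X \<inter> W))" if W: "(W, \<psi>) \<in> A" for W \<psi>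
  proof -
    have inj: "inj_on \<phi> U" "inj_on \<psi> W"
      using assms(1,2) W by (auto simp: smooth_atlas_def)
    have "open (\<psi> ` (W \<inter> U))" "smooth_on (transition (W, \<psi>) (U, \<phi>)) (\<psi> ` (W \<inter> U))"
      using assms(1,2) W unfolding smooth_atlas_def by blast+
    then have "open (\<psi> ` (W \<inter> U) \<inter> transition (W, \<psi>) (U, \<phi>) -` (\<phi> ` X))"
      using X by (intro continuous_open_preimage smooth_on_continuous)
    also have "\<psi> ` (W \<inter> U) \<inter> transition (W, \<psi>) (U, \<phi>) -` (\<phi> ` X) = \<psi> ` (X \<inter> W)"
    proof -
      have "transition (W, \<psi>) (U, \<phi>) (\<psi> p) = \<phi> p" if "p \<in> W" for p
        using inj that by (simp add: transition_def local_rep_def)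
      moreover have "\<phi> p \<in> \<phi> ` X \<longleftrightarrow> p \<in> X" if "p \<in> U" for p
        using inj(1) that assms(3) by (rule inj_on_image_mem_iff)
      ultimately show ?thesis
        using assms(3) by (intro equalityI subsetI) (fastforce, force)
    qed
    finally show ?thesis .
  qed
  moreover have "X \<subseteq> carrier_of A"
    using assms(2,3) by (auto simp: carrier_of_def)
  ultimately show "openin (atlas_topology A) X"
    using assms(1) by (auto simp: openin_atlas_topology)
qed

lemma openin_chart_domain:
  assumes "smooth_atlas A" "(U, \<phi>) \<in> A"
  shows "openin (atlas_topology A) U"
proof -
  have "open (\<phi> ` (U \<inter> U))"
    using assms unfolding smooth_atlas_def by fast
  then show ?thesis
    using openin_chart[OF assms order_refl] by simp
qed

lemma continuous_map_atlasI:
  assumes A: "smooth_atlas A" and B: "smooth_atlas B"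
    and im: "f ` carrier_of A \<subseteq> carrier_of B"
    and opn: "\<And>U \<phi> W \<psi>. (U, \<phi>) \<in> A \<Longrightarrow> (W, \<psi>) \<in> B \<Longrightarrow> open (\<phi> ` {p \<in> U. f p \<in> W})"
    and cont: "\<And>U \<phi> W \<psi>. (U, \<phi>) \<in> A \<Longrightarrow> (W, \<psi>) \<in> B \<Longrightarrow>
      continuous_on (\<phi> ` {p \<in> U. f p \<in> W}) (local_rep (U, \<phi>) (W, \<psi>) f)"
  shows "continuous_map (atlas_topology A) (atlas_topology B) f"
  unfolding continuous_map_def topspace_atlas_topology[OF A] topspace_atlas_topology[OF B]
proof (intro conjI allI impI)
  show "f \<in> carrier_of A \<rightarrow> carrier_of B"
    using im by auto
  fix X assume X: "openin (atlas_topology B) X"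
  have "open (\<phi> ` ({p \<in> carrier_of A. f p \<in> X} \<inter> U))" if U: "(U, \<phi>) \<in> A" for U \<phi>
  proof -
    have inj: "inj_on \<phi> U"
      using A U by (auto simp: smooth_atlas_def)
    have UA: "U \<subseteq> carrier_of A"
      using U by (auto simp: carrier_of_def)
    \<comment> \<open>Seen in a chart of the source, the preimage of \<open>X\<close> is the union
      of these pieces, one for each chart of the target.\<close>
    let ?Y = "\<lambda>(W, \<psi>). {y \<in> \<phi> ` {p \<in> U. f p \<in> W}. local_rep (U, \<phi>) (W, \<psi>) f y \<in> \<psi> ` (X \<inter> W)}"
    have "open (?Y (W, \<psi>))" if "(W, \<psi>) \<in> B" for W \<psi>
    proof -
      have "open (\<psi> ` (X \<inter> W))"
        using X that B by (auto simp: openin_atlas_topology)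
      then show ?thesis
        using continuous_open_preimage[OF cont[OF U that] opn[OF U that]]
        by (simp add: vimage_def Int_def)
    qed
    then have "open (\<Union>c\<in>B. ?Y c)"
      by (intro open_UN) auto
    also have "(\<Union>c\<in>B. ?Y c) = \<phi> ` ({p \<in> carrier_of A. f p \<in> X} \<inter> U)"
    proof (intro equalityI subsetI)
      fix y assume "y \<in> (\<Union>c\<in>B. ?Y c)"
      then obtain W \<psi> p where *: "(W, \<psi>) \<in> B" "p \<in> U" "f p \<in> W" "y = \<phi> p"
        "local_rep (U, \<phi>) (W, \<psi>) f y \<in> \<psi> ` (X \<inter> W)"
        by auto
      have "inj_on \<psi> W" using B * by (auto simp: smooth_atlas_def)
      then have "f p \<in> X"
        using * inj by (auto simp: local_rep_def inj_on_def)
      then show "y \<in> \<phi> ` ({p \<in> carrier_of A. f p \<in> X} \<inter> U)"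
        using * UA by auto
    next
      fix y assume "y \<in> \<phi> ` ({p \<in> carrier_of A. f p \<in> X} \<inter> U)"
      then obtain p where p: "p \<in> U" "f p \<in> X" "y = \<phi> p" by auto
      then have "f p \<in> carrier_of B"
        using im UA by auto
      then obtain W \<psi> where "(W, \<psi>) \<in> B" "f p \<in> W"
        by (auto simp: carrier_of_def)
      then show "y \<in> (\<Union>c\<in>B. ?Y c)"
        using p inj by (auto simp: local_rep_def intro!: bexI[of _ "(W, \<psi>)"])
    qed
    finally show ?thesis .
  qed
  then show "openin (atlas_topology A) {x \<in> carrier_of A. f x \<in> X}"
    using A by (auto simp: openin_atlas_topology)
qed

lemma smooth_mapI:
  assumes "smooth_atlas A" "smooth_atlas B" "f ` carrier_of A \<subseteq> carrier_of B"
    and "\<And>U \<phi> W \<psi>. (U, \<phi>) \<in> A \<Longrightarrow> (W, \<psi>) \<in> B \<Longrightarrow> open (\<phi> ` {p \<in> U. f p \<in> W})"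
    and "\<And>U \<phi> W \<psi>. (U, \<phi>) \<in> A \<Longrightarrow> (W, \<psi>) \<in> B \<Longrightarrow>
      smooth_on (local_rep (U, \<phi>) (W, \<psi>) f) (\<phi> ` {p \<in> U. f p \<in> W})"
  shows "smooth_map A B f"
  unfolding smooth_map_def using assms
  by (auto intro!: continuous_map_atlasI smooth_on_continuous)

lemma smooth_map_open_chart:
  assumes "smooth_atlas A" "smooth_atlas B" "smooth_map A B f" "(U, \<phi>) \<in> A"
    "openin (atlas_topology B) Y"
  shows "open (\<phi> ` {p \<in> U. f p \<in> Y})"
proof -
  have "openin (atlas_topology A) {p \<in> carrier_of A. f p \<in> Y}"
    using assms by (simp add: smooth_map_def continuous_map_def topspace_atlas_topology)
  then have "open (\<phi> ` ({p \<in> carrier_of A. f p \<in> Y} \<inter> U))"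
    using assms(1,4) by (auto simp: openin_atlas_topology)
  also have "{p \<in> carrier_of A. f p \<in> Y} \<inter> U = {p \<in> U. f p \<in> Y}"
    using assms(4) by (auto simp: carrier_of_def)
  finally show ?thesis .
qed

text \<open>An atlas of a sphere: two charts onto the whole Euclidean space, glued along the complement
  of the origin by an inversion followed by a linear isometric involution.\<close>

locale inversion_atlas =
  fixes X :: "'a set" and P Q :: 'a and \<phi> \<psi> :: "'a \<Rightarrow> 'e::euclidean_space" and R :: "'e \<Rightarrow> 'e"
  assumes P: "P \<in> X" and Q: "Q \<in> X" and PQ: "P \<noteq> Q"
    and bij: "bij_betw \<phi> (X - {P}) UNIV" and \<phi>Q: "\<phi> Q = 0" and \<psi>P: "\<psi> P = 0"
    and linear_R: "linear R" and norm_R: "norm (R y) = norm y" and R_R: "R (R y) = y"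
    and glue: "x \<in> X - {P, Q} \<Longrightarrow> \<psi> x = R (invert (\<phi> x))"
begin

lemma R_invert: "R (invert x) = invert (R x)"
  by (simp add: invert_def linear_scale[OF linear_R] norm_R)

lemma R_eq_0_iff: "R x = 0 \<longleftrightarrow> x = 0"
  using norm_R[of x] by (metis norm_eq_zero)

lemma inj_\<phi>: "inj_on \<phi> (X - {P})" and image_\<phi>: "\<phi> ` (X - {P}) = UNIV"
  using bij by (auto simp: bij_betw_def)

lemma \<phi>_nonzero: "x \<in> X - {P, Q} \<Longrightarrow> \<phi> x \<noteq> 0"
  using inj_\<phi> \<phi>Q PQ Q by (metis DiffD1 DiffD2 DiffI inj_onD insertCI singletonD)

lemma image_\<phi>_Int: "\<phi> ` (X - {P, Q}) = UNIV - {0}"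
proof -
  have "\<phi> ` (X - {P} - {Q}) = \<phi> ` (X - {P}) - \<phi> ` {Q}"
    using Q PQ by (intro inj_on_image_set_diff[OF inj_\<phi>]) auto
  then show ?thesis
    by (simp add: image_\<phi> \<phi>Q) (metis Diff_insert Diff_insert2)
qed

abbreviation "\<kappa> \<equiv> inv_into (X - {P}) \<phi>"

text \<open>\<open>R\<close> commutes with \<open>invert\<close> and both are involutions, so the
  gluing map is its own inverse. Every fact about the first chart thereby transfers to the
  second.\<close>

lemma swap: "inversion_atlas X Q P \<psi> \<phi> R"
proof
  have "\<psi> ` (X - {P, Q}) = (\<lambda>v. R (invert v)) ` (UNIV - {0})"
    unfolding image_\<phi>_Int[symmetric] by (auto simp: glue image_image cong: image_cong_simp)
  also have "\<dots> = UNIV - {0}"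
  proof (intro equalityI subsetI)
    fix y :: 'e assume "y \<in> UNIV - {0}"
    then show "y \<in> (\<lambda>v. R (invert v)) ` (UNIV - {0})"
      by (intro image_eqI[of _ _ "invert (R y)"]) (auto simp: R_R R_eq_0_iff)
  qed (auto simp: R_eq_0_iff)
  finally have im: "\<psi> ` (X - {P, Q}) = UNIV - {0}" .
  have "X - {Q} = insert P (X - {P, Q})"
    using P PQ by auto
  then have "\<psi> ` (X - {Q}) = UNIV"
    using im \<psi>P by auto
  moreover have "inj_on \<psi> (X - {Q})"
  proof (rule inj_onI)
    have nz: "\<psi> x \<noteq> 0" if "x \<in> X - {P, Q}" for x
      using im that by blast
    fix x y assume x: "x \<in> X - {Q}" and y: "y \<in> X - {Q}" and eq: "\<psi> x = \<psi> y"
    show "x = y"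
    proof (cases "x = P \<or> y = P")
      case True
      then show ?thesis
        using x y eq nz[of x] nz[of y] \<psi>P by force
    next
      case False
      then have "R (R (invert (\<phi> x))) = R (R (invert (\<phi> y)))"
        using glue[of x] glue[of y] x y eq by simp
      then have "invert (invert (\<phi> x)) = invert (invert (\<phi> y))"
        by (simp only: R_R)
      then show ?thesis
        using inj_\<phi> x y False by (simp add: inj_on_def)
    qed
  qed
  ultimately show "bij_betw \<psi> (X - {Q}) UNIV"
    by (simp add: bij_betw_def)
  show "\<phi> x = R (invert (\<psi> x))" if "x \<in> X - {Q, P}" for x
    using glue[of x] that by (simp add: R_invert[symmetric] R_R insert_commute)
qed (use P Q PQ \<phi>Q \<psi>P norm_R R_R linear_add[OF linear_R] linear_scale[OF linear_R] in auto)

definition "A = {(X - {P}, \<phi>), (X - {Q}, \<psi>)}"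

lemma carrier: "carrier_of A = X"
  using P Q PQ by (auto simp: A_def carrier_of_def)

lemma transition_self: "transition (X - {P}, \<phi>) (X - {P}, \<phi>) y = y"
  using image_\<phi> by (simp add: transition_def local_rep_def f_inv_into_f)

lemma transition_glue: "y \<noteq> 0 \<Longrightarrow> transition (X - {P}, \<phi>) (X - {Q}, \<psi>) y = R (invert y)"
proof -
  assume "y \<noteq> 0"
  then obtain x where x: "x \<in> X - {P, Q}" "y = \<phi> x"
    using image_\<phi>_Int by blast
  then have "\<kappa> y = x"
    using inj_\<phi> by auto
  then show ?thesis
    using x glue by (simp add: transition_def local_rep_def)
qed

lemma open_and_smooth_transition:
  shows "open (\<phi> ` ((X - {P}) \<inter> (X - {P})))" "open (\<phi> ` ((X - {P}) \<inter> (X - {Q})))"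
    and "smooth_on (transition (X - {P}, \<phi>) (X - {P}, \<phi>)) (\<phi> ` ((X - {P}) \<inter> (X - {P})))"
    and "smooth_on (transition (X - {P}, \<phi>) (X - {Q}, \<psi>)) (\<phi> ` ((X - {P}) \<inter> (X - {Q})))"
proof -
  have eq: "(X - {P}) \<inter> (X - {Q}) = X - {P, Q}" by auto
  show "open (\<phi> ` ((X - {P}) \<inter> (X - {P})))"
    by (simp add: image_\<phi>)
  show "open (\<phi> ` ((X - {P}) \<inter> (X - {Q})))"
    unfolding eq image_\<phi>_Int by auto
  show "smooth_on (transition (X - {P}, \<phi>) (X - {P}, \<phi>)) (\<phi> ` ((X - {P}) \<inter> (X - {P})))"
    using smooth_on_id[of UNIV] by (simp add: image_\<phi> transition_self[abs_def])
  have "smooth_on (\<lambda>y. R (invert y)) (UNIV - {0})"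
    using linear_R smooth_on_invert
    by (intro smooth_on_bounded_linear[of R]) (auto simp: linear_conv_bounded_linear)
  then show "smooth_on (transition (X - {P}, \<phi>) (X - {Q}, \<psi>)) (\<phi> ` ((X - {P}) \<inter> (X - {Q})))"
    unfolding eq image_\<phi>_Int by (subst smooth_on_cong[OF _ transition_glue]) auto
qed

lemma smooth_atlas: "smooth_atlas A"
proof -
  interpret s: inversion_atlas X Q P \<psi> \<phi> R by (rule swap)
  show ?thesis
    unfolding smooth_atlas_def A_def
    using open_and_smooth_transition s.open_and_smooth_transition inj_\<phi> s.inj_\<phi>
    by (simp add: Int_commute)
qed

lemma topspace: "topspace (atlas_topology A) = X"
  by (simp add: topspace_atlas_topology[OF smooth_atlas] carrier)

lemma swap_atlas: "inversion_atlas.A X Q P \<psi> \<phi> = A"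
  using inversion_atlas.A_def[OF swap] by (auto simp: A_def)

lemma inv_chart: "\<kappa> y \<in> X - {P}" "\<phi> (\<kappa> y) = y"
  using inv_into_into[of y \<phi> "X - {P}"] f_inv_into_f[of y \<phi> "X - {P}"] image_\<phi> by blast+

lemma openin_image_inv:
  assumes "open Y"
  shows "openin (atlas_topology A) (\<kappa> ` Y)"
proof -
  have "\<phi> ` \<kappa> ` Y = Y"
    by (simp add: image_image inv_chart(2))
  moreover have "\<kappa> ` Y \<subseteq> X - {P}"
    by (rule image_subsetI) (rule inv_chart(1))
  ultimately show ?thesis
    using assms openin_chart[OF smooth_atlas, of "X - {P}" \<phi>] by (simp add: A_def)
qed

lemma open_image_chart:
  assumes "openin (atlas_topology A) Y"
  shows "open (\<phi> ` (Y - {P}))"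
proof -
  have "Y \<inter> (X - {P}) = Y - {P}"
    using openin_subset[OF assms] topspace by auto
  then show ?thesis
    using assms smooth_atlas by (auto simp: openin_atlas_topology A_def)
qed

lemma inv_image_chart:
  assumes "Y \<subseteq> X"
  shows "\<kappa> ` \<phi> ` (Y - {P}) = Y - {P}"
proof -
  have "\<kappa> (\<phi> y) = y" if "y \<in> Y - {P}" for y
    using inj_\<phi> assms that by (intro inv_into_f_f) auto
  then show ?thesis
    by (simp add: image_image)
qed

lemma continuous_map_inv_chart:
  "continuous_map euclidean (atlas_topology A) \<kappa>"
  unfolding continuous_map_def topspace
proof (intro conjI allI impI)
  have inX: "\<kappa> y \<in> X - {P}" for y
    using inv_into_into[of y \<phi> "X - {P}"] image_\<phi> by blast
  then show "\<kappa> \<in> topspace euclidean \<rightarrow> X"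
    by blast
  fix Y assume Y: "openin (atlas_topology A) Y"
  then have "Y \<subseteq> X"
    using openin_subset topspace by metis
  have "{y. \<kappa> y \<in> Y} = \<phi> ` (Y - {P})"
  proof (intro equalityI subsetI)
    fix y assume "y \<in> {y. \<kappa> y \<in> Y}"
    then show "y \<in> \<phi> ` (Y - {P})"
      using inX[of y] image_\<phi> by (intro image_eqI[of _ _ "\<kappa> y"])
        (auto simp: f_inv_into_f)
  next
    fix y assume "y \<in> \<phi> ` (Y - {P})"
    then show "y \<in> {y. \<kappa> y \<in> Y}"
      using inv_image_chart[OF \<open>Y \<subseteq> X\<close>] by auto
  qed
  then show "openin euclidean {x \<in> topspace euclidean. \<kappa> x \<in> Y}"
    using open_image_chart[OF Y] by (simp add: open_openin[symmetric])
qed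

lemma norm_\<psi>: "x \<in> X - {P, Q} \<Longrightarrow> norm (\<psi> x) = inverse (norm (\<phi> x))"
  by (simp add: glue norm_R norm_invert)

text \<open>The two coordinates of a point other than the poles have reciprocal norms, so one of
  them is at most 1. Compactness follows from this cover.\<close>

lemma covered_by_discs:
  "\<kappa> ` cball 0 1 \<union> inv_into (X - {Q}) \<psi> ` cball 0 1 = X"
proof -
  interpret s: inversion_atlas X Q P \<psi> \<phi> R by (rule swap)
  have "x \<in> \<kappa> ` cball 0 1 \<union> s.\<kappa> ` cball 0 1"
    if x: "x \<in> X" for x
  proof (cases "x \<noteq> P \<and> norm (\<phi> x) \<le> 1")
    case True
    then show ?thesis
      using x inj_\<phi> by (intro UnI1 image_eqI[of _ _ "\<phi> x"]) auto
  next
    case False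
    then have "x \<noteq> Q"
      using PQ \<phi>Q by auto
    moreover have "norm (\<psi> x) \<le> 1"
    proof (cases "x = P")
      case x': False
      then show ?thesis
        using x False \<open>x \<noteq> Q\<close> norm_\<psi>[of x] by (simp add: inverse_le_1_iff)
    qed (simp add: \<psi>P)
    ultimately show ?thesis
      using x s.inj_\<phi> by (intro UnI2 image_eqI[of _ _ "\<psi> x"]) auto
  qed
  then show ?thesis
    using inv_chart(1) s.inv_chart(1) by blast
qed

lemma Hausdorff_chart:
  assumes "x \<in> X - {P}" "y \<in> X - {P}" "x \<noteq> y"
  shows "\<exists>U V. openin (atlas_topology A) U \<and> openin (atlas_topology A) V \<and>
    x \<in> U \<and> y \<in> V \<and> disjnt U V"
proof -
  have "\<phi> x \<noteq> \<phi> y"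
    using assms inj_\<phi> by (auto dest: inj_onD)
  from hausdorff[OF this] obtain U V where UV: "open U" "open V" "\<phi> x \<in> U" "\<phi> y \<in> V" "U \<inter> V = {}"
    by blast
  have "\<kappa> (\<phi> x) = x" "\<kappa> (\<phi> y) = y"
    using inj_\<phi> assms by auto
  then have "x \<in> \<kappa> ` U" "y \<in> \<kappa> ` V"
    using UV by (metis imageI)+
  moreover have "disjnt (\<kappa> ` U) (\<kappa> ` V)"
  proof -
    have "u = v" if "\<kappa> u = \<kappa> v" for u v
      using arg_cong[OF that, of \<phi>] by (simp only: inv_chart(2))
    then show ?thesis
      using UV(5) by (fastforce simp: disjnt_iff)
  qed
  ultimately show ?thesis
    using openin_image_inv[OF UV(1)] openin_image_inv[OF UV(2)] by blast
qed

lemma basis_chart: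
  assumes "topological_basis \<B>" and Y: "openin (atlas_topology A) Y" "x \<in> Y" "x \<noteq> P"
  shows "\<exists>C\<in>image \<kappa> ` \<B>. x \<in> C \<and> C \<subseteq> Y"
proof -
  have YX: "Y \<subseteq> X"
    using openin_subset[OF Y(1)] topspace by simp
  have "open (\<phi> ` (Y - {P}))" "\<phi> x \<in> \<phi> ` (Y - {P})"
    using Y open_image_chart by auto
  then obtain B where B: "B \<in> \<B>" "\<phi> x \<in> B" "B \<subseteq> \<phi> ` (Y - {P})"
    using assms(1) topological_basisE by blast
  moreover have "\<kappa> (\<phi> x) = x"
    using inj_\<phi> Y YX by auto
  moreover have "\<kappa> ` B \<subseteq> Y"
    using image_mono[OF B(3), of \<kappa>] inv_image_chart[OF YX] by blast
  ultimately show ?thesis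
    by (metis imageI)
qed

lemma Hausdorff: "Hausdorff_space (atlas_topology A)"
proof -
  interpret s: inversion_atlas X Q P \<psi> \<phi> R by (rule swap)
  let ?sep = "\<lambda>x y. \<exists>U V. openin (atlas_topology A) U \<and> openin (atlas_topology A) V \<and>
      x \<in> U \<and> y \<in> V \<and> disjnt U V"
  \<comment> \<open>The poles are the only pair of distinct points without a common chart. Their
    open unit discs are disjoint, because reciprocal norms cannot both be below 1.\<close>
  have poles: "?sep Q P"
  proof -
    have "openin (atlas_topology A) (\<kappa> ` ball 0 1)"
      "openin (atlas_topology A) (s.\<kappa> ` ball 0 1)"
      using openin_image_inv s.openin_image_inv swap_atlas by auto
    moreover have "Q \<in> \<kappa> ` ball 0 1"
      using inv_into_f_f[OF inj_\<phi>, of Q] Q PQ \<phi>Q by (intro image_eqI[of _ _ 0]) auto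
    moreover have "P \<in> s.\<kappa> ` ball 0 1"
      using inv_into_f_f[OF s.inj_\<phi>, of P] P PQ \<psi>P by (intro image_eqI[of _ _ 0]) auto
    moreover have "disjnt (\<kappa> ` ball 0 1) (s.\<kappa> ` ball 0 1)"
    proof -
      have False if xx: "x \<in> \<kappa> ` ball 0 1" "x \<in> s.\<kappa> ` ball 0 1" for x
      proof -
        obtain u v where uv: "x = \<kappa> u" "u \<in> ball 0 1"
            "x = s.\<kappa> v" "v \<in> ball 0 1"
          using xx by blast
        have "x \<in> X - {P, Q}"
          using inv_chart(1)[of u, folded uv(1)] s.inv_chart(1)[of v, folded uv(3)] by blast
        moreover have "norm (\<phi> x) < 1" "norm (\<psi> x) < 1"
          using inv_chart(2)[of u] s.inv_chart(2)[of v] uv by (metis mem_ball_0)+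
        ultimately have "x \<in> X - {P, Q}" "norm (\<phi> x) < 1" "norm (\<psi> x) < 1"
          by blast+
        then show False
          using norm_\<psi>[of x] \<phi>_nonzero[of x] by (simp add: field_simps)
      qed
      then show ?thesis
        by (auto simp: disjnt_def)
    qed
    ultimately show ?thesis by blast
  qed
  have "?sep x y" if "x \<in> X" "y \<in> X" "x \<noteq> y" for x y
  proof -
    consider "x \<noteq> P" "y \<noteq> P" | "x \<noteq> Q" "y \<noteq> Q" | "x = Q" "y = P" | "x = P" "y = Q"
      using PQ by blast
    then show ?thesis
    proof cases
      case 1
      then show ?thesis using Hausdorff_chart[of x y] that by blast
    next
      case 2
      then show ?thesis using s.Hausdorff_chart[of x y] that swap_atlas by simp
    next
      case 3
      then show ?thesis using poles by blast
    next
      case 4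
      then show ?thesis using poles disjnt_sym by blast
    qed
  qed
  then show ?thesis
    unfolding Hausdorff_space_def topspace by blast
qed

lemma second_countable: "second_countable (atlas_topology A)"
proof -
  interpret s: inversion_atlas X Q P \<psi> \<phi> R by (rule swap)
  obtain \<B> :: "'e set set" where \<B>: "countable \<B>" "topological_basis \<B>"
    using ex_countable_basis by blast
  let ?\<C> = "image \<kappa> ` \<B> \<union> image s.\<kappa> ` \<B>"
  have "countable ?\<C>"
    using \<B> by auto
  moreover have "openin (atlas_topology A) C" if "C \<in> ?\<C>" for C
    using that topological_basis_open[OF \<B>(2)] openin_image_inv s.openin_image_inv swap_atlas by auto
  moreover have "\<exists>C\<in>?\<C>. x \<in> C \<and> C \<subseteq> Y" if "openin (atlas_topology A) Y" "x \<in> Y" for x Y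
  proof -
    have "x \<noteq> P \<Longrightarrow> \<exists>C\<in>image \<kappa> ` \<B>. x \<in> C \<and> C \<subseteq> Y" "x \<noteq> Q \<Longrightarrow> \<exists>C\<in>image s.\<kappa> ` \<B>. x \<in> C \<and> C \<subseteq> Y"
      using basis_chart[OF \<B>(2) that] s.basis_chart[OF \<B>(2), of Y x] that swap_atlas by simp_all
    then show ?thesis
      using PQ by (cases "x = P") (auto simp only: bex_Un)
  qed
  ultimately show ?thesis
    unfolding second_countable_def by (intro exI[of _ ?\<C>] conjI ballI allI impI) simp_all
qed

lemma compact: "compact_space (atlas_topology A)"
proof -
  interpret s: inversion_atlas X Q P \<psi> \<phi> R by (rule swap)
  have "compactin (atlas_topology A) (\<kappa> ` cball 0 1)"
    by (rule image_compactin[OF _ continuous_map_inv_chart]) simp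
  moreover have "compactin (atlas_topology A) (s.\<kappa> ` cball 0 1)"
    using image_compactin[OF _ s.continuous_map_inv_chart, of "cball 0 1"] swap_atlas by simp
  ultimately show ?thesis
    unfolding compact_space_def topspace
    using compactin_Un covered_by_discs by metis
qed

lemma connected: "connected_space (atlas_topology A)"
proof -
  interpret s: inversion_atlas X Q P \<psi> \<phi> R by (rule swap)
  have ran: "range \<kappa> = X - {P}" "range s.\<kappa> = X - {Q}"
    using inv_image_chart[of X] s.inv_image_chart[of X] image_\<phi> s.image_\<phi> by auto
  have "connectedin (atlas_topology A) (X - {P})"
    using connectedin_continuous_map_image[OF continuous_map_inv_chart, of UNIV] ran connected_UNIV by simp
  moreover have "connectedin (atlas_topology A) (X - {Q})"
    using connectedin_continuous_map_image[OF s.continuous_map_inv_chart, of UNIV] ran swap_atlas connected_UNIV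
    by simp
  moreover have "(X - {P}) \<inter> (X - {Q}) \<noteq> {}"
  proof -
    have "\<phi> ` (X - {P, Q}) \<noteq> {}"
      unfolding image_\<phi>_Int using nonzero_Basis nonempty_Basis by blast
    then show ?thesis by blast
  qed
  ultimately have "connectedin (atlas_topology A) ((X - {P}) \<union> (X - {Q}))"
    by (rule connectedin_Un)
  moreover have "(X - {P}) \<union> (X - {Q}) = X"
    using PQ by auto
  ultimately show ?thesis
    unfolding connectedin_topspace[symmetric] topspace by simp
qed

lemma manifold: "manifold A"
  using smooth_atlas Hausdorff second_countable connected carrier P by (auto simp: manifold_def)

end

lemma inversion_chart_Some [simp]: "inversion_chart (Some y) = invert y"
  by (simp add: invert_def)

declare inversion_chart.simps(2) [simp del]

lemma inversion_atlas_S: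
  "inversion_atlas UNIV None (Some 0) the (inversion_chart :: 'v::euclidean_space option \<Rightarrow> 'v) (\<lambda>x. x)"
proof
  show "bij_betw the (UNIV - {None}) (UNIV :: 'v set)"
    by (rule bij_betwI[where g = Some]) auto
qed (auto simp: linear_iff)

interpretation S: inversion_atlas UNIV None "Some 0" the
  "inversion_chart :: 'v::euclidean_space option \<Rightarrow> 'v" "\<lambda>x. x"
  rewrites "inversion_atlas.A UNIV None (Some 0) the (inversion_chart :: 'v option \<Rightarrow> 'v) = S_atlas"
  by (rule inversion_atlas_S) (simp add: inversion_atlas.A_def[OF inversion_atlas_S] S_atlas_def)

section \<open>The two-sphere with its stereographic charts\<close>

definition stereo_N :: "real^3 \<Rightarrow> real^2" where
  "stereo_N x = vector [x$1 / (1 - x$3), x$2 / (1 - x$3)]"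

definition stereo_S :: "real^3 \<Rightarrow> real^2" where
  "stereo_S x = vector [x$1 / (1 + x$3), x$2 / (1 + x$3)]"

lemma norm_power2_vec3: "(norm (x :: real^3))\<^sup>2 = (x$1)\<^sup>2 + (x$2)\<^sup>2 + (x$3)\<^sup>2"
  unfolding power2_norm_eq_inner by (simp add: inner_vec_def sum_3 power2_eq_square)

lemma mem_sphere_vec3: "x \<in> sphere 0 1 \<longleftrightarrow> (x$1)\<^sup>2 + (x$2)\<^sup>2 + (x$3)\<^sup>2 = (1::real)"
  for x :: "real^3"
proof -
  have "norm x = 1 \<longleftrightarrow> (norm x)\<^sup>2 = 1"
    using norm_ge_zero[of x] by (auto simp: power2_eq_1_iff simp del: norm_ge_zero)
  then show ?thesis
    by (simp add: norm_power2_vec3)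
qed

lemma inversion_atlas_S2:
  "inversion_atlas (sphere 0 1) (axis 3 1) (- axis 3 1) stereo_N stereo_S (\<lambda>x. x)"
proof
  let ?N = "axis 3 1 :: real^3"
  have pole: "x = axis 3 1 \<longleftrightarrow> x$3 = 1" "x = - axis 3 1 \<longleftrightarrow> x$3 = -1" if "x \<in> sphere 0 1" for x :: "real^3"
  proof -
    have "x$1 = 0 \<and> x$2 = 0" if "(x$3)\<^sup>2 = 1"
      using \<open>x \<in> sphere 0 1\<close> that unfolding mem_sphere_vec3 by (auto simp: add_nonneg_eq_0_iff)
    then show "x = axis 3 1 \<longleftrightarrow> x$3 = 1" "x = - axis 3 1 \<longleftrightarrow> x$3 = -1"
      by (auto simp: vec_eq_iff forall_3 axis_def)
  qed
  \<comment> \<open>On the sphere the first two squares sum to (1 - x3)(1 + x3). This value yields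
    both the inverse of the projection and the gluing of the two charts by inversion.\<close>
  have norm_N: "(norm (stereo_N x))\<^sup>2 = (1 + x$3) / (1 - x$3)"
    if x: "x \<in> sphere 0 1" and x3: "x$3 \<noteq> 1" for x
  proof -
    have "(x$1)\<^sup>2 + (x$2)\<^sup>2 + (x$3)\<^sup>2 = 1"
      using x by (simp only: mem_sphere_vec3)
    then have "(x$1)\<^sup>2 + (x$2)\<^sup>2 = (1 - x$3) * (1 + x$3)"
      by (simp add: algebra_simps power2_eq_square)
    moreover have "(norm (stereo_N x))\<^sup>2 = ((x$1)\<^sup>2 + (x$2)\<^sup>2) / (1 - x$3)\<^sup>2"
      by (simp add: norm_power2_vec2 stereo_N_def power_divide add_divide_distrib)
    ultimately show ?thesis
      using x3 by (simp add: power2_eq_square)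
  qed
  \<comment> \<open>Inverse stereographic projection from the north pole.\<close>
  let ?g = "\<lambda>v::real^2. vector [2 * v$1, 2 * v$2, (norm v)\<^sup>2 - 1] /\<^sub>R ((norm v)\<^sup>2 + 1) :: real^3"
  have nz: "(norm v)\<^sup>2 + 1 \<noteq> 0" for v :: "real^2"
    by (smt (verit) zero_le_power2)
  show "bij_betw stereo_N (sphere 0 1 - {?N}) UNIV"
  proof (rule bij_betwI[where g = ?g])
    show "?g \<in> UNIV \<rightarrow> sphere 0 1 - {?N}"
    proof
      fix v :: "real^2"
      have "(2 * v$1)\<^sup>2 + (2 * v$2)\<^sup>2 + ((norm v)\<^sup>2 - 1)\<^sup>2 = ((norm v)\<^sup>2 + 1)\<^sup>2"
        unfolding norm_power2_vec2 by (simp add: power2_eq_square algebra_simps)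
      then have "?g v \<in> sphere 0 1"
        unfolding mem_sphere_vec3 using nz[of v]
        by (simp add: power_mult_distrib power_inverse field_simps)
      moreover have "?g v $ 3 \<noteq> 1"
        using nz[of v] by (simp add: field_simps)
      ultimately show "?g v \<in> sphere 0 1 - {?N}"
        using pole by auto
    qed
    show "?g (stereo_N x) = x" if "x \<in> sphere 0 1 - {?N}" for x
    proof -
      have x3: "x$3 \<noteq> 1"
        using that pole[of x] by blast
      have n: "(norm (stereo_N x))\<^sup>2 = (1 + x$3) / (1 - x$3)"
        using norm_N[OF _ x3] that by blast
      have "(norm (stereo_N x))\<^sup>2 + 1 = 2 / (1 - x$3)" "(norm (stereo_N x))\<^sup>2 - 1 = 2 * x$3 / (1 - x$3)"
        using x3 by (simp_all add: n field_simps)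
      then have "?g (stereo_N x) = vector [2 * stereo_N x $ 1, 2 * stereo_N x $ 2,
          2 * x$3 / (1 - x$3)] /\<^sub>R (2 / (1 - x$3))"
        by (simp only:)
      also have "\<dots> = x"
        using x3 by (simp add: vec_eq_iff forall_3 stereo_N_def field_simps)
      finally show ?thesis .
    qed
    show "stereo_N (?g v) = v" for v
    proof -
      have "1 - ?g v $ 3 = 2 / ((norm v)\<^sup>2 + 1)"
        using nz[of v] by (simp add: field_simps)
      then show ?thesis
        using nz[of v] by (simp add: vec_eq_iff forall_2 stereo_N_def field_simps)
    qed
  qed auto
  show "stereo_S x = invert (stereo_N x)" if "x \<in> sphere 0 1 - {?N, - ?N}" for x
  proof -
    have x: "x \<in> sphere 0 1" and x3: "x$3 \<noteq> 1" "x$3 \<noteq> -1"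
      using that pole[of x] by blast+
    note n = norm_N[OF x x3(1)]
    have "1 + x$3 \<noteq> 0" using x3 by linarith
    then show ?thesis
      using x3 by (simp add: invert_def n vec_eq_iff forall_2) (simp add: stereo_N_def stereo_S_def)
  qed
  show "?N \<in> sphere 0 1" "- ?N \<in> sphere 0 1"
    by (simp_all add: norm_axis_1)
qed (auto simp: linear_iff stereo_N_def stereo_S_def vec_eq_iff forall_2 forall_3 axis_def)

interpretation S2: inversion_atlas "sphere 0 1" "axis 3 1" "- axis 3 1" stereo_N stereo_S "\<lambda>x. x"
  rewrites "inversion_atlas.A (sphere 0 1) (axis 3 1) (- axis 3 1) stereo_N stereo_S = S2_atlas"
  by (rule inversion_atlas_S2)
    (simp only: inversion_atlas.A_def[OF inversion_atlas_S2], simp add: S2_atlas_def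
      stereo_N_def[abs_def] stereo_S_def[abs_def])

lemma S_charts: "(UNIV - {None}, the) \<in> S_atlas" "(UNIV - {Some 0}, inversion_chart) \<in> S_atlas"
  by (auto simp: S_atlas_def)

abbreviation "affine_rep U \<phi> \<equiv> local_rep (U, \<phi>) (UNIV - {None}, the) id"

text \<open>Both charts of the target factor through charts of \<open>S\<close>: a map that is a restriction of
  smooth maps \<open>H\<close> with smooth left inverses \<open>K\<close> in this sense is a diffeomorphism.\<close>

lemma diffeomorphism_of_submanifold:
  fixes A :: "('v::euclidean_space option, real^2) atlas" and B :: "('b, real^2) atlas"
  assumes A: "smooth_atlas A" and B: "smooth_atlas B" and imm: "immersion A S_atlas id"
    and bij: "bij_betw f (carrier_of A) (carrier_of B)"
    and fac: "\<And>W \<psi>. (W, \<psi>) \<in> B \<Longrightarrow> \<exists>Y Z \<sigma> \<Omega> H K. (Z, \<sigma>) \<in> S_atlas \<and>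
       openin (atlas_topology S_atlas) Y \<and> Y \<subseteq> Z \<and> open \<Omega> \<and> smooth_on H \<Omega> \<and>
       smooth_on K UNIV \<and> (\<forall>p\<in>carrier_of A. (f p \<in> W \<longleftrightarrow> p \<in> Y) \<and>
         (p \<in> Y \<longrightarrow> \<sigma> p \<in> \<Omega> \<and> H (\<sigma> p) = \<psi> (f p) \<and> K (\<psi> (f p)) = \<sigma> p))"
  shows "diffeomorphism A B f"
proof -
  let ?g = "inv_into (carrier_of A) f"
  have injf: "inj_on f (carrier_of A)" and imf: "f ` carrier_of A = carrier_of B"
    using bij by (auto simp: bij_betw_def)
  have smA: "smooth_map A S_atlas id"
    using imm by (simp add: immersion_def)
  have main: "open (\<phi> ` {p \<in> U. f p \<in> W}) \<and>
      smooth_on (local_rep (U, \<phi>) (W, \<psi>) f) (\<phi> ` {p \<in> U. f p \<in> W}) \<and>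
      open (\<psi> ` {q \<in> W. ?g q \<in> U}) \<and>
      smooth_on (local_rep (W, \<psi>) (U, \<phi>) ?g) (\<psi> ` {q \<in> W. ?g q \<in> U})"
    if U: "(U, \<phi>) \<in> A" and W: "(W, \<psi>) \<in> B" for U \<phi> W \<psi>
  proof -
    have inj\<phi>: "inj_on \<phi> U" and inj\<psi>: "inj_on \<psi> W"
      using A B U W by (auto simp: smooth_atlas_def)
    have UA: "U \<subseteq> carrier_of A" and WB: "W \<subseteq> carrier_of B"
      using U W by (auto simp: carrier_of_def)
    from fac[OF W] obtain Y Z \<sigma> \<Omega> H K where Z: "(Z, \<sigma>) \<in> S_atlas"
      and Y: "openin (atlas_topology S_atlas) Y" "Y \<subseteq> Z" and \<Omega>: "open \<Omega>" "smooth_on H \<Omega>"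
      and K: "smooth_on K UNIV" and *: "\<forall>p\<in>carrier_of A. (f p \<in> W \<longleftrightarrow> p \<in> Y) \<and>
        (p \<in> Y \<longrightarrow> \<sigma> p \<in> \<Omega> \<and> H (\<sigma> p) = \<psi> (f p) \<and> K (\<psi> (f p)) = \<sigma> p)"
      by (elim exE conjE)
    have p: "\<And>p. p \<in> carrier_of A \<Longrightarrow> f p \<in> W \<longleftrightarrow> p \<in> Y"
        "\<And>p. p \<in> carrier_of A \<Longrightarrow> p \<in> Y \<Longrightarrow> \<sigma> p \<in> \<Omega>"
        "\<And>p. p \<in> carrier_of A \<Longrightarrow> p \<in> Y \<Longrightarrow> H (\<sigma> p) = \<psi> (f p)"
        "\<And>p. p \<in> carrier_of A \<Longrightarrow> p \<in> Y \<Longrightarrow> K (\<psi> (f p)) = \<sigma> p"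
      using * by blast+
    \<comment> \<open>The domain of the local representative is described through \<open>Y\<close>
      instead of \<open>f\<close>, so its openness comes from the smooth inclusion into S and not
      from continuity of \<open>f\<close>, which is still to be shown.\<close>
    define O' where "O' = \<phi> ` {p \<in> U. p \<in> Y}"
    have O'_eq: "\<phi> ` {p \<in> U. f p \<in> W} = O'"
      using p(1) UA by (auto simp: O'_def)
    define r where "r = local_rep (U, \<phi>) (Z, \<sigma>) id"
    define u where "u = local_rep (U, \<phi>) (W, \<psi>) f"
    have r_eq: "r (\<phi> q) = \<sigma> q" and u_eq: "u (\<phi> q) = \<psi> (f q)" if "q \<in> U" for q
      using that inj\<phi> by (simp_all add: r_def u_def local_rep_def)
    have openO: "open O'"
      using smooth_map_open_chart[OF A S.smooth_atlas smA U Y(1)]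
      by (simp add: O'_def)
    have "smooth_on r (\<phi> ` {p \<in> U. p \<in> Z})"
      using smA U Z unfolding smooth_map_def r_def by fastforce
    then have r: "smooth_on r O'"
      by (rule smooth_on_subset) (use Y(2) in \<open>auto simp: O'_def\<close>)
    have injDr: "inj (frechet_derivative r (at x))" if "x \<in> O'" for x
    proof -
      obtain p where "x = \<phi> p" "p \<in> U" "p \<in> Z"
        using \<open>x \<in> O'\<close> Y(2) by (auto simp: O'_def)
      then show ?thesis
        using imm U Z unfolding immersion_def r_def by fastforce
    qed
    have rO: "r ` O' \<subseteq> \<Omega>"
      using p(2) UA r_eq by (auto simp: O'_def)
    have Hr: "H (r x) = u x" and Ku: "K (u x) = r x" if "x \<in> O'" for x
      using that p(3,4) UA r_eq u_eq by (auto simp: O'_def)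
    have "smooth_on (\<lambda>x. H (r x)) O'"
      by (rule smooth_on_compose[OF openO \<Omega>(1) rO r \<Omega>(2)])
    then have u: "smooth_on u O'"
      using smooth_on_cong[OF openO, of "\<lambda>x. H (r x)" u] Hr by simp
    have uinj: "inj_on u O'"
    proof (rule inj_onI)
      fix x y assume xy: "x \<in> O'" "y \<in> O'" "u x = u y"
      then obtain s t where st: "s \<in> U" "s \<in> Y" "x = \<phi> s" "t \<in> U" "t \<in> Y" "y = \<phi> t"
        by (auto simp: O'_def)
      then have "\<psi> (f s) = \<psi> (f t)" "f s \<in> W" "f t \<in> W"
        using xy(3) u_eq p(1) UA by auto
      then have "f s = f t"
        using inj\<psi> by (auto dest: inj_onD)
      then show "x = y"
        using st injf UA by (auto dest: inj_onD)
    qed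
    \<comment> \<open>Since \<open>r\<close> is \<open>K\<close> after \<open>u\<close> and
      \<open>r\<close> represents an immersion, a vector killed by the derivative of
      \<open>u\<close> would be killed by that of \<open>r\<close>.\<close>
    have uD: "inj (frechet_derivative u (at x))" if x: "x \<in> O'" for x
    proof -
      have "((\<lambda>x. K (u x)) has_derivative
          (\<lambda>v. frechet_derivative K (at (u x)) (frechet_derivative u (at x) v))) (at x)"
        using has_derivative_compose[OF smooth_on_has_derivative[OF u x]
            smooth_on_has_derivative[OF K UNIV_I]] .
      then have "(r has_derivative
          (\<lambda>v. frechet_derivative K (at (u x)) (frechet_derivative u (at x) v))) (at x)"
        by (rule has_derivative_transform_within_open[OF _ openO x]) (rule Ku)
      from frechet_derivative_at[OF this] injDr[OF x]
      have "inj (\<lambda>v. frechet_derivative K (at (u x)) (frechet_derivative u (at x) v))"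
        by simp
      then show ?thesis
        unfolding inj_def by metis
    qed
    have img: "\<psi> ` {q \<in> W. ?g q \<in> U} = u ` O'"
    proof (intro equalityI subsetI)
      fix y assume "y \<in> \<psi> ` {q \<in> W. ?g q \<in> U}"
      then obtain q where q: "q \<in> W" "?g q \<in> U" "y = \<psi> q"
        by blast
      have "f (?g q) = q"
        using q(1) WB imf f_inv_into_f[of q f "carrier_of A"] by blast
      then have "y = u (\<phi> (?g q))" "?g q \<in> Y"
        using u_eq[OF q(2)] q p(1)[of "?g q"] UA by auto
      then show "y \<in> u ` O'"
        using q(2) by (auto simp: O'_def)
    next
      fix y assume "y \<in> u ` O'"
      then obtain s where s: "s \<in> U" "s \<in> Y" "y = u (\<phi> s)"
        by (auto simp: O'_def)
      then have "?g (f s) = s"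
        using injf UA by auto
      then show "y \<in> \<psi> ` {q \<in> W. ?g q \<in> U}"
        using s u_eq p(1) UA by (intro image_eqI[of _ _ "f s"]) auto
    qed
    have val: "inv_into O' u y = local_rep (W, \<psi>) (U, \<phi>) ?g y" if y: "y \<in> u ` O'" for y
    proof -
      obtain s where s: "s \<in> U" "s \<in> Y" "y = u (\<phi> s)"
        using y by (auto simp: O'_def)
      have "f s \<in> W"
        using s p(1) UA by auto
      then have "inv_into W \<psi> y = f s"
        using s(1,3) u_eq inj\<psi> by auto
      moreover have "?g (f s) = s"
        using s injf UA by auto
      moreover have "inv_into O' u y = \<phi> s"
        using s uinj by (auto simp: O'_def)
      ultimately show ?thesis
        by (simp add: local_rep_def)
    qed
    \<comment> \<open>The inverse function theorem in the plane; by \<open>val\<close>, the local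
      inverse of \<open>u\<close> is the local representative of the inverse of
      \<open>f\<close>.\<close>
    have "open (u ` O')" "smooth_on (inv_into O' u) (u ` O')"
      using smooth_on_inv_into_plane[OF openO u uinj uD] by auto
    then have "smooth_on (local_rep (W, \<psi>) (U, \<phi>) ?g) (u ` O')"
      using smooth_on_cong[OF \<open>open (u ` O')\<close>, of "inv_into O' u"] val by blast
    then show ?thesis
      using openO u \<open>open (u ` O')\<close> unfolding O'_eq img u_def by blast
  qed
  have "smooth_map A B f"
    using main imf by (intro smooth_mapI[OF A B]) auto
  moreover have "smooth_map B A ?g"
  proof (intro smooth_mapI[OF B A])
    show "?g ` carrier_of B \<subseteq> carrier_of A"
      by (intro image_subsetI inv_into_into) (simp add: imf)
  qed (use main in auto)
  ultimately show ?thesis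
    using bij by (simp add: diffeomorphism_def)
qed

section \<open>Holomorphic curves in \<open>V\<close>\<close>

context hermitian_plane
begin

lemma herm_scaleR_left: "herm (r *\<^sub>R x) y = of_real r * herm x y"
  by (metis scaleC_of_real herm_scale_left)

lemma herm_add_right: "herm x (y + z) = herm x y + herm x z"
  using herm_cnj[of "y + z" x] herm_cnj[of y x] herm_cnj[of z x] herm_add_left
  by (metis complex_cnj_add complex_cnj_cnj)

lemma herm_scale_right: "herm x (scaleC c y) = cnj c * herm x y"
  by (metis herm_cnj herm_scale_left complex_cnj_mult)

lemma linear_herm: "linear (\<lambda>x. herm x y)"
  by (simp add: linear_iff herm_add_left herm_scaleR_left scaleR_conv_of_real)

lemma bounded_linear_herm: "bounded_linear (\<lambda>x. herm x y)"
  using linear_herm by (simp add: linear_conv_bounded_linear)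

lemma herm_0_left [simp]: "herm 0 y = 0"
  using linear_0[OF linear_herm] .

lemma herm_diff_left: "herm (x - z) y = herm x y - herm z y"
  using linear_diff[OF linear_herm] .

lemmas continuous_on_herm [continuous_intros] = bounded_linear.continuous_on[OF bounded_linear_herm]

lemma compact_attains_max_herm:
  assumes "compact D" "D \<noteq> {}"
  obtains p where "p \<in> D" "\<And>y. y \<in> D \<Longrightarrow> cmod (herm y b) \<le> cmod (herm p b)"
proof -
  have "continuous_on D (\<lambda>y. cmod (herm y b))"
    by (intro continuous_intros)
  then show ?thesis
    using continuous_attains_sup[OF assms] that by blast
qed

lemma herm_self: "herm x x = of_real ((norm x)\<^sup>2)"
proof -
  have "Im (herm x x) = 0"
    using herm_cnj[of x x] by (metis cnj.simps(2) equal_neg_zero)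
  then show ?thesis
    by (simp add: complex_eq_iff Re_herm power2_norm_eq_inner)
qed

lemma norm_scaleC: "norm (scaleC c x) = cmod c * norm x"
proof -
  have "complex_of_real ((norm (scaleC c x))\<^sup>2) = of_real ((cmod c * norm x)\<^sup>2)"
    unfolding herm_self[symmetric] herm_scale_left herm_scale_right
    by (simp add: herm_self power_mult_distrib mult_ac) (metis complex_norm_square of_real_power)
  then have "(norm (scaleC c x))\<^sup>2 = (cmod c * norm x)\<^sup>2"
    using of_real_eq_iff by blast
  then show ?thesis
    by (simp add: power2_eq_iff_nonneg)
qed

text \<open>The coordinates \<open>herm v e\<close> and \<open>herm v f\<close> serve as z and w.
  The expansion clause expresses that the orthonormal pair spans the plane.\<close>

definition unitary_frame :: "'v \<Rightarrow> 'v \<Rightarrow> bool" where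
  "unitary_frame e f \<longleftrightarrow> herm e e = 1 \<and> herm f f = 1 \<and> herm e f = 0 \<and>
     (\<forall>v. v = scaleC (herm v e) e + scaleC (herm v f) f)"

lemma unitary_frame_eqI:
  "unitary_frame e f \<Longrightarrow> herm x e = herm y e \<Longrightarrow> herm x f = herm y f \<Longrightarrow> x = y"
  unfolding unitary_frame_def by metis

lemma unitary_frame_norm_le:
  assumes "unitary_frame e f"
  shows "norm v \<le> cmod (herm v e) + cmod (herm v f)"
proof -
  have "norm e = 1" "norm f = 1"
    using assms herm_self[of e] herm_self[of f]
    by (simp_all add: unitary_frame_def power2_eq_1_iff del: of_real_power)
       (metis norm_ge_zero not_one_le_zero neg_0_le_iff_le of_real_eq_1_iff power2_eq_1_iff)+
  then show ?thesis
    using assms norm_triangle_ineq[of "scaleC (herm v e) e" "scaleC (herm v f) f"]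
    by (metis mult.right_neutral norm_scaleC unitary_frame_def)
qed

text \<open>Holomorphy is tested on the pairings with fixed vectors. The last clause excludes
  further sheets of \<open>M\<close> through or accumulating at \<open>p\<close>: even a shrunken
  disc fills a neighbourhood of \<open>p\<close> in \<open>M\<close>.\<close>

definition holo_disc :: "'v set \<Rightarrow> 'v \<Rightarrow> (complex \<Rightarrow> 'v) \<Rightarrow> real \<Rightarrow> bool" where
  "holo_disc M p h r \<longleftrightarrow> r > 0 \<and> h 0 = p \<and> h ` ball 0 r \<subseteq> M \<and> inj_on h (ball 0 r) \<and>
     continuous_on (ball 0 r) h \<and> (\<forall>b. (\<lambda>\<zeta>. herm (h \<zeta>) b) holomorphic_on ball 0 r) \<and>
     (\<forall>\<rho>. 0 < \<rho> \<and> \<rho> \<le> r \<longrightarrow> (\<exists>\<delta>>0. M \<inter> ball p \<delta> \<subseteq> h ` ball 0 \<rho>))"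

definition holo_curve :: "'v set \<Rightarrow> bool" where
  "holo_curve M \<longleftrightarrow> (\<forall>p\<in>M. \<exists>h r. holo_disc M p h r)"

text \<open>Holomorphy in two variables is replaced by its effect on holomorphic maps from plane
  domains, which is all the maximum principle uses.\<close>

definition holo_fun :: "('v \<Rightarrow> complex) \<Rightarrow> 'v set \<Rightarrow> bool" where
  "holo_fun F T \<longleftrightarrow> (\<forall>S h. open S \<and> (\<forall>b. (\<lambda>\<zeta>. herm (h \<zeta>) b) holomorphic_on S) \<and> h ` S \<subseteq> T \<longrightarrow>
     (\<lambda>\<zeta>. F (h \<zeta>)) holomorphic_on S)"

lemma holo_fun_herm: "holo_fun (\<lambda>y. herm y b) UNIV"
  by (simp add: holo_fun_def)

lemma holo_fun_divide: "holo_fun (\<lambda>y. herm y b ^ n / herm y c) {y. herm y c \<noteq> 0}"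
  unfolding holo_fun_def by (auto intro!: holomorphic_intros)

lemma holo_curve_small_disc:
  assumes "holo_curve M" "p \<in> M" "open T" "p \<in> T"
  obtains h r where "r > 0" "h 0 = p" "h ` ball 0 r \<subseteq> M \<inter> T" "inj_on h (ball 0 r)"
    "\<And>b. (\<lambda>\<zeta>. herm (h \<zeta>) b) holomorphic_on ball 0 r"
    "\<exists>\<delta>>0. M \<inter> ball p \<delta> \<subseteq> h ` ball 0 r"
proof -
  obtain h r where h: "r > 0" "h 0 = p" "h ` ball 0 r \<subseteq> M" "inj_on h (ball 0 r)"
    "continuous_on (ball 0 r) h" "\<And>b. (\<lambda>\<zeta>. herm (h \<zeta>) b) holomorphic_on ball 0 r"
    "\<And>\<rho>. 0 < \<rho> \<Longrightarrow> \<rho> \<le> r \<Longrightarrow> \<exists>\<delta>>0. M \<inter> ball p \<delta> \<subseteq> h ` ball 0 \<rho>"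
    using assms(1,2) unfolding holo_curve_def holo_disc_def by metis
  have "open (ball 0 r \<inter> h -` T)"
    using h(5) assms(3) by (intro continuous_open_preimage) auto
  then obtain \<rho> where \<rho>: "\<rho> > 0" "ball 0 \<rho> \<subseteq> ball 0 r \<inter> h -` T"
    using h(1,2) assms(4) by (metis IntI centre_in_ball open_contains_ball vimageI)
  show ?thesis
  proof (rule that[of "min r \<rho>" h])
    have sub: "ball 0 (min r \<rho>) \<subseteq> ball (0::complex) r"
      by auto
    show "h ` ball 0 (min r \<rho>) \<subseteq> M \<inter> T"
      using h(3) \<rho>(2) by fastforce
    show "inj_on h (ball 0 (min r \<rho>))"
      using h(4) sub by (rule inj_on_subset)
    show "(\<lambda>\<zeta>. herm (h \<zeta>) b) holomorphic_on ball 0 (min r \<rho>)" for b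
      using h(6) sub by (rule holomorphic_on_subset)
    show "\<exists>\<delta>>0. M \<inter> ball p \<delta> \<subseteq> h ` ball 0 (min r \<rho>)"
      using h(1,7) \<rho>(1) by simp
  qed (use h \<rho> in auto)
qed

text \<open>Pulled back along a small disc, the function of one variable has an interior maximum of
  modulus and is constant. The disc fills a neighbourhood of \<open>p\<close> in \<open>M\<close>,
  so constancy passes to \<open>M\<close>.\<close>

lemma holo_curve_max_principle:
  assumes M: "holo_curve M" "p \<in> M" and T: "open T" "p \<in> T" "holo_fun F T"
    and max: "\<And>y. y \<in> M \<inter> T \<Longrightarrow> cmod (F y) \<le> cmod (F p)"
  shows "\<exists>\<delta>>0. \<forall>y\<in>M \<inter> ball p \<delta>. F y = F p"
proof -
  obtain h r where h: "r > 0" "h 0 = p" "h ` ball 0 r \<subseteq> M \<inter> T"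
    "\<And>b. (\<lambda>\<zeta>. herm (h \<zeta>) b) holomorphic_on ball 0 r"
    "\<exists>\<delta>>0. M \<inter> ball p \<delta> \<subseteq> h ` ball 0 r"
    using holo_curve_small_disc[OF M T(1,2)] by metis
  have "(\<lambda>\<zeta>. F (h \<zeta>)) holomorphic_on ball 0 r"
    using T(3) h(3,4) unfolding holo_fun_def by auto
  moreover have "cmod (F (h \<zeta>)) \<le> cmod (F (h 0))" if "\<zeta> \<in> ball 0 r" for \<zeta>
    using max[of "h \<zeta>"] h(2,3) that by blast
  ultimately have "(\<lambda>\<zeta>. F (h \<zeta>)) constant_on ball 0 r"
    using h(1) by (intro maximum_modulus_principle[where \<xi> = 0 and U = "ball 0 r"]) auto
  then have "F (h \<zeta>) = F p" if "\<zeta> \<in> ball 0 r" for \<zeta>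
    using that h(1,2) unfolding constant_on_def by (metis centre_in_ball)
  then show ?thesis
    using h(5) by blast
qed

text \<open>Maximize first one coordinate and then, on the set of maximizers, the other one: by the
  maximum principle both are constant near the point found, which is therefore isolated.\<close>

lemma no_compact_clopen_subset_holo_curve:
  assumes frame: "unitary_frame e f" and M: "holo_curve M"
    and D: "D \<subseteq> M" "compact D" and opn: "\<And>p. p \<in> D \<Longrightarrow> \<exists>\<delta>>0. M \<inter> ball p \<delta> \<subseteq> D"
  shows "D = {}"
proof (rule ccontr)
  assume "D \<noteq> {}"
  then obtain p1 where p1: "p1 \<in> D" "\<And>y. y \<in> D \<Longrightarrow> cmod (herm y e) \<le> cmod (herm p1 e)"
    using compact_attains_max_herm[OF D(2)] by metis
  define D1 where "D1 = D \<inter> {y. cmod (herm y e) = cmod (herm p1 e)}"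
  have "closed {y. cmod (herm y e) = cmod (herm p1 e)}"
    by (intro closed_Collect_eq continuous_intros)
  then have "compact D1"
    unfolding D1_def by (rule compact_Int_closed[OF D(2)])
  moreover have "D1 \<noteq> {}"
    using p1(1) by (auto simp: D1_def)
  ultimately obtain p where p: "p \<in> D1" "\<And>y. y \<in> D1 \<Longrightarrow> cmod (herm y f) \<le> cmod (herm p f)"
    using compact_attains_max_herm by metis
  have pD: "p \<in> D" "p \<in> M" "cmod (herm p e) = cmod (herm p1 e)"
    using p(1) D(1) by (auto simp: D1_def)
  obtain d0 where d0: "d0 > 0" "M \<inter> ball p d0 \<subseteq> D"
    using opn[OF pD(1)] by blast
  have hf: "holo_fun (\<lambda>y. herm y b) (ball p d)" for b d
    by (simp add: holo_fun_def)
  obtain d1 where d1: "d1 > 0" "\<And>y. y \<in> M \<inter> ball p d1 \<Longrightarrow> herm y e = herm p e"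
  proof -
    have "cmod (herm y e) \<le> cmod (herm p e)" if "y \<in> M \<inter> ball p d0" for y
      using p1(2)[of y] pD(3) d0(2) that by auto
    then show ?thesis
      using that holo_curve_max_principle[OF M pD(2) open_ball _ hf[of e d0]] d0(1) by auto
  qed
  define d2 where "d2 = min d0 d1"
  have d2: "d2 > 0" "M \<inter> ball p d2 \<subseteq> D1" "\<And>y. y \<in> M \<inter> ball p d2 \<Longrightarrow> herm y e = herm p e"
    using d0 d1 pD(3) by (auto simp: d2_def D1_def)
  obtain d3 where d3: "d3 > 0" "\<And>y. y \<in> M \<inter> ball p d3 \<Longrightarrow> herm y f = herm p f"
  proof -
    have "cmod (herm y f) \<le> cmod (herm p f)" if "y \<in> M \<inter> ball p d2" for y
      using p(2)[of y] d2(2) that by auto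
    then show ?thesis
      using that holo_curve_max_principle[OF M pD(2) open_ball _ hf[of f d2]] d2(1) by auto
  qed
  have iso: "y = p" if "y \<in> M \<inter> ball p (min d2 d3)" for y
    using d2(3)[of y] d3(2)[of y] that by (intro unitary_frame_eqI[OF frame]) auto
  have p_ball: "p \<in> ball p (min d2 d3)"
    using d2 d3 by simp
  obtain h :: "complex \<Rightarrow> 'v" and r where h: "r > 0" "h 0 = p" "h ` ball 0 r \<subseteq> M \<inter> ball p (min d2 d3)"
    "inj_on h (ball 0 r)"
    using holo_curve_small_disc[OF M pD(2) open_ball p_ball] by metis
  \<comment> \<open>An injective disc centred at \<open>p\<close> contains a second point, so
    \<open>p\<close> cannot be isolated in \<open>M\<close>.\<close>
  have "of_real (r / 2) \<in> ball (0::complex) r"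
    using h(1) by (simp add: dist_norm)
  then have "h (of_real (r / 2)) = h 0"
    using iso h(2,3) by blast
  then have "complex_of_real (r / 2) = 0"
    using h(1,4) \<open>of_real (r / 2) \<in> ball (0::complex) r\<close> by (auto dest: inj_onD)
  then show False
    using h(1) by simp
qed

text \<open>The connected set \<open>N\<close> represents the single end of the curve. A level set
  of w at its maximum is relatively clopen and noncompact, so it meets \<open>N\<close> and hence
  contains it; the remainder of \<open>M\<close> is bounded and must be empty.\<close>

lemma bounded_holo_curve_is_line:
  assumes frame: "unitary_frame e f" and M: "holo_curve M" "closed M" "M \<noteq> {}"
    and B: "\<And>y. y \<in> M \<Longrightarrow> cmod (herm y f) \<le> B"
    and N: "connected N" "N \<subseteq> M" "\<And>y. y \<in> M \<Longrightarrow> norm y > R \<Longrightarrow> y \<in> N"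
  obtains w where "M = {y. herm y f = w}"
proof -
  have comp: "compact (M \<inter> {y. cmod (herm y e) \<le> r})" for r
  proof -
    have "norm y \<le> r + B" if "y \<in> M \<inter> {y. cmod (herm y e) \<le> r}" for y
      using unitary_frame_norm_le[OF frame, of y] B[of y] that by auto
    then have "bounded (M \<inter> {y. cmod (herm y e) \<le> r})"
      unfolding bounded_iff by blast
    moreover have "closed (M \<inter> {y. cmod (herm y e) \<le> r})"
      using M(2) by (intro closed_Int closed_Collect_le continuous_intros)
    ultimately show ?thesis
      by (simp add: compact_eq_bounded_closed)
  qed
  obtain p0 where p0: "p0 \<in> M"
    using M(3) by blast
  \<comment> \<open>Any positive radius for which the slab |z| <= r meets \<open>M\<close> would do;
    \<open>m\<close> is then the maximum of |w| on that slab.\<close>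
  define r where "r = cmod (herm p0 e) + 1"
  have r: "r > 0" "p0 \<in> M \<inter> {y. cmod (herm y e) \<le> r}"
    using p0 by (auto simp: r_def add_nonneg_pos)
  then have "M \<inter> {y. cmod (herm y e) \<le> r} \<noteq> {}"
    by blast
  then obtain q0 where "q0 \<in> M \<inter> {y. cmod (herm y e) \<le> r}"
    "\<And>y. y \<in> M \<inter> {y. cmod (herm y e) \<le> r} \<Longrightarrow> cmod (herm y f) \<le> cmod (herm q0 f)"
    using compact_attains_max_herm[OF comp[of r]] by metis
  then have q0: "q0 \<in> M"
    "\<And>y. y \<in> M \<Longrightarrow> cmod (herm y e) \<le> r \<Longrightarrow> cmod (herm y f) \<le> cmod (herm q0 f)"
    by simp_all
  define m where "m = cmod (herm q0 f)"
  text \<open>A Phragmen-Lindelof argument: otherwise a suitable \<open>w\<^sup>n / z\<close> has an interior maximum.\<close>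
  have max: "cmod (herm p f) \<le> m" if p: "p \<in> M" for p
  proof (rule ccontr)
    assume "\<not> cmod (herm p f) \<le> m"
    then have mp: "m < cmod (herm p f)" by simp
    then have zp: "cmod (herm p e) > r"
      using q0(2)[OF p] by (force simp: m_def)
    have m0: "m \<ge> 0" by (simp add: m_def)
    have pos: "cmod (herm p f) > 0" "cmod (herm p e) > 0"
      using mp m0 zp r(1) by linarith+
    \<comment> \<open>As |w(p)| exceeds \<open>m\<close>, the powers of the ratio tend to zero. For
      large \<open>n\<close> the modulus of w^n / z at \<open>p\<close> therefore exceeds
      \<open>m ^ n / r\<close>, its bound on the inner boundary |z| = r.\<close>
    have "m / cmod (herm p f) < 1" "r / cmod (herm p e) > 0"
      using mp r(1) pos by simp_all
    then obtain n where "(m / cmod (herm p f)) ^ n < r / cmod (herm p e)"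
      using real_arch_pow_inv by blast
    then have n: "m ^ n / r < cmod (herm p f) ^ n / cmod (herm p e)"
      using pos r(1) by (simp add: power_divide field_simps)
    define F where "F y = herm y f ^ n / herm y e" for y
    define c where "c = cmod (F p)"
    have c: "c > 0" "m ^ n / r < c"
      using n pos by (simp_all add: c_def F_def norm_divide norm_power)
    \<comment> \<open>Since |w| is at most \<open>B\<close>, the quotient is smaller than
      \<open>c\<close> once |z| exceeds \<open>B ^ n / c\<close>. Its maximum over the compact part
      \<open>E\<close> is thus its maximum over all of \<open>M\<close> with |z| >= r.\<close>
    define s where "s = max (cmod (herm p e)) (B ^ n / c)"
    have out: "cmod (F y) < c" if y: "y \<in> M" "cmod (herm y e) > s" for y
    proof -
      have "cmod (herm y e) > B ^ n / c" "cmod (herm y e) > 0"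
        using y(2) zp r(1) by (auto simp: s_def)
      moreover have "cmod (herm y f) ^ n \<le> B ^ n"
        using B[OF y(1)] by (simp add: power_mono)
      ultimately show ?thesis
        using c(1) by (simp add: F_def norm_divide norm_power field_simps)
    qed
    define E where "E = (M \<inter> {y. cmod (herm y e) \<le> s}) \<inter> {y. r \<le> cmod (herm y e)}"
    have "compact E"
      unfolding E_def by (intro compact_Int_closed[OF comp] closed_Collect_le continuous_intros)
    have "p \<in> E"
      using p zp by (auto simp: E_def s_def)
    have contF: "continuous_on E (\<lambda>y. cmod (F y))"
      unfolding F_def using r(1) by (intro continuous_intros) (auto simp: E_def)
    obtain q where q: "q \<in> E" "\<And>y. y \<in> E \<Longrightarrow> cmod (F y) \<le> cmod (F q)"
      using continuous_attains_sup[OF \<open>compact E\<close> _ contF] \<open>p \<in> E\<close> by blast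
    have cq: "c \<le> cmod (F q)"
      using q(2)[OF \<open>p \<in> E\<close>] by (simp add: c_def)
    have Fq: "cmod (F y) \<le> cmod (F q)" if "y \<in> M" "r \<le> cmod (herm y e)" for y
      using that out[of y] q(2)[of y] cq by (force simp: E_def not_le)
    \<comment> \<open>The set of maximum points is compact. It avoids both boundaries of
      \<open>E\<close>, so the maximum principle makes it relatively open in \<open>M\<close>, which
      is impossible for a nonempty set.\<close>
    define D where "D = E \<inter> (\<lambda>y. cmod (F y)) -` {cmod (F q)}"
    have "compact D"
    proof -
      have "closed D"
        unfolding D_def
        by (intro continuous_closed_preimage contF compact_imp_closed \<open>compact E\<close>) auto
      then show ?thesis
        using \<open>compact E\<close> compact_Int_closed[of E D] by (simp add: D_def)
    qed
    moreover have "D \<subseteq> M"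
      by (auto simp: D_def E_def)
    moreover have "\<exists>\<delta>>0. M \<inter> ball y \<delta> \<subseteq> D" if y: "y \<in> D" for y
    proof -
      have y': "y \<in> M" "r \<le> cmod (herm y e)" "cmod (F y) = cmod (F q)"
        using y by (auto simp: D_def E_def)
      \<comment> \<open>On the inner boundary the quotient is at most \<open>m ^ n / r\<close>,
        which the choice of \<open>n\<close> put below \<open>c\<close>.\<close>
      have "cmod (herm y e) \<noteq> r"
      proof
        assume r': "cmod (herm y e) = r"
        then have "cmod (F y) \<le> m ^ n / r"
          using q0(2)[OF y'(1)] r(1)
          by (simp add: F_def norm_divide norm_power m_def divide_right_mono power_mono)
        then show False
          using y'(3) cq c(2) by simp
      qed
      then have yr: "cmod (herm y e) > r"
        using y'(2) by simp
      let ?T = "{y. r < cmod (herm y e)}"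
      have T: "open ?T"
        by (intro open_Collect_less continuous_intros)
      have "holo_fun F ?T"
        using holo_fun_divide[of f n e] r(1) unfolding holo_fun_def F_def by force
      then obtain d1 where d1: "d1 > 0" "\<And>x. x \<in> M \<inter> ball y d1 \<Longrightarrow> F x = F y"
        using holo_curve_max_principle[OF M(1) y'(1) T, of F] yr Fq y'(3) by auto
      obtain d2 where d2: "d2 > 0" "ball y d2 \<subseteq> ?T"
        using T yr open_contains_ball by blast
      have "x \<in> D" if "x \<in> M \<inter> ball y (min d1 d2)" for x
      proof -
        have x: "x \<in> M" "F x = F y" "r < cmod (herm x e)"
          using that d1 d2 by auto
        moreover have "cmod (herm x e) \<le> s"
          using out[OF x(1)] x(2) y'(3) cq by (metis linorder_not_le)
        ultimately show ?thesis
          using y'(3) by (auto simp: D_def E_def)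
      qed
      then show ?thesis
        using d1(1) d2(1) by (intro exI[of _ "min d1 d2"]) auto
    qed
    ultimately have "D = {}"
      by (intro no_compact_clopen_subset_holo_curve[OF frame M(1)])
    then show False
      using q(1) by (auto simp: D_def)
  qed
  define w where "w = herm q0 f"
  define C where "C = M \<inter> {y. herm y f = w}"
  have clC: "closed {y. herm y f = w}"
    by (intro closed_Collect_eq continuous_intros)
  have opC: "\<exists>\<delta>>0. M \<inter> ball p \<delta> \<subseteq> C" if p: "p \<in> C" for p
  proof -
    have p': "p \<in> M" "herm p f = w"
      using p by (auto simp: C_def)
    have "\<exists>\<delta>>0. \<forall>y\<in>M \<inter> ball p \<delta>. herm y f = herm p f"
      by (rule holo_curve_max_principle[OF M(1) p'(1) open_UNIV UNIV_I holo_fun_herm])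
        (use max p' in \<open>auto simp: m_def w_def\<close>)
    then show ?thesis
      using p'(2) by (auto simp: C_def)
  qed
  have "q0 \<in> C"
    using q0(1) by (auto simp: C_def w_def)
  \<comment> \<open>A bounded level set would be a nonempty compact relatively open subset of
    \<open>M\<close>; so it reaches the end.\<close>
  have "\<exists>y\<in>C. norm y > R"
  proof (rule ccontr)
    assume "\<not> ?thesis"
    then have "bounded C"
      unfolding bounded_iff by (meson not_le)
    moreover have "closed C"
      unfolding C_def using M(2) clC by (rule closed_Int)
    ultimately have "C = {}"
      using opC by (intro no_compact_clopen_subset_holo_curve[OF frame M(1)])
        (auto simp: compact_eq_bounded_closed C_def)
    then show False
      using \<open>q0 \<in> C\<close> by simp
  qed
  then have NC: "N \<inter> C \<noteq> {}"
    using N(3) by (auto simp: C_def)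
  have "openin (top_of_set N) (N \<inter> C)"
    unfolding openin_euclidean_subtopology_iff
  proof (intro conjI ballI)
    fix x assume "x \<in> N \<inter> C"
    then obtain \<delta> where "\<delta> > 0" "M \<inter> ball x \<delta> \<subseteq> C"
      using opC by blast
    then show "\<exists>e>0. \<forall>x'\<in>N. dist x' x < e \<longrightarrow> x' \<in> N \<inter> C"
      using N(2) by (intro exI[of _ \<delta>]) (auto simp: dist_commute subset_iff)
  qed auto
  moreover have "closedin (top_of_set N) (N \<inter> C)"
  proof -
    have "N \<inter> C = N \<inter> {y. herm y f = w}"
      using N(2) by (auto simp: C_def)
    then show ?thesis
      using clC by (simp add: closedin_closed_Int)
  qed
  ultimately have "N \<inter> C = N"
    using N(1) NC unfolding connected_clopen by blast
  \<comment> \<open>The complement of \<open>C\<close> in \<open>M\<close> is also relatively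
    clopen, and it misses \<open>N\<close>, which contains every point of norm above
    \<open>R\<close>; so it is compact.\<close>
  have "M - C = {}"
  proof (rule no_compact_clopen_subset_holo_curve[OF frame M(1)])
    have "bounded (M - C)"
      unfolding bounded_iff using N(3) \<open>N \<inter> C = N\<close> by (intro exI[of _ R]) (force simp: not_le)
    moreover have "openin (top_of_set M) C"
      unfolding openin_euclidean_subtopology_iff
    proof (intro conjI ballI)
      fix x assume "x \<in> C"
      then obtain \<delta> where "\<delta> > 0" "M \<inter> ball x \<delta> \<subseteq> C"
        using opC by blast
      then show "\<exists>e>0. \<forall>x'\<in>M. dist x' x < e \<longrightarrow> x' \<in> C"
        by (intro exI[of _ \<delta>]) (auto simp: dist_commute subset_iff)
    qed (auto simp: C_def)
    then have "closedin (top_of_set M) (M - C)"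
      using closedin_diff[OF closedin_topspace, of "top_of_set M" C] by simp
    then have "closed (M - C)"
      using M(2) closedin_closed_trans by blast
    ultimately show "compact (M - C)"
      by (simp add: compact_eq_bounded_closed)
    show "\<exists>\<delta>>0. M \<inter> ball p \<delta> \<subseteq> M - C" if "p \<in> M - C" for p
    proof -
      have "open (- {y. herm y f = w})" "p \<in> - {y. herm y f = w}"
        using clC that by (auto simp: C_def)
      then obtain \<delta> where "\<delta> > 0" "ball p \<delta> \<subseteq> - {y. herm y f = w}"
        using open_contains_ball by blast
      then show ?thesis
        by (intro exI[of _ \<delta>]) (auto simp: C_def)
    qed
  qed auto
  then have Mw: "herm y f = w" if "y \<in> M" for y
    using that by (auto simp: C_def)
  define L where "L = {y. herm y f = w}"
  have "convex L"
    unfolding convex_def L_def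
    by (simp add: herm_add_left herm_scaleR_left) (metis distrib_right mult_1 of_real_1 of_real_add)
  then have "connected L"
    by (rule convex_connected)
  moreover have "closedin (top_of_set L) M"
    using M(2) Mw by (intro closed_subset) (auto simp: L_def)
  moreover have "openin (top_of_set L) M"
    unfolding openin_euclidean_subtopology_iff
  proof (intro conjI ballI)
    show "M \<subseteq> L"
      using Mw by (auto simp: L_def)
    fix p assume p: "p \<in> M"
    then obtain h r where h: "r > 0" "h 0 = p" "h ` ball 0 r \<subseteq> M \<inter> UNIV" "inj_on h (ball 0 r)"
      "\<And>b. (\<lambda>\<zeta>. herm (h \<zeta>) b) holomorphic_on ball 0 r"
      using holo_curve_small_disc[OF M(1) p open_UNIV UNIV_I] by metis
    \<comment> \<open>With w constant, z alone separates the points of the disc. An injective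
      holomorphic function is open, so all points of the line near \<open>p\<close> already lie on
      the disc.\<close>
    let ?z = "\<lambda>\<zeta>. herm (h \<zeta>) e"
    have "inj_on ?z (ball 0 r)"
    proof (rule inj_onI)
      fix x y assume xy: "x \<in> ball 0 r" "y \<in> ball 0 r" "?z x = ?z y"
      then have "herm (h x) f = herm (h y) f"
        using h(3) Mw by (metis (no_types, lifting) IntD1 imageI subsetD)
      then have "h x = h y"
        using xy(3) by (intro unitary_frame_eqI[OF frame])
      then show "x = y"
        using h(4) xy by (auto dest: inj_onD)
    qed
    then have "open (?z ` ball 0 r)"
      using h(5) by (intro open_mapping_thm3) auto
    then have "open ((\<lambda>y. herm y e) -` (?z ` ball 0 r))"
      by (intro open_vimage continuous_intros)
    moreover have "p \<in> (\<lambda>y. herm y e) -` (?z ` ball 0 r)"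
      using h(1,2) by (auto intro!: image_eqI[of _ _ 0])
    ultimately obtain \<delta> where \<delta>: "\<delta> > 0" "ball p \<delta> \<subseteq> (\<lambda>y. herm y e) -` (?z ` ball 0 r)"
      using open_contains_ball by blast
    have "x \<in> M" if x: "x \<in> L" "dist x p < \<delta>" for x
    proof -
      have "x \<in> ball p \<delta>"
        using x(2) by (simp add: dist_commute)
      then obtain \<zeta> where \<zeta>: "\<zeta> \<in> ball 0 r" "herm x e = herm (h \<zeta>) e"
        using \<delta>(2) by blast
      moreover have "h \<zeta> \<in> M"
        using h(3) \<zeta>(1) by blast
      moreover have "herm x f = herm (h \<zeta>) f"
        using x(1) Mw[OF \<open>h \<zeta> \<in> M\<close>] by (simp add: L_def)
      ultimately show ?thesis
        using unitary_frame_eqI[OF frame, of x "h \<zeta>"] by simp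
    qed
    then show "\<exists>e>0. \<forall>x'\<in>L. dist x' p < e \<longrightarrow> x' \<in> M"
      using \<delta>(1) by blast
  qed
  ultimately have "M = L"
    using M(3) unfolding connected_clopen by blast
  then show ?thesis
    using that by (auto simp: L_def)
qed

end

section \<open>Existence of unitary frames\<close>

context hermitian_plane
begin

lemma herm_diff_right: "herm x (y - z) = herm x y - herm x z"
  by (metis add_diff_cancel_right' diff_add_cancel herm_add_right)

lemma exists_unitary_frame: "\<exists>e f. unitary_frame e f"
proof -
  obtain B where B: "independent B" "UNIV \<subseteq> span B" "card B = 2"
    using basis_exists[of UNIV] dim_2 by metis
  then obtain b1 b2 where b: "B = {b1, b2}" "b1 \<noteq> b2"
    by (auto simp: card_2_iff)
  have b1: "b1 \<noteq> 0" and b2: "b2 \<notin> span {b1}"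
    using B(1) b dependent_zero[of B] independent_insert[of b2 "{b1}"]
    by (auto simp: insert_commute)
  define e where "e = b1 /\<^sub>R norm b1"
  define f0 where "f0 = b2 - scaleC (herm b2 e) e"
  define f where "f = f0 /\<^sub>R norm f0"
  have unit: "herm (v /\<^sub>R norm v) (v /\<^sub>R norm v) = 1" if "v \<noteq> 0" for v
    using that by (simp add: herm_self)
  have re: "r *\<^sub>R v = scaleC (of_real r) v" for r v
    by (simp add: scaleC_of_real)
  have ee: "herm e e = 1"
    using unit[OF b1] by (simp add: e_def)
  have e_span: "e = scaleC (of_real (inverse (norm b1))) b1"
    by (simp add: e_def re)
  have "f0 \<noteq> 0"
  proof
    assume "f0 = 0"
    then have "b2 = scaleC (herm b2 e * of_real (inverse (norm b1))) b1"
      by (simp add: f0_def e_span)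
    then show False
      using b2 by (auto simp: span_singleton)
  qed
  then have ff: "herm f f = 1"
    using unit by (simp add: f_def)
  have "herm f0 e = 0"
    by (simp add: f0_def herm_diff_left herm_scale_left ee)
  then have "herm f e = 0"
    by (simp add: f_def herm_scaleR_left)
  then have ef: "herm e f = 0"
    using herm_cnj[of e f] by simp
  have "v = scaleC (herm v e) e + scaleC (herm v f) f" for v
  proof -
    have b1': "b1 = scaleC (of_real (norm b1)) e"
      using b1 by (simp add: e_span)
    have "b2 = f0 + scaleC (herm b2 e) e"
      by (simp add: f0_def)
    moreover have "f0 = scaleC (of_real (norm f0)) f"
      using \<open>f0 \<noteq> 0\<close> by (simp add: f_def re)
    ultimately have b2': "b2 = scaleC (of_real (norm f0)) f + scaleC (herm b2 e) e"
      by metis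
    have "v \<in> span (insert b1 {b2})"
      using B(2) b(1) by blast
    then obtain k where "v - scaleC k b1 \<in> span {b2}"
      unfolding span_insert by blast
    then obtain l where "v - scaleC k b1 = scaleC l b2"
      unfolding span_singleton by blast
    then have "v = scaleC k (scaleC (of_real (norm b1)) e) +
        scaleC l (scaleC (of_real (norm f0)) f + scaleC (herm b2 e) e)"
      using b1' b2' by (metis add.commute diff_add_cancel)
    then have "v = scaleC (k * of_real (norm b1) + l * herm b2 e) e + scaleC (l * of_real (norm f0)) f"
      by (simp add: scale_right_distrib scale_left_distrib)
    then obtain s t where v: "v = scaleC s e + scaleC t f"
      by blast
    show ?thesis
      unfolding v using ee ff ef \<open>herm f e = 0\<close> by (simp add: herm_add_left herm_scale_left)
  qed
  then show ?thesis
    using ee ff ef unfolding unitary_frame_def by blast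
qed

lemma exists_unitary_frame_with:
  assumes "norm e = 1"
  shows "\<exists>f. unitary_frame e f"
proof -
  obtain E F where EF: "herm E E = 1" "herm F F = 1" "herm E F = 0"
    "\<And>v. v = scaleC (herm v E) E + scaleC (herm v F) F"
    using exists_unitary_frame unfolding unitary_frame_def by blast
  have FE: "herm F E = 0"
    using EF(3) herm_cnj[of F E] by simp
  define \<alpha> \<beta> where "\<alpha> = herm e E" "\<beta> = herm e F"
  have e: "e = scaleC \<alpha> E + scaleC \<beta> F"
    using EF(4)[of e] by (simp add: \<alpha>_\<beta>_def)
  have one: "\<alpha> * cnj \<alpha> + \<beta> * cnj \<beta> = 1"
    using herm_self[of e] assms
    by (subst (asm) (1 2) e) (simp add: herm_add_left herm_add_right herm_scale_left herm_scale_right EF FE mult_ac)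
  \<comment> \<open>The second column completing the unit coordinate vector of \<open>e\<close> to a
    matrix in SU(2).\<close>
  define f where "f = scaleC (- cnj \<beta>) E + scaleC (cnj \<alpha>) F"
  have "herm e e = 1"
    using herm_self[of e] assms by simp
  moreover have "herm f f = 1" "herm e f = 0"
    using one by (simp_all add: e f_def herm_add_left herm_add_right herm_scale_left
        herm_scale_right herm_diff_left herm_diff_right EF FE algebra_simps)
  moreover have "v = scaleC (herm v e) e + scaleC (herm v f) f" for v
  proof -
    define a b where "a = herm v E" "b = herm v F"
    have ve: "herm v e = a * cnj \<alpha> + b * cnj \<beta>" "herm v f = b * \<alpha> - a * \<beta>"
      by (simp_all add: e f_def herm_add_right herm_scale_right herm_diff_right a_b_def algebra_simps)
    have "scaleC (herm v e) e + scaleC (herm v f) f =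
        scaleC (herm v e * \<alpha> - herm v f * cnj \<beta>) E + scaleC (herm v e * \<beta> + herm v f * cnj \<alpha>) F"
      by (simp add: e f_def scale_right_distrib scale_left_distrib
        scale_left_diff_distrib scale_right_diff_distrib)
    also have "herm v e * \<alpha> - herm v f * cnj \<beta> = a * (\<alpha> * cnj \<alpha> + \<beta> * cnj \<beta>)"
      by (simp add: ve algebra_simps)
    also have "herm v e * \<beta> + herm v f * cnj \<alpha> = b * (\<alpha> * cnj \<alpha> + \<beta> * cnj \<beta>)"
      by (simp add: ve algebra_simps)
    finally show ?thesis
      using EF(4)[of v] by (simp add: one a_b_def)
  qed
  ultimately show ?thesis
    unfolding unitary_frame_def by blast
qed

end

section \<open>Surfaces pseudoholomorphically embedded in \<open>S\<close>\<close>

locale closed_holo_surface = hermitian_plane scaleC herm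
  for scaleC :: "complex \<Rightarrow> 'v::euclidean_space \<Rightarrow> 'v" and herm :: "'v \<Rightarrow> 'v \<Rightarrow> complex" +
  fixes A :: "('v option, real^2) atlas"
  assumes smooth_A: "smooth_atlas A" and compact_A: "compact_space (atlas_topology A)"
    and nonempty_A: "carrier_of A \<noteq> {}"
    and embedded_A: "embedded_submanifold A S_atlas"
    and holo_A: "pseudoholomorphic_immersion scaleC A id"
begin

definition "M = {y. Some y \<in> carrier_of A}"

lemma smooth_map_A: "smooth_map A S_atlas id"
  using embedded_A by (simp add: embedded_submanifold_def immersion_def)

lemma inj_chart: "(U, \<phi>) \<in> A \<Longrightarrow> inj_on \<phi> U"
  using smooth_A by (auto simp: smooth_atlas_def)

lemma chart_in_carrier: "(U, \<phi>) \<in> A \<Longrightarrow> U \<subseteq> carrier_of A"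
  by (auto simp: carrier_of_def)

lemma rep:
  assumes "(U, \<phi>) \<in> A" "(W, \<psi>) \<in> S_atlas"
  shows "open (\<phi> ` {p \<in> U. p \<in> W})" "smooth_on (local_rep (U, \<phi>) (W, \<psi>) id) (\<phi> ` {p \<in> U. p \<in> W})"
    and "p \<in> U \<Longrightarrow> local_rep (U, \<phi>) (W, \<psi>) id (\<phi> p) = \<psi> p"
    and "p \<in> U \<Longrightarrow> p \<in> W \<Longrightarrow>
      inj (frechet_derivative (local_rep (U, \<phi>) (W, \<psi>) id) (at (\<phi> p)))"
proof -
  show "open (\<phi> ` {p \<in> U. p \<in> W})"
    using smooth_map_open_chart[OF smooth_A S.smooth_atlas smooth_map_A assms(1)
        openin_chart_domain[OF S.smooth_atlas assms(2)]] by simp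
  show "smooth_on (local_rep (U, \<phi>) (W, \<psi>) id) (\<phi> ` {p \<in> U. p \<in> W})"
    using smooth_map_A assms unfolding smooth_map_def by fastforce
  show "p \<in> U \<Longrightarrow> local_rep (U, \<phi>) (W, \<psi>) id (\<phi> p) = \<psi> p"
    using inj_chart[OF assms(1)] by (simp add: local_rep_def)
  show "p \<in> U \<Longrightarrow> p \<in> W \<Longrightarrow>
      inj (frechet_derivative (local_rep (U, \<phi>) (W, \<psi>) id) (at (\<phi> p)))"
    using embedded_A assms unfolding embedded_submanifold_def immersion_def by fastforce
qed

lemma complex_tangent:
  assumes "(U, \<phi>) \<in> A" "x \<in> \<phi> ` {p \<in> U. p \<in> UNIV - {None}}"
  obtains e where "e \<noteq> 0"
    "range (frechet_derivative (affine_rep U \<phi>) (at x)) = cline scaleC e"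
proof -
  obtain p where "p \<in> U" "p \<noteq> None" "x = \<phi> p"
    using assms(2) by auto
  then show ?thesis
    using holo_A assms(1) that unfolding pseudoholomorphic_immersion_def Let_def by fastforce
qed

text \<open>The embedding, beyond the immersion, is used here: the surface carries the subspace
  topology of S. Points of the surface close to a given point in S thus lie in any prescribed chart
  neighbourhood of it.\<close>

lemma openin_A_eq:
  assumes "openin (atlas_topology A) T"
  obtains Y where "openin (atlas_topology S_atlas) Y" "T = Y \<inter> carrier_of A"
proof -
  have "homeomorphic_map (atlas_topology A)
      (subtopology (atlas_topology S_atlas) (id ` topspace (atlas_topology A))) id"
    using embedded_A by (simp add: embedded_submanifold_def embedding_map_def)
  then have "open_map (atlas_topology A)
      (subtopology (atlas_topology S_atlas) (id ` topspace (atlas_topology A))) id"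
    by (rule homeomorphic_imp_open_map)
  then have "openin (subtopology (atlas_topology S_atlas) (carrier_of A)) T"
    using assms unfolding open_map_def topspace_atlas_topology[OF smooth_A] by auto
  then show ?thesis
    using that by (auto simp: openin_subtopology)
qed

lemma nbhd_finite:
  assumes "openin (atlas_topology A) T" "Some p \<in> T"
  obtains \<delta> where "\<delta> > 0" "\<And>y. y \<in> M \<inter> ball p \<delta> \<Longrightarrow> Some y \<in> T"
proof -
  obtain Y where Y: "openin (atlas_topology S_atlas) Y" "T = Y \<inter> carrier_of A"
    using openin_A_eq[OF assms(1)] .
  have "open (the ` (Y - {None}))"
    by (rule S.open_image_chart[OF Y(1)])
  moreover have "p \<in> the ` (Y - {None})"
    using assms(2) Y(2) by force
  ultimately obtain \<delta> where "\<delta> > 0" "ball p \<delta> \<subseteq> the ` (Y - {None})"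
    using open_contains_ball by blast
  then show ?thesis
    using that[of \<delta>] Y(2) by (fastforce simp: M_def)
qed

text \<open>\<Phi> replaces norms by their reciprocals, so a ball of radius \<epsilon> about the
  image of infinity corresponds to the exterior of the ball of radius 1/\<epsilon>.\<close>

lemma S_nbhd_infinity:
  fixes Y :: "'v option set"
  assumes "openin (atlas_topology S_atlas) Y" "None \<in> Y"
  obtains R where "\<And>y. norm y > R \<Longrightarrow> Some y \<in> Y"
proof -
  have "open (inversion_chart ` (Y \<inter> (UNIV - {Some 0})))"
    using assms(1) S_charts(2) by (auto simp: openin_atlas_topology[OF S.smooth_atlas])
  moreover have "0 \<in> inversion_chart ` (Y \<inter> (UNIV - {Some 0}))"
    using assms(2) by (intro image_eqI[of _ _ None]) auto
  ultimately obtain \<epsilon> where \<epsilon>: "\<epsilon> > 0" "ball 0 \<epsilon> \<subseteq> inversion_chart ` (Y \<inter> (UNIV - {Some 0}))"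
    using open_contains_ball by blast
  show ?thesis
  proof (rule that[of "inverse \<epsilon>"])
    fix y :: 'v assume y: "inverse \<epsilon> < norm y"
    then have "y \<noteq> 0"
      using \<epsilon>(1) by auto
    then have "invert y \<in> ball 0 \<epsilon>"
      using y \<epsilon>(1) by (simp add: norm_invert field_simps)
    then obtain q where q: "q \<in> Y" "q \<noteq> Some 0" "inversion_chart (Some y) = inversion_chart q"
      unfolding inversion_chart_Some using \<epsilon>(2) by blast
    moreover have "inj_on inversion_chart (UNIV - {Some (0::'v)})"
      using S.smooth_atlas S_charts(2) unfolding smooth_atlas_def by blast
    ultimately have "Some y = q"
      using \<open>y \<noteq> 0\<close> by (auto dest!: inj_onD simp del: inversion_chart_Some)
    then show "Some y \<in> Y"
      using q(1) by simp
  qed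
qed

lemma nbhd_infinity:
  assumes "openin (atlas_topology A) T" "None \<in> T"
  obtains R where "\<And>y. y \<in> M \<Longrightarrow> norm y > R \<Longrightarrow> Some y \<in> T"
proof -
  obtain Y where Y: "openin (atlas_topology S_atlas) Y" "T = Y \<inter> carrier_of A"
    using openin_A_eq[OF assms(1)] .
  then have "None \<in> Y"
    using assms(2) by blast
  from S_nbhd_infinity[OF Y(1) this] obtain R where "\<And>y. norm y > R \<Longrightarrow> Some y \<in> Y"
    by blast
  then show ?thesis
    using that[of R] Y(2) by (auto simp: M_def)
qed

text \<open>The surface is a continuous image of a compact space in the Hausdorff space S.\<close>

lemma closedin_carrier: "openin (atlas_topology S_atlas) (UNIV - carrier_of A)"
proof -
  have "compactin (atlas_topology A) (carrier_of A)"
    using compact_A by (simp add: compact_space_def topspace_atlas_topology[OF smooth_A])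
  moreover have "continuous_map (atlas_topology A) (atlas_topology S_atlas) id"
    using smooth_map_A by (simp add: smooth_map_def)
  ultimately have "compactin (atlas_topology S_atlas) (id ` carrier_of A)"
    by (rule image_compactin)
  then have "closedin (atlas_topology S_atlas) (carrier_of A)"
    using compactin_imp_closedin[OF S.Hausdorff] by simp
  then show ?thesis
    by (simp add: closedin_def S.topspace)
qed

lemma closed_M: "closed M"
proof -
  have "open (the ` (UNIV - carrier_of A - {None}))"
    by (rule S.open_image_chart[OF closedin_carrier])
  also have "the ` (UNIV - carrier_of A - {None}) = - M"
    by (force simp: M_def)
  finally show ?thesis
    by (simp add: open_closed)
qed

text \<open>A pairing \<open>herm (G x) b\<close> that is nondegenerate on the tangent line is a
  local coordinate on the surface. Parametrized by it, the surface has complex linear derivatives,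
  because each tangent plane is a complex line.\<close>

lemma holo_curve_M: "holo_curve M"
  unfolding holo_curve_def
proof (intro ballI)
  fix p assume "p \<in> M"
  then obtain U \<phi> where U: "(U, \<phi>) \<in> A" "Some p \<in> U"
    by (auto simp: M_def carrier_of_def)
  define G where "G = affine_rep U \<phi>"
  define V where "V = \<phi> ` {q \<in> U. q \<in> UNIV - {None}}"
  define x0 where "x0 = \<phi> (Some p)"
  let ?D = "\<lambda>x. frechet_derivative G (at x)"
  have V: "open V" "x0 \<in> V"
    using rep(1)[OF U(1) S_charts(1)] U(2) by (auto simp: V_def x0_def)
  have G: "smooth_on G V"
    using rep(2)[OF U(1) S_charts(1)] by (simp add: V_def G_def)
  have G_eq: "G (\<phi> q) = the q" if "q \<in> U" for q
    using rep(3)[OF U(1) S_charts(1) that] by (simp add: G_def)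
  have G_M: "G x \<in> M" if "x \<in> V" for x
    using that G_eq chart_in_carrier[OF U(1)] by (auto simp: V_def M_def)
  have injG: "inj_on G V"
    by (rule inj_onI) (auto simp: V_def G_eq)
  have derG: "(G has_derivative ?D x) (at x)" if "x \<in> V" for x
    using smooth_on_has_derivative[OF G that] .
  have tangent: "\<exists>e. e \<noteq> 0 \<and> range (?D x) = cline scaleC e" if "x \<in> V" for x
    using complex_tangent[OF U(1), of x] that unfolding V_def G_def by metis
  obtain e0 where e0: "e0 \<noteq> 0" "range (?D x0) = cline scaleC e0"
    using tangent[OF V(2)] by blast
  \<comment> \<open>Some frame coordinate of a nonzero tangent vector is nonzero; its pairing is
    then injective on the whole complex tangent line.\<close>
  obtain b where b: "herm e0 b \<noteq> 0"
  proof -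
    obtain E F where "unitary_frame E F"
      using exists_unitary_frame by blast
    then have "herm e0 E \<noteq> 0 \<or> herm e0 F \<noteq> 0"
      using e0(1) unitary_frame_eqI[of E F e0 0] by auto
    then show ?thesis
      using that by blast
  qed
  define u where "u x = c2v (herm (G x) b)" for x
  have u: "smooth_on u V"
    unfolding u_def using G V(1)
    by (intro smooth_on_bounded_linear[OF bounded_linear_c2v] smooth_on_bounded_linear[OF bounded_linear_herm])
  have "(u has_derivative (\<lambda>v. c2v (herm (?D x v) b))) (at x)" if "x \<in> V" for x
  proof -
    have "((\<lambda>x. herm (G x) b) has_derivative (\<lambda>v. herm (?D x v) b)) (at x)"
      by (rule bounded_linear.has_derivative[OF bounded_linear_herm derG[OF that]])
    from bounded_linear.has_derivative[OF bounded_linear_c2v this] show ?thesis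
      by (simp add: u_def[abs_def])
  qed
  from frechet_derivative_at[OF this]
  have Du: "frechet_derivative u (at x) = (\<lambda>v. c2v (herm (?D x v) b))" if "x \<in> V" for x
    using that by simp
  have "inj (frechet_derivative u (at x0))"
  proof (rule injI)
    fix v w assume "frechet_derivative u (at x0) v = frechet_derivative u (at x0) w"
    then have vw: "herm (?D x0 v) b = herm (?D x0 w) b"
      by (simp add: Du[OF V(2)] c2v_eq_iff)
    have "?D x0 v \<in> cline scaleC e0" "?D x0 w \<in> cline scaleC e0"
      unfolding e0(2)[symmetric] by blast+
    then obtain c d where cd: "?D x0 v = scaleC c e0" "?D x0 w = scaleC d e0"
      unfolding cline_def by blast
    then have "?D x0 v = ?D x0 w"
      using vw b by (simp add: herm_scale_left)
    moreover have "inj (?D x0)"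
      using rep(4)[OF U(1) S_charts(1) U(2)] by (simp add: G_def x0_def)
    ultimately show "v = w"
      by (auto dest: injD)
  qed
  then obtain r0 where r0: "r0 > 0" "ball x0 r0 \<subseteq> V" "inj_on u (ball x0 r0)"
    "\<And>x. x \<in> ball x0 r0 \<Longrightarrow> inj (frechet_derivative u (at x))"
    using smooth_on_locally_injective[OF V u] by metis
  let ?B = "ball x0 r0"
  define k where "k = inv_into ?B u"
  have uB: "smooth_on u ?B"
    using u r0(2) by (rule smooth_on_subset)
  have k: "open (u ` ?B)" "smooth_on k (u ` ?B)"
    using smooth_on_inv_into_plane[OF open_ball uB r0(3)] r0(4) by (auto simp: k_def)
  have kB: "k y \<in> ?B" "u (k y) = y" if "y \<in> u ` ?B" for y
    unfolding k_def using inv_into_into[OF that] f_inv_into_f[OF that] by blast+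
  have ku: "k (u x) = x" if "x \<in> ?B" for x
    using that r0(3) by (simp add: k_def)
  have "u x0 \<in> u ` ?B"
    using r0(1) by simp
  then obtain r where r: "r > 0" "ball (u x0) r \<subseteq> u ` ?B"
    using k(1) open_contains_ball by blast
  have y_in: "u x0 + c2v \<zeta> \<in> u ` ?B" if "\<zeta> \<in> ball 0 r" for \<zeta>
    using r(2) that by (auto simp: dist_norm norm_c2v)
  define h where "h \<zeta> = G (k (u x0 + c2v \<zeta>))" for \<zeta>
  have x_in: "k (u x0 + c2v \<zeta>) \<in> V" if "\<zeta> \<in> ball 0 r" for \<zeta>
    using kB(1)[OF y_in[OF that]] r0(2) by blast
  have herm_h: "herm (h \<zeta>) b = herm (G x0) b + \<zeta>" if "\<zeta> \<in> ball 0 r" for \<zeta>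
  proof -
    have "c2v (herm (h \<zeta>) b) = u x0 + c2v \<zeta>"
      using kB(2)[OF y_in[OF that]] by (simp add: u_def h_def)
    then have "c2v (herm (h \<zeta>) b) = c2v (herm (G x0) b + \<zeta>)"
      by (simp add: u_def linear_add[OF linear_c2v])
    then show ?thesis
      by (simp add: c2v_eq_iff)
  qed
  have h0: "h 0 = p"
    using ku[of x0] r0(1) G_eq[OF U(2)] by (simp add: h_def linear_0[OF linear_c2v] x0_def)
  have hM: "h ` ball 0 r \<subseteq> M"
    using x_in G_M by (auto simp: h_def)
  have hinj: "inj_on h (ball 0 r)"
    by (rule inj_onI) (metis add_left_cancel herm_h)
  let ?K = "\<lambda>\<zeta>. frechet_derivative k (at (u x0 + c2v \<zeta>))"
  have derh: "(h has_derivative (\<lambda>\<eta>. ?D (k (u x0 + c2v \<zeta>)) (?K \<zeta> (c2v \<eta>)))) (at \<zeta>)"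
    if "\<zeta> \<in> ball 0 r" for \<zeta>
  proof -
    have 1: "((\<lambda>\<zeta>. u x0 + c2v \<zeta>) has_derivative c2v) (at \<zeta>)"
      using bounded_linear_c2v by (auto intro!: derivative_eq_intros bounded_linear_imp_has_derivative)
    have 2: "(k has_derivative ?K \<zeta>) (at (u x0 + c2v \<zeta>))"
      using smooth_on_has_derivative[OF k(2) y_in[OF that]] .
    have 3: "((\<lambda>\<zeta>. k (u x0 + c2v \<zeta>)) has_derivative (\<lambda>\<eta>. ?K \<zeta> (c2v \<eta>))) (at \<zeta>)"
      by (rule has_derivative_compose[OF 1 2])
    show ?thesis
      unfolding h_def by (rule has_derivative_compose[OF 3 derG[OF x_in[OF that]]])
  qed
  have hcont: "continuous_on (ball 0 r) h"
    using derh has_derivative_continuous continuous_at_imp_continuous_on by blast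
  have hholo: "(\<lambda>\<zeta>. herm (h \<zeta>) b') holomorphic_on ball 0 r" for b'
  proof (rule holomorphic_onI)
    fix \<zeta> :: complex assume \<zeta>: "\<zeta> \<in> ball 0 r"
    let ?Dh = "\<lambda>\<eta>. ?D (k (u x0 + c2v \<zeta>)) (?K \<zeta> (c2v \<eta>))"
    obtain e where e: "e \<noteq> 0" "range (?D (k (u x0 + c2v \<zeta>))) = cline scaleC e"
      using tangent[OF x_in[OF \<zeta>]] by blast
    have "((\<lambda>\<zeta>. herm (h \<zeta>) b) has_derivative (\<lambda>\<eta>. herm (?Dh \<eta>) b)) (at \<zeta>)"
      by (rule bounded_linear.has_derivative[OF bounded_linear_herm derh[OF \<zeta>]])
    moreover have "((\<lambda>\<zeta>. herm (h \<zeta>) b) has_derivative (\<lambda>\<eta>. \<eta>)) (at \<zeta>)"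
      by (rule has_derivative_transform_within_open[of "\<lambda>\<zeta>. herm (G x0) b + \<zeta>" _ _ _ "ball 0 r"])
        (use \<zeta> herm_h in \<open>auto intro!: derivative_eq_intros\<close>)
    \<comment> \<open>This normalization fixes the multiple of \<open>e\<close> that
      \<open>?Dh \<eta>\<close> is. Every other pairing of the derivative is then \<eta> times the
      constant \<open>herm e b' / herm e b\<close>, which is the Cauchy-Riemann condition.\<close>
    ultimately have id: "herm (?Dh \<eta>) b = \<eta>" for \<eta>
      using has_derivative_unique by metis
    have \<tau>: "\<exists>\<tau>. ?Dh \<eta> = scaleC \<tau> e" for \<eta>
    proof -
      have "?Dh \<eta> \<in> cline scaleC e"
        unfolding e(2)[symmetric] by blast
      then show ?thesis
        unfolding cline_def by blast
    qed
    have "herm e b \<noteq> 0"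
      using id[of 1] \<tau>[of 1] herm_scale_left by force
    have lin: "herm (?Dh \<eta>) b' = herm e b' / herm e b * \<eta>" for \<eta>
    proof -
      obtain t where "?Dh \<eta> = scaleC t e"
        using \<tau> by blast
      then show ?thesis
        using id[of \<eta>] \<open>herm e b \<noteq> 0\<close> by (simp add: herm_scale_left field_simps)
    qed
    have "((\<lambda>\<zeta>. herm (h \<zeta>) b') has_derivative (\<lambda>\<eta>. herm (?Dh \<eta>) b')) (at \<zeta>)"
      by (rule bounded_linear.has_derivative[OF bounded_linear_herm derh[OF \<zeta>]])
    then have "((\<lambda>\<zeta>. herm (h \<zeta>) b') has_field_derivative herm e b' / herm e b) (at \<zeta>)"
      unfolding has_field_derivative_def lin .
    then show "(\<lambda>\<zeta>. herm (h \<zeta>) b') field_differentiable at \<zeta> within ball 0 r"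
      using field_differentiable_def field_differentiable_at_within by blast
  qed
  have hnbhd: "\<exists>\<delta>>0. M \<inter> ball p \<delta> \<subseteq> h ` ball 0 \<rho>" if \<rho>: "0 < \<rho> \<and> \<rho> \<le> r" for \<rho>
  proof -
    \<comment> \<open>The chart points with parameter in the disc of radius \<rho>. They form an
      open piece \<open>T\<close> of the surface, which by the embedding contains all points of
      \<open>M\<close> near \<open>p\<close>.\<close>
    define X where "X = ?B \<inter> u -` ball (u x0) \<rho>"
    define T where "T = {q \<in> U. q \<noteq> None \<and> \<phi> q \<in> X}"
    have "open X"
      unfolding X_def using smooth_on_continuous[OF uB] by (intro continuous_open_preimage) auto
    moreover have "\<phi> ` T = X"
      using r0(2) by (auto simp: T_def X_def V_def)
    moreover have "T \<subseteq> U"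
      by (auto simp: T_def)
    ultimately have "openin (atlas_topology A) T"
      using openin_chart[OF smooth_A U(1)] by simp
    moreover have "Some p \<in> T"
      using U(2) r0(1) \<rho> by (auto simp: T_def X_def x0_def)
    ultimately obtain \<delta> where \<delta>: "\<delta> > 0" "\<And>y. y \<in> M \<inter> ball p \<delta> \<Longrightarrow> Some y \<in> T"
      using nbhd_finite by blast
    have "y \<in> h ` ball 0 \<rho>" if y: "y \<in> M \<inter> ball p \<delta>" for y
    proof -
      have yT: "Some y \<in> U" "\<phi> (Some y) \<in> X"
        using \<delta>(2)[OF y] by (auto simp: T_def)
      obtain c where c: "u (\<phi> (Some y)) - u x0 = c2v c"
        using surj_c2v by blast
      have "norm (u (\<phi> (Some y)) - u x0) < \<rho>"
        using yT(2) by (simp add: X_def dist_norm norm_minus_commute)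
      then have "c \<in> ball 0 \<rho>"
        unfolding c norm_c2v by simp
      moreover have "u x0 + c2v c = u (\<phi> (Some y))"
        using c by (metis add.commute diff_add_cancel)
      then have "h c = y"
        using ku[of "\<phi> (Some y)"] yT G_eq[OF yT(1)] by (simp add: h_def X_def)
      ultimately show ?thesis
        by blast
    qed
    then show ?thesis
      using \<delta>(1) by blast
  qed
  show "\<exists>h r. holo_disc M p h r"
    unfolding holo_disc_def
    using r(1) h0 hM hinj hcont hholo hnbhd by blast
qed

end

section \<open>Complex dependence of tangent vectors under reflections\<close>

context hermitian_plane
begin

text \<open>The complex determinant of the frame coordinates of \<open>a\<close> and
  \<open>b\<close>. It is a continuous test for lying in one complex line, so it survives the
  passage to infinity.\<close>

definition omega :: "'v \<Rightarrow> 'v \<Rightarrow> 'v \<Rightarrow> 'v \<Rightarrow> complex" where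
  "omega e f a b = herm a e * herm b f - herm b e * herm a f"

lemma omega_cline: "a \<in> cline scaleC w \<Longrightarrow> b \<in> cline scaleC w \<Longrightarrow> omega e f a b = 0"
  by (auto simp: cline_def omega_def herm_scale_left)

lemma omega_scaleR: "omega e f (s *\<^sub>R a) (s *\<^sub>R b) = of_real (s * s) * omega e f a b"
  by (simp add: omega_def herm_scaleR_left algebra_simps)

text \<open>For a unit vector \<open>n\<close>, the reflection in the real hyperplane orthogonal to
  \<open>n\<close>; up to a positive scale it is the derivative of inversion at a point in direction
  \<open>n\<close>.\<close>

definition reflect :: "'v \<Rightarrow> 'v \<Rightarrow> 'v" where
  "reflect n v = v - (2 * (n \<bullet> v)) *\<^sub>R n"

lemma invert_derivative_reflect:
  fixes q :: 'v
  assumes "q \<noteq> 0"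
  shows "(invert has_derivative (\<lambda>v. (1 / (norm q)\<^sup>2) *\<^sub>R reflect (sgn q) v)) (at q)"
proof -
  have "(v - (2 * (q \<bullet> v) / (norm q)\<^sup>2) *\<^sub>R q) /\<^sub>R (norm q)\<^sup>2 = (1 / (norm q)\<^sup>2) *\<^sub>R reflect (sgn q) v" for v
    by (simp add: reflect_def sgn_div_norm power2_eq_square divide_inverse)
  then show ?thesis
    using has_derivative_invert[OF assms] by simp
qed

lemma tendsto_omega_reflect:
  assumes "(n \<longlongrightarrow> n0) F" "(a \<longlongrightarrow> a0) F" "(b \<longlongrightarrow> b0) F"
  shows "((\<lambda>t. omega e f (reflect (n t) (a t)) (reflect (n t) (b t))) \<longlongrightarrow>
    omega e f (reflect n0 a0) (reflect n0 b0)) F"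
  unfolding omega_def reflect_def
  by (intro tendsto_intros bounded_linear.tendsto[OF bounded_linear_herm] assms)

text \<open>The reflection negates \<open>e\<close> and changes \<open>b\<close> only along
  \<open>e\<close>, so the determinant still detects the component of \<open>b\<close> along
  \<open>f\<close>.\<close>

lemma omega_reflect_frame:
  assumes "unitary_frame e f"
  shows "omega e f (reflect e (r *\<^sub>R e)) (reflect e b) = - of_real r * herm b f"
proof -
  have ee: "herm e e = 1" "herm e f = 0"
    using assms by (auto simp: unitary_frame_def)
  then have "e \<bullet> e = 1"
    by (metis Re_herm one_complex.sel(1))
  then have r: "reflect e (r *\<^sub>R e) = (- r) *\<^sub>R e"
    by (simp add: reflect_def scaleR_left_diff_distrib[symmetric])
  have "herm (reflect e b) f = herm b f"
    by (simp add: reflect_def herm_diff_left herm_scaleR_left ee)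
  then show ?thesis
    unfolding omega_def r herm_scaleR_left ee by simp
qed

end

context closed_holo_surface
begin

text \<open>The tangent plane at infinity is a complex line: it is the limit of the tangent planes at
  nearby points, mapped by reflections that converge to the one in the direction of approach.\<close>

lemma behaviour_at_infinity:
  assumes "None \<in> carrier_of A"
  obtains e f N R B where "unitary_frame e f" "connected N" "N \<subseteq> M" "N \<noteq> {}"
    "\<And>y. y \<in> M \<Longrightarrow> norm y > R \<Longrightarrow> y \<in> N" "\<And>y. y \<in> M \<Longrightarrow> cmod (herm y f) \<le> B"
proof -
  obtain U \<phi> where U: "(U, \<phi>) \<in> A" "None \<in> U"
    using assms by (auto simp: carrier_of_def)
  define G where "G = local_rep (U, \<phi>) (UNIV - {Some 0}, inversion_chart) id"
  define G1 where "G1 = affine_rep U \<phi>"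
  define V where "V = \<phi> ` {q \<in> U. q \<in> UNIV - {Some 0}}"
  define x0 where "x0 = \<phi> None"
  let ?D = "\<lambda>x. frechet_derivative G (at x)"
  have V: "open V" "x0 \<in> V"
    using rep(1)[OF U(1) S_charts(2)] U(2) by (auto simp: V_def x0_def)
  have G: "smooth_on G V"
    using rep(2)[OF U(1) S_charts(2)] by (simp add: V_def G_def)
  have G_eq: "G (\<phi> q) = inversion_chart q" if "q \<in> U" for q
    using rep(3)[OF U(1) S_charts(2) that] by (simp add: G_def)
  have G0: "G x0 = 0"
    using G_eq[OF U(2)] by (simp add: x0_def)
  have derG: "(G has_derivative ?D x) (at x)" if "x \<in> V" for x
    using smooth_on_has_derivative[OF G that] .
  have off: "\<exists>y. Some y \<in> U \<and> x = \<phi> (Some y) \<and> y \<noteq> 0 \<and> G x = invert y \<and> G1 x = y"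
    if x: "x \<in> V - {x0}" for x
  proof -
    obtain q where q: "q \<in> U" "q \<noteq> Some 0" "x = \<phi> q"
      using x by (auto simp: V_def)
    then obtain y where "q = Some y"
      using x by (cases q) (auto simp: x0_def)
    then show ?thesis
      using q G_eq[OF q(1)] rep(3)[OF U(1) S_charts(1) q(1)]
      by (intro exI[of _ y]) (simp add: G1_def)
  qed
  have G_nz: "G x \<noteq> 0" and G1_eq: "G1 x = invert (G x)" and G1_M: "invert (G x) \<in> M"
    if "x \<in> V - {x0}" for x
    using off[OF that] chart_in_carrier[OF U(1)] by (auto simp: M_def)
  have inj_D0: "inj (?D x0)"
    using rep(4)[OF U(1) S_charts(2) U(2)] by (simp add: G_def x0_def)
  have linD: "linear (?D x0)"
    using derG[OF V(2)] has_derivative_linear by blast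
  define e0 where "e0 = ?D x0 (axis 1 1)"
  define b0 where "b0 = ?D x0 (axis 2 1)"
  have e0: "e0 \<noteq> 0"
  proof
    assume "e0 = 0"
    then have "?D x0 (axis 1 1) = ?D x0 0"
      by (simp add: e0_def linear_0[OF linD])
    then have "axis 1 1 = (0 :: real^2)"
      using inj_eq[OF inj_D0] by blast
    then show False
      by (simp add: axis_eq_0_iff)
  qed
  \<comment> \<open>The first frame vector is the direction in which the path along the first
    coordinate axis enters infinity; the other tangent vector \<open>b0\<close> is to be shown a
    complex multiple of it.\<close>
  define e where "e = sgn e0"
  have "norm e = 1"
    using e0 by (simp add: e_def norm_sgn)
  then obtain f where frame: "unitary_frame e f"
    using exists_unitary_frame_with by blast
  have e0_eq: "e0 = norm e0 *\<^sub>R e"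
    using e0 by (simp add: e_def sgn_div_norm)
  define \<omega> where "\<omega> x = omega e f (reflect (sgn (G x)) (?D x (axis 1 1)))
      (reflect (sgn (G x)) (?D x (axis 2 1)))" for x
  \<comment> \<open>The derivative of the affine representative is a scaled reflection after
    \<open>?D x\<close>. Its image is a complex line by hypothesis, and the scale does not affect
    the vanishing of \<open>omega\<close>.\<close>
  have omega0: "\<omega> x = 0"
    if x: "x \<in> V - {x0}" for x
  proof -
    let ?s = "1 / (norm (G x))\<^sup>2"
    have "((\<lambda>x. invert (G x)) has_derivative (\<lambda>v. ?s *\<^sub>R reflect (sgn (G x)) (?D x v))) (at x)"
      using has_derivative_compose[OF derG invert_derivative_reflect[OF G_nz[OF x]]] x by simp
    then have "(G1 has_derivative (\<lambda>v. ?s *\<^sub>R reflect (sgn (G x)) (?D x v))) (at x)"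
      by (rule has_derivative_transform_within_open[of _ _ _ _ "V - {x0}"])
        (use V(1) x G1_eq in auto)
    from frechet_derivative_at[OF this]
    have D1: "frechet_derivative G1 (at x) = (\<lambda>v. ?s *\<^sub>R reflect (sgn (G x)) (?D x v))"
      by simp
    have "x \<in> \<phi> ` {p \<in> U. p \<in> UNIV - {None}}"
      using off[OF x] by auto
    from complex_tangent[OF U(1) this, folded G1_def]
    obtain w where w: "range (frechet_derivative G1 (at x)) = cline scaleC w"
      by blast
    have "frechet_derivative G1 (at x) v \<in> cline scaleC w" for v
      unfolding w[symmetric] by blast
    then have "omega e f (frechet_derivative G1 (at x) (axis 1 1)) (frechet_derivative G1 (at x) (axis 2 1)) = 0"
      by (intro omega_cline)
    then show ?thesis
      unfolding D1 omega_scaleR \<omega>_def using G_nz[OF x] by simp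
  qed
  have herm_b0: "herm b0 f = 0"
  proof -
    \<comment> \<open>The approach is one-sided, because \<open>sgn\<close> ignores the factor 1/t
      only for positive t; this gives the unit normals a limit.\<close>
    let ?x = "\<lambda>t. x0 + t *\<^sub>R axis 1 1 :: real^2"
    have x_lim: "(?x \<longlongrightarrow> x0) (at_right 0)"
      by (auto intro!: tendsto_eq_intros)
    have "((\<lambda>t. G (?x t) /\<^sub>R t) \<longlongrightarrow> e0) (at_right 0)"
      unfolding e0_def using has_derivative_directional_limit[OF derG[OF V(2)] G0] .
    then have "((\<lambda>t. sgn (G (?x t) /\<^sub>R t)) \<longlongrightarrow> e) (at_right 0)"
      unfolding e_def using e0 by (rule tendsto_sgn)
    moreover have "eventually (\<lambda>t. sgn (G (?x t) /\<^sub>R t) = sgn (G (?x t))) (at_right (0::real))"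
      using eventually_at_right_less[of 0] by eventually_elim (simp add: sgn_div_norm)
    ultimately have n_lim: "((\<lambda>t. sgn (G (?x t))) \<longlongrightarrow> e) (at_right 0)"
      by (rule Lim_transform_eventually)
    have D_lim: "((\<lambda>t. ?D (?x t) v) \<longlongrightarrow> ?D x0 v) (at_right 0)" for v
    proof -
      have "continuous_on V (\<lambda>x. ?D x v)"
        using G by (intro smooth_on_continuous smooth_on_frechet_derivative)
      then have "isCont (\<lambda>x. ?D x v) x0"
        using V continuous_on_eq_continuous_at by blast
      then show ?thesis
        using x_lim by (rule isCont_tendsto_compose)
    qed
    have lim: "((\<lambda>t. \<omega> (?x t)) \<longlongrightarrow> omega e f (reflect e e0) (reflect e b0)) (at_right 0)"
      unfolding e0_def b0_def \<omega>_def by (intro tendsto_omega_reflect n_lim D_lim)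
    have "eventually (\<lambda>t. ?x t \<in> V) (at_right 0)"
      using x_lim V topological_tendstoD by blast
    then have "eventually (\<lambda>t. \<omega> (?x t) = 0) (at_right 0)"
      using eventually_at_right_less[of 0]
      by eventually_elim (rule omega0, simp add: axis_eq_0_iff)
    then have "((\<lambda>t. \<omega> (?x t)) \<longlongrightarrow> 0) (at_right (0::real))"
      by (rule tendsto_eventually)
    then have "omega e f (reflect e e0) (reflect e b0) = 0"
      using tendsto_unique[OF trivial_limit_at_right_real lim] by blast
    then show ?thesis
      using e0 omega_reflect_frame[OF frame, of "norm e0" b0] e0_eq by simp
  qed
  have herm_D: "herm (?D x0 v) f = 0" for v
  proof -
    have "herm e f = 0"
      using frame by (simp add: unitary_frame_def)
    then have "herm e0 f = 0"
      by (subst e0_eq) (simp add: herm_scaleR_left)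
    moreover have "?D x0 v = v$1 *\<^sub>R e0 + v$2 *\<^sub>R b0"
    proof -
      have "?D x0 v = ?D x0 (v$1 *\<^sub>R axis 1 1 + v$2 *\<^sub>R axis 2 1)"
        by (rule arg_cong[OF vec2_eq_axis])
      then show ?thesis
        by (simp add: e0_def b0_def linear_add[OF linD] linear_scale[OF linD])
    qed
    ultimately show ?thesis
      using herm_b0 by (simp add: herm_add_left herm_scaleR_left)
  qed
  \<comment> \<open>The coordinate w in the chart \<Phi>. It and its derivative vanish at
    \<open>x0\<close>, while \<open>G\<close> itself grows at least linearly there.\<close>
  define g where "g x = herm (G x) f" for x
  have g: "smooth_on g V"
    unfolding g_def using V(1) G by (intro smooth_on_bounded_linear[OF bounded_linear_herm])
  have "(g has_derivative (\<lambda>v. herm (?D x0 v) f)) (at x0)"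
    unfolding g_def by (rule bounded_linear.has_derivative[OF bounded_linear_herm derG[OF V(2)]])
  from frechet_derivative_at[OF this] have "frechet_derivative g (at x0) v = 0" for v
    using herm_D by metis
  moreover have "g x0 = 0"
    by (simp add: g_def G0)
  ultimately obtain C \<rho>1 where C: "\<rho>1 > 0" "\<And>x. x \<in> ball x0 \<rho>1 \<Longrightarrow> norm (g x) \<le> C * (norm (x - x0))\<^sup>2"
    using smooth_on_quadratic_bound[OF V g] by metis
  obtain c \<rho>2 where c: "c > 0" "\<rho>2 > 0" "\<And>x. x \<in> ball x0 \<rho>2 \<Longrightarrow> c * norm (x - x0) \<le> norm (G x)"
    using has_derivative_local_lower_bound[OF derG[OF V(2)] inj_D0] by (auto simp: G0)
  obtain \<rho>3 where \<rho>3: "\<rho>3 > 0" "ball x0 \<rho>3 \<subseteq> V"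
    using V open_contains_ball by blast
  define \<rho> where "\<rho> = min \<rho>1 (min \<rho>2 \<rho>3)"
  have \<rho>: "\<rho> > 0" "ball x0 \<rho> \<subseteq> ball x0 \<rho>1" "ball x0 \<rho> \<subseteq> ball x0 \<rho>2" "ball x0 \<rho> \<subseteq> V"
    using C(1) c(2) \<rho>3 by (auto simp: \<rho>_def)
  \<comment> \<open>The end of \<open>M\<close>: a punctured disc in a real plane is connected, and
    so is its image.\<close>
  define N where "N = (\<lambda>x. invert (G x)) ` (ball x0 \<rho> - {x0})"
  have "connected (ball x0 \<rho> - {x0})"
    by (rule connected_punctured_ball) simp
  moreover have "continuous_on (ball x0 \<rho> - {x0}) (\<lambda>x. invert (G x))"
  proof (rule continuous_on_compose2[OF smooth_on_continuous[OF smooth_on_invert]])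
    show "continuous_on (ball x0 \<rho> - {x0}) G"
      using smooth_on_continuous[OF G] by (rule continuous_on_subset) (use \<rho>(4) in auto)
    show "G ` (ball x0 \<rho> - {x0}) \<subseteq> UNIV - {0}"
      using G_nz \<rho>(4) by auto
  qed
  ultimately have N_conn: "connected N"
    unfolding N_def using connected_continuous_image by blast
  have N_M: "N \<subseteq> M"
    using G1_M \<rho>(4) by (auto simp: N_def)
  have "x0 + (\<rho> / 2) *\<^sub>R axis 1 1 \<in> ball x0 \<rho> - {x0}"
    using \<rho>(1) by (simp add: dist_norm axis_eq_0_iff norm_axis_1)
  then have N_ne: "N \<noteq> {}"
    unfolding N_def by blast
  define T where "T = {q \<in> U. q \<noteq> Some 0 \<and> \<phi> q \<in> ball x0 \<rho>}"
  have "\<phi> ` T = ball x0 \<rho>"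
    using \<rho>(4) by (auto simp: T_def V_def)
  then have "openin (atlas_topology A) T"
    using openin_chart[OF smooth_A U(1), of T] by (auto simp: T_def)
  moreover have "None \<in> T"
    using U(2) \<rho>(1) by (simp add: T_def x0_def)
  ultimately obtain R where R: "\<And>y. y \<in> M \<Longrightarrow> norm y > R \<Longrightarrow> Some y \<in> T"
    using nbhd_infinity by blast
  have N_far: "y \<in> N" if y: "y \<in> M" "norm y > R" for y
  proof -
    have T: "Some y \<in> U" "\<phi> (Some y) \<in> ball x0 \<rho>"
      using R[OF y] by (auto simp: T_def)
    moreover have "\<phi> (Some y) \<noteq> x0"
      using inj_chart[OF U(1)] T(1) U(2) by (auto simp: x0_def dest: inj_onD)
    moreover have "y = invert (G (\<phi> (Some y)))"
      using G_eq[OF T(1)] by simp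
    ultimately show ?thesis
      unfolding N_def by blast
  qed
  obtain K where K: "\<And>y. cmod (herm y f) \<le> norm y * K" "K > 0"
    using bounded_linear.pos_bounded[OF bounded_linear_herm] by blast
  \<comment> \<open>The first constant bounds w on the end, the second on the part of
    \<open>M\<close> inside the ball of radius \<open>R\<close>.\<close>
  define B where "B = max (C / c\<^sup>2) (R * K)"
  have bound: "cmod (herm y f) \<le> B" if y: "y \<in> M" for y
  proof (cases "norm y > R")
    case True
    then obtain x where x: "x \<in> ball x0 \<rho>" "x \<noteq> x0" "y = invert (G x)"
      using N_far[OF y True] unfolding N_def by blast
    have pos: "norm (x - x0) > 0"
      using x(2) by simp
    have nG: "c * norm (x - x0) \<le> norm (G x)" "norm (g x) \<le> C * (norm (x - x0))\<^sup>2"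
      using c(3) C(2) x(1) \<rho> by blast+
    \<comment> \<open>Inverting back divides w by |G|^2; the quadratic bound on \<open>g\<close> and
      the linear lower bound on \<open>G\<close> cancel to a constant.\<close>
    have "cmod (herm y f) = norm (g x) / (norm (G x))\<^sup>2"
      by (simp add: x(3) invert_def herm_scaleR_left norm_mult g_def norm_inverse norm_power divide_inverse mult.commute)
    also have "\<dots> \<le> (C * (norm (x - x0))\<^sup>2) / (c * norm (x - x0))\<^sup>2"
    proof (rule frac_le)
      show "0 \<le> C * (norm (x - x0))\<^sup>2"
        using nG(2) norm_ge_zero order_trans by blast
      show "(c * norm (x - x0))\<^sup>2 \<le> (norm (G x))\<^sup>2"
        using nG(1) c(1) pos by (intro power_mono) auto
    qed (use nG(2) c(1) pos in auto)
    also have "\<dots> = C / c\<^sup>2"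
      using pos by (simp add: power_mult_distrib)
    finally show ?thesis
      by (simp add: B_def)
  next
    case False
    then have "norm y * K \<le> R * K"
      using K(2) by (intro mult_right_mono) auto
    then show ?thesis
      using K(1)[of y] by (simp add: B_def)
  qed
  show ?thesis
    by (rule that[OF frame N_conn N_M N_ne N_far bound])
qed

theorem carrier_is_line:
  obtains e f w where "unitary_frame e f" "carrier_of A = insert None (Some ` {y. herm y f = w})"
proof (cases "None \<in> carrier_of A")
  case True
  obtain e f N R B where *: "unitary_frame e f" "connected N" "N \<subseteq> M" "N \<noteq> {}"
    "\<And>y. y \<in> M \<Longrightarrow> norm y > R \<Longrightarrow> y \<in> N" "\<And>y. y \<in> M \<Longrightarrow> cmod (herm y f) \<le> B"
    using behaviour_at_infinity[OF True] by metis
  then have "M \<noteq> {}"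
    by blast
  then obtain w where "M = {y. herm y f = w}"
    using bounded_holo_curve_is_line[OF *(1) holo_curve_M closed_M _ *(6) *(2,3) *(5)] by blast
  moreover have "carrier_of A = insert None (Some ` M)"
  proof (rule set_eqI)
    show "q \<in> carrier_of A \<longleftrightarrow> q \<in> insert None (Some ` M)" for q
      using True by (cases q) (auto simp: M_def)
  qed
  ultimately show ?thesis
    using that[OF *(1), of w] by simp
next
  case False
  obtain e f where frame: "unitary_frame e f"
    using exists_unitary_frame by blast
  obtain R where R: "\<And>y. norm y > R \<Longrightarrow> Some y \<in> UNIV - carrier_of A"
    using S_nbhd_infinity[OF closedin_carrier] False by blast
  then have "norm y \<le> R" if "y \<in> M" for y
    using that R[of y] by (force simp: M_def)
  then have "bounded M"
    unfolding bounded_iff by blast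
  then have "compact M"
    using closed_M by (simp add: compact_eq_bounded_closed)
  then have "M = {}"
    by (intro no_compact_clopen_subset_holo_curve[OF frame holo_curve_M]) (auto intro: exI[of _ 1])
  moreover obtain q where "q \<in> carrier_of A"
    using nonempty_A by blast
  then have "M \<noteq> {}"
    using False by (cases q) (auto simp: M_def)
  ultimately show ?thesis
    by blast
qed

end

section \<open>Complex lines as embedded spheres\<close>

lemma continuous_imp_closed_map_Hausdorff:
  assumes "compact_space X" "Hausdorff_space Y" "continuous_map X Y f"
  shows "closed_map X Y f"
  unfolding closed_map_def
  using assms by (meson closedin_compact_space compactin_imp_closedin image_compactin)

text \<open>A chart onto the whole plane whose inverse, composed with one chart of \<open>S\<close>, is a smooth
  map with a smooth left inverse, is an immersion in both charts of \<open>S\<close>.\<close>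

lemma immersion_in_S_charts:
  fixes \<phi> :: "'v::euclidean_space option \<Rightarrow> real^2" and \<sigma> \<sigma>' :: "'v option \<Rightarrow> 'v"
    and Z Z' Y :: "'v option set"
  assumes img: "\<phi> ` U = UNIV" and inj: "inj_on \<phi> U"
    and K: "smooth_on K UNIV" and \<Omega>: "open \<Omega>" "smooth_on H \<Omega>"
    and left_inv: "\<And>x. K x \<in> \<Omega>" "\<And>x. H (K x) = x"
    and c: "(Z, \<sigma>, Z', \<sigma>') = (UNIV - {None}, the, UNIV - {Some 0}, inversion_chart) \<or>
      (Z, \<sigma>, Z', \<sigma>') = (UNIV - {Some 0}, inversion_chart, UNIV - {None}, the)"
    and U: "U \<subseteq> Z" "\<And>p. p \<in> U \<Longrightarrow> \<sigma> p = K (\<phi> p)"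
    and Y: "(Y, \<tau>) \<in> S_atlas"
  shows "open (\<phi> ` {p \<in> U. p \<in> Y}) \<and>
    smooth_on (local_rep (U, \<phi>) (Y, \<tau>) id) (\<phi> ` {p \<in> U. p \<in> Y}) \<and>
    (\<forall>p\<in>U. p \<in> Y \<longrightarrow> inj (frechet_derivative (local_rep (U, \<phi>) (Y, \<tau>) id) (at (\<phi> p))))"
proof -
  \<comment> \<open>The two charts of S are inversions of each other, and the point missing from the
    second domain is the one where the first coordinate vanishes.\<close>
  have off: "p \<in> Z' \<longleftrightarrow> K (\<phi> p) \<noteq> 0" "p \<in> Z' \<Longrightarrow> \<sigma>' p = invert (K (\<phi> p))" if "p \<in> U" for p
  proof -
    have p: "p \<in> Z" "\<sigma> p = K (\<phi> p)"
      using that U by auto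
    have "p \<in> Z' \<longleftrightarrow> \<sigma> p \<noteq> 0"
      using c p(1) by (cases p) auto
    moreover have "p \<in> Z' \<Longrightarrow> \<sigma>' p = invert (\<sigma> p)"
      using c p(1) by (cases p) auto
    ultimately show "p \<in> Z' \<longleftrightarrow> K (\<phi> p) \<noteq> 0" "p \<in> Z' \<Longrightarrow> \<sigma>' p = invert (K (\<phi> p))"
      by (simp_all add: p(2))
  qed
  have derK: "(K has_derivative frechet_derivative K (at x)) (at x)" for x
    using smooth_on_has_derivative[OF K] by blast
  have derH: "(H has_derivative frechet_derivative H (at (K x))) (at (K x))" for x
    using smooth_on_has_derivative[OF \<Omega>(2) left_inv(1)] .
  have ex: "\<exists>p\<in>U. x = \<phi> p" for x
    using img by blast
  have "(Y, \<tau>) = (Z, \<sigma>) \<or> (Y, \<tau>) = (Z', \<sigma>')"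
    using Y c by (auto simp: S_atlas_def)
  then show ?thesis
  proof
    assume Y: "(Y, \<tau>) = (Z, \<sigma>)"
    have "{p \<in> U. p \<in> Y} = U"
      using Y U(1) by auto
    then have eq: "\<phi> ` {p \<in> U. p \<in> Y} = UNIV"
      using img by simp
    have rep: "local_rep (U, \<phi>) (Y, \<tau>) id = K"
    proof
      fix x
      obtain p where "p \<in> U" "x = \<phi> p"
        using ex by blast
      then show "local_rep (U, \<phi>) (Y, \<tau>) id x = K x"
        using inj Y U(2) by (simp add: local_rep_def)
    qed
    have "inj (frechet_derivative K (at x))" for x
      by (rule inj_frechet_derivative_left_inverse[OF derK derH open_UNIV UNIV_I left_inv(2)])
    then show ?thesis
      unfolding eq rep using K by simp
  next
    assume Y: "(Y, \<tau>) = (Z', \<sigma>')"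
    define O' where "O' = {x. K x \<noteq> 0}"
    have eq: "\<phi> ` {p \<in> U. p \<in> Y} = O'"
    proof (intro equalityI subsetI)
      fix x assume "x \<in> O'"
      moreover obtain p where "p \<in> U" "x = \<phi> p"
        using ex by blast
      ultimately show "x \<in> \<phi> ` {p \<in> U. p \<in> Y}"
        using off(1) Y by (auto simp: O'_def)
    qed (use off(1) Y in \<open>auto simp: O'_def\<close>)
    have "open (UNIV \<inter> K -` (- {0}))"
      using smooth_on_continuous[OF K] by (intro continuous_open_preimage) auto
    then have openO: "open O'"
      by (simp add: O'_def vimage_def Compl_eq)
    have rep: "local_rep (U, \<phi>) (Y, \<tau>) id x = invert (K x)" if "x \<in> O'" for x
    proof -
      obtain p where "p \<in> U" "x = \<phi> p"
        using ex by blast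
      then show ?thesis
        using inj Y off that by (simp add: local_rep_def O'_def)
    qed
    have "smooth_on (\<lambda>x. invert (K x)) O'"
      by (rule smooth_on_compose[OF openO _ _ smooth_on_subset[OF K] smooth_on_invert])
        (auto simp: O'_def)
    then have smooth: "smooth_on (local_rep (U, \<phi>) (Y, \<tau>) id) O'"
      using smooth_on_cong[OF openO, of "local_rep (U, \<phi>) (Y, \<tau>) id" "\<lambda>x. invert (K x)"] rep
      by simp
    have "inj (frechet_derivative (local_rep (U, \<phi>) (Y, \<tau>) id) (at x))" if x: "x \<in> O'" for x
    \<comment> \<open>In the other chart the parametrization is \<open>K\<close> followed by
      inversion, so inversion followed by \<open>H\<close> is a left inverse.\<close>
    proof (rule inj_frechet_derivative_left_inverse[OF smooth_on_has_derivative[OF smooth x] _ openO x])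
      have nz: "invert (K x) \<noteq> 0"
        using x by (simp add: O'_def)
      have "(invert has_derivative frechet_derivative invert (at (invert (K x)))) (at (invert (K x)))"
        using smooth_on_has_derivative[OF smooth_on_invert] nz by blast
      moreover have "(H has_derivative frechet_derivative H (at (K x))) (at (invert (invert (K x))))"
        using derH by simp
      ultimately show "((\<lambda>y. H (invert y)) has_derivative (\<lambda>v. frechet_derivative H (at (K x))
          (frechet_derivative invert (at (invert (K x))) v))) (at (local_rep (U, \<phi>) (Y, \<tau>) id x))"
        unfolding rep[OF x] by (rule has_derivative_compose)
      show "H (invert (local_rep (U, \<phi>) (Y, \<tau>) id y)) = y" if "y \<in> O'" for y
        using rep[OF that] left_inv(2) by simp
    qed
    then show ?thesis
      using openO smooth eq by auto
  qed
qed

section \<open>An affine complex line completed by infinity\<close>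

locale complex_line = hermitian_plane scaleC herm
  for scaleC :: "complex \<Rightarrow> 'v::euclidean_space \<Rightarrow> 'v" and herm :: "'v \<Rightarrow> 'v \<Rightarrow> complex" +
  fixes e f :: 'v and w :: complex
  assumes frame: "unitary_frame e f"
begin

text \<open>The point of the affine line nearest to the origin; it has z-coordinate 0.\<close>

definition "a = scaleC w f"
definition "X = insert None (Some ` {y. herm y f = w})"
definition "K1 x = a + scaleC (v2c x) e"
text \<open>The inversion of \<open>K1 (invert x)\<close> for nonzero \<open>x\<close>: since
  |K1(invert x)|^2 is 1/|x|^2 + |w|^2, clearing denominators gives this formula, which extends
  smoothly to \<open>x = 0\<close>.\<close>

definition "K2 x = inverse (1 + (cmod w)\<^sup>2 * (norm x)\<^sup>2) *\<^sub>R ((norm x)\<^sup>2 *\<^sub>R a + scaleC (v2c x) e)"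
definition "H1 y = c2v (herm y e)"
text \<open>The left inverse of \<open>K2\<close>: at \<open>y = K2 x\<close> the bracket equals the
  reciprocal of the denominator in \<open>K2\<close>. The bracket is positive on the open set
  \<open>\<Omega>2\<close>.\<close>

definition "H2 y = inverse (1 - (cmod w)\<^sup>2 * (norm y)\<^sup>2) *\<^sub>R c2v (herm y e)"
definition "\<Omega>2 = {y :: 'v. (cmod w)\<^sup>2 * (norm y)\<^sup>2 < 1}"
definition "\<phi>1 q = c2v (herm (the q) e)"
text \<open>In complex terms the coordinate 1/z, which takes the value 0 at infinity.\<close>

definition "\<phi>2 q = (if q = None then 0 else cnj_vec (invert (\<phi>1 q)))"

lemma frame_simps: "herm e e = 1" "herm f f = 1" "herm e f = 0" "herm f e = 0"
  "v = scaleC (herm v e) e + scaleC (herm v f) f"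
  using frame herm_cnj[of f e] by (auto simp: unitary_frame_def)

lemma norm_frame_power2: "(norm (scaleC s e + scaleC t f))\<^sup>2 = (cmod s)\<^sup>2 + (cmod t)\<^sup>2"
proof -
  have "herm (scaleC s e + scaleC t f) (scaleC s e + scaleC t f) = of_real ((cmod s)\<^sup>2 + (cmod t)\<^sup>2)"
    unfolding of_real_add complex_norm_square
    by (simp add: herm_add_left herm_add_right herm_scale_left herm_scale_right frame_simps(1-4)
        mult.commute)
  then show ?thesis
    unfolding herm_self using of_real_eq_iff by blast
qed

lemma linear_scaleC_e: "linear (\<lambda>c. scaleC c e)"
  by (simp add: linear_iff scale_left_distrib scaleR_conv_of_real)
    (metis scaleC_of_real scale_scale)

lemma bounded_linear_scaleC_e: "bounded_linear (\<lambda>c. scaleC c e)"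
  using linear_scaleC_e by (simp add: linear_conv_bounded_linear)

lemma smooth_v2c_e: "smooth_on (\<lambda>x. scaleC (v2c x) e) UNIV"
  by (intro smooth_on_bounded_linear[OF bounded_linear_scaleC_e]
      smooth_on_bounded_linear[OF bounded_linear_v2c] smooth_on_id open_UNIV)

lemma smooth_K1: "smooth_on K1 UNIV"
  unfolding K1_def by (intro smooth_on_add smooth_on_const smooth_v2c_e open_UNIV)

lemma pos_denom: "1 + (cmod w)\<^sup>2 * (norm x)\<^sup>2 > 0"
  by (simp add: add_pos_nonneg)

lemma smooth_K2: "smooth_on K2 UNIV"
  unfolding K2_def
  by (intro smooth_on_scaleR smooth_on_inverse smooth_on_add smooth_on_mult smooth_on_const
      smooth_on_norm_power2 smooth_on_id smooth_v2c_e open_UNIV)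
    (rule less_imp_neq[THEN not_sym], rule pos_denom)

lemma smooth_H1: "smooth_on H1 UNIV"
  unfolding H1_def by (intro smooth_on_bounded_linear[OF bounded_linear_c2v]
      smooth_on_bounded_linear[OF bounded_linear_herm] smooth_on_id open_UNIV)

lemma open_\<Omega>2: "open \<Omega>2"
  unfolding \<Omega>2_def by (intro open_Collect_less continuous_intros)

lemma smooth_H2: "smooth_on H2 \<Omega>2"
  unfolding H2_def
  by (intro smooth_on_scaleR smooth_on_inverse smooth_on_diff smooth_on_mult smooth_on_const
      smooth_on_norm_power2 smooth_on_id smooth_on_bounded_linear[OF bounded_linear_c2v]
      smooth_on_bounded_linear[OF bounded_linear_herm] open_\<Omega>2) (simp add: \<Omega>2_def)

lemma herm_a: "herm a e = 0" "herm a f = w"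
  by (simp_all add: a_def herm_scale_left frame_simps(1-4))

lemma H1_K1: "H1 (K1 x) = x"
  by (simp add: H1_def K1_def herm_add_left herm_scale_left herm_a frame_simps(1-4))

lemma herm_K1: "herm (K1 x) f = w"
  by (simp add: K1_def herm_add_left herm_scale_left herm_a frame_simps(1-4))

lemma K1_H1: "herm y f = w \<Longrightarrow> K1 (H1 y) = y"
  using frame_simps(5)[of y] by (simp add: K1_def H1_def a_def add.commute)

lemma norm_K1_power2: "(norm (K1 x))\<^sup>2 = (norm x)\<^sup>2 + (cmod w)\<^sup>2"
  using norm_frame_power2[of "v2c x" w] by (simp add: K1_def a_def add.commute norm_v2c)

lemma norm_K2_power2: "(norm (K2 x))\<^sup>2 = (norm x)\<^sup>2 / (1 + (cmod w)\<^sup>2 * (norm x)\<^sup>2)"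
proof -
  let ?d = "1 + (cmod w)\<^sup>2 * (norm x)\<^sup>2"
  have "(norm x)\<^sup>2 *\<^sub>R a = scaleC (of_real ((norm x)\<^sup>2) * w) f"
    unfolding a_def scaleC_of_real[symmetric] by simp
  then have "(norm ((norm x)\<^sup>2 *\<^sub>R a + scaleC (v2c x) e))\<^sup>2 = (norm x)\<^sup>2 * ?d"
    using norm_frame_power2[of "v2c x" "of_real ((norm x)\<^sup>2) * w"]
    by (simp add: add.commute norm_v2c norm_mult norm_power power_mult_distrib algebra_simps power2_eq_square)
  then have "(norm (K2 x))\<^sup>2 = (inverse ?d)\<^sup>2 * ((norm x)\<^sup>2 * ?d)"
    by (simp add: K2_def power_mult_distrib del: power_inverse)
  then show ?thesis
    using pos_denom[of x] by (simp add: power2_eq_square divide_inverse)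
qed

lemma K2_in_\<Omega>2: "K2 x \<in> \<Omega>2"
  using pos_denom[of x] by (simp add: \<Omega>2_def norm_K2_power2 divide_less_eq)

lemma H2_K2: "H2 (K2 x) = x"
proof -
  let ?d = "1 + (cmod w)\<^sup>2 * (norm x)\<^sup>2"
  have "1 - (cmod w)\<^sup>2 * (norm (K2 x))\<^sup>2 = inverse ?d"
    using pos_denom[of x] by (simp add: norm_K2_power2 field_simps)
  moreover have "c2v (herm (K2 x) e) = inverse ?d *\<^sub>R x"
    by (simp add: K2_def herm_add_left herm_scale_left herm_scaleR_left herm_a frame_simps(1-4)
        scaleR_conv_of_real[symmetric] linear_scale[OF linear_c2v] del: of_real_inverse of_real_add
        of_real_mult of_real_power of_real_1)
  ultimately show ?thesis
    using pos_denom[of x] by (simp add: H2_def)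
qed

lemma K2_invert: 
  assumes "x \<noteq> 0"
  shows "K2 (invert x) = invert (K1 x)"
proof -
  have n: "(norm (invert x))\<^sup>2 = inverse ((norm x)\<^sup>2)"
    by (simp add: norm_invert power_inverse)
  have "scaleC (v2c (invert x)) e = inverse ((norm x)\<^sup>2) *\<^sub>R scaleC (v2c x) e"
    by (simp add: invert_def linear_scale[OF linear_v2c] linear_scale[OF linear_scaleC_e])
  then have "K2 (invert x) = (inverse (1 + (cmod w)\<^sup>2 * inverse ((norm x)\<^sup>2)) * inverse ((norm x)\<^sup>2)) *\<^sub>R K1 x"
    by (simp add: K2_def n K1_def scaleR_right_distrib)
  also have "inverse (1 + (cmod w)\<^sup>2 * inverse ((norm x)\<^sup>2)) * inverse ((norm x)\<^sup>2) = inverse ((norm (K1 x))\<^sup>2)"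
    using assms by (simp add: norm_K1_power2 inverse_mult_distrib[symmetric] distrib_right del: inverse_mult_distrib)
  finally show ?thesis
    by (simp add: invert_def)
qed

lemma a_in_X: "Some a \<in> X"
  by (simp add: X_def herm_a)

text \<open>If the line passes through the origin then \<open>w = 0\<close> and
  \<open>a = 0\<close>. Hence removing \<open>Some a\<close> from the line also avoids
  \<open>Some 0\<close>, where \<Phi> is not defined.\<close>

lemma zero_notin: "p \<in> X \<Longrightarrow> p \<noteq> Some a \<Longrightarrow> p \<noteq> Some 0"
  by (auto simp: X_def a_def)

lemma the_eq_K1: "p \<in> X - {None} \<Longrightarrow> the p = K1 (\<phi>1 p)"
  using K1_H1 by (auto simp: X_def \<phi>1_def H1_def)

lemma inversion_atlas_X: "inversion_atlas X None (Some a) \<phi>1 \<phi>2 cnj_vec"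
proof
  show "bij_betw \<phi>1 (X - {None}) UNIV"
  proof (rule bij_betwI[where g = "\<lambda>x. Some (K1 x)"])
    show "Some (K1 (\<phi>1 p)) = p" if "p \<in> X - {None}" for p
      using the_eq_K1[OF that] that by (cases p) auto
    show "\<phi>1 (Some (K1 x)) = x" for x
      using H1_K1 by (simp add: \<phi>1_def H1_def)
  qed (auto simp: X_def herm_K1)
  show "None \<in> X" "Some a \<in> X" "None \<noteq> Some a"
    using a_in_X by (auto simp: X_def)
  show "\<phi>1 (Some a) = 0"
    by (simp add: \<phi>1_def herm_a linear_0[OF linear_c2v])
qed (auto simp: \<phi>2_def norm_cnj_vec linear_add[OF linear_cnj_vec] linear_scale[OF linear_cnj_vec])

sublocale X: inversion_atlas X None "Some a" \<phi>1 \<phi>2 cnj_vec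
  by (rule inversion_atlas_X)

sublocale X': inversion_atlas X "Some a" None \<phi>2 \<phi>1 cnj_vec
  by (rule X.swap)

lemma inversion_chart_eq_K2:
  assumes "p \<in> X - {Some a}"
  shows "inversion_chart p = K2 (cnj_vec (\<phi>2 p))"
proof (cases p)
  case None
  then show ?thesis
    by (simp add: \<phi>2_def K2_def linear_0[OF linear_cnj_vec] linear_0[OF linear_v2c])
next
  case (Some y)
  then have "\<phi>1 p \<noteq> 0"
    using X.\<phi>_nonzero[of p] assms by auto
  then have "K2 (invert (\<phi>1 p)) = invert (K1 (\<phi>1 p))"
    by (rule K2_invert)
  moreover have "K1 (\<phi>1 p) = y"
    using the_eq_K1[of p] assms Some by auto
  ultimately show ?thesis
    by (simp add: Some \<phi>2_def)
qed

lemma smooth_cnj_vec: "open T \<Longrightarrow> smooth_on cnj_vec T"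
  by (rule smooth_on_linear[OF linear_cnj_vec])

lemma charts_immersion:
  assumes "(U, \<phi>) \<in> X.A" "(Y, \<tau>) \<in> S_atlas"
  shows "open (\<phi> ` {p \<in> U. p \<in> Y}) \<and>
    smooth_on (local_rep (U, \<phi>) (Y, \<tau>) id) (\<phi> ` {p \<in> U. p \<in> Y}) \<and>
    (\<forall>p\<in>U. p \<in> Y \<longrightarrow> inj (frechet_derivative (local_rep (U, \<phi>) (Y, \<tau>) id) (at (\<phi> p))))"
proof -
  have K: "smooth_on (\<lambda>x. K2 (cnj_vec x)) UNIV"
    by (rule smooth_on_compose[OF open_UNIV open_UNIV _ smooth_cnj_vec smooth_K2]) auto
  have H: "smooth_on (\<lambda>y. cnj_vec (H2 y)) \<Omega>2"
    by (rule smooth_on_compose[OF open_\<Omega>2 open_UNIV _ smooth_H2 smooth_cnj_vec]) auto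
  show ?thesis
    using assms(1) unfolding X.A_def insert_iff empty_iff
  proof (elim disjE FalseE)
    assume "(U, \<phi>) = (X - {None}, \<phi>1)"
    then have U: "U = X - {None}" "\<phi> = \<phi>1" by auto
    have "U \<subseteq> UNIV - {None}" "\<And>p. p \<in> U \<Longrightarrow> the p = K1 (\<phi> p)"
      using the_eq_K1 by (auto simp: U)
    note * = immersion_in_S_charts[OF _ _ smooth_K1 open_UNIV smooth_H1 UNIV_I H1_K1
        disjI1[OF refl] this assms(2)]
    show ?thesis
      using * X.image_\<phi> X.inj_\<phi> unfolding U by blast
  next
    assume "(U, \<phi>) = (X - {Some a}, \<phi>2)"
    then have U: "U = X - {Some a}" "\<phi> = \<phi>2" by auto
    have "U \<subseteq> UNIV - {Some 0}" "\<And>p. p \<in> U \<Longrightarrow> inversion_chart p = K2 (cnj_vec (\<phi> p))"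
      using inversion_chart_eq_K2 zero_notin by (auto simp: U)
    note * = immersion_in_S_charts[OF _ _ K open_\<Omega>2 H K2_in_\<Omega>2 _ disjI2[OF refl] this assms(2)]
    have "cnj_vec (H2 (K2 (cnj_vec x))) = x" for x
      by (simp add: H2_K2)
    then show ?thesis
      using * X'.image_\<phi> X'.inj_\<phi> unfolding U by blast
  qed
qed

lemma immersion_X: "immersion X.A S_atlas id"
  unfolding immersion_def
proof
  show "smooth_map X.A S_atlas id"
    by (rule smooth_mapI[OF X.smooth_atlas S.smooth_atlas])
      (use charts_immersion S.carrier in auto)
qed (use charts_immersion in auto)

text \<open>An injective continuous map from a compact space to a Hausdorff space is closed, so the
  immersion is automatically an embedding.\<close>

lemma embedded_X: "embedded_submanifold X.A S_atlas"
  unfolding embedded_submanifold_def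
proof (intro conjI)
  show "carrier_of X.A \<subseteq> carrier_of S_atlas"
    by (simp add: S.carrier)
  show "immersion X.A S_atlas id"
    by (rule immersion_X)
  have "continuous_map (atlas_topology X.A) (atlas_topology S_atlas) id"
    using immersion_X by (simp add: immersion_def smooth_map_def)
  then show "embedding_map (atlas_topology X.A) (atlas_topology S_atlas) id"
    using continuous_imp_closed_map_Hausdorff[OF X.compact S.Hausdorff]
    by (intro injective_closed_imp_embedding_map) auto
qed

text \<open>Transitions are the identity or z -> 1/z; the latter has derivative multiplication by
  -1/z^2, of positive real determinant.\<close>

lemma transition_derivative_X:
  assumes "(U, \<phi>) \<in> X.A" "(W, \<psi>) \<in> X.A" "p \<in> U \<inter> W"
  shows "det (matrix (frechet_derivative (transition (U, \<phi>) (W, \<psi>)) (at (\<phi> p)))) > 0"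
proof -
  have self: "det (matrix (frechet_derivative (\<lambda>y :: real^2. y) (at x))) > 0" for x
    by (simp add: frechet_derivative_ident matrix_id[unfolded id_def])
  have glue: "det (matrix (frechet_derivative t (at x))) > 0"
    if x: "x \<noteq> 0" and t: "\<And>y. y \<noteq> 0 \<Longrightarrow> t y = cnj_vec (invert y)" for t and x :: "real^2"
  proof -
    have "(t has_derivative (\<lambda>v. c2v (- inverse ((v2c x)\<^sup>2) * v2c v))) (at x)"
      by (rule has_derivative_transform_within_open[OF cnj_vec_invert_has_derivative[OF x], of "UNIV - {0}"])
        (use x t in auto)
    from frechet_derivative_at[OF this, symmetric] show ?thesis
      using det_c2v_mult_pos[of "- inverse ((v2c x)\<^sup>2)"] x by (simp add: v2c_eq_0_iff)
  qed
  have trivial: "det (matrix (frechet_derivative t (at x))) > 0" if "\<And>y. t y = y" for t and x :: "real^2"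
  proof -
    have "t = (\<lambda>y. y)"
      using that by blast
    then show ?thesis
      using self by simp
  qed
  have c: "(U, \<phi>) = (X - {None}, \<phi>1) \<or> (U, \<phi>) = (X - {Some a}, \<phi>2)"
    "(W, \<psi>) = (X - {None}, \<phi>1) \<or> (W, \<psi>) = (X - {Some a}, \<phi>2)"
    using assms(1,2) by (simp_all add: X.A_def)
  then consider "(U, \<phi>) = (X - {None}, \<phi>1)" "(W, \<psi>) = (X - {None}, \<phi>1)"
    | "(U, \<phi>) = (X - {Some a}, \<phi>2)" "(W, \<psi>) = (X - {Some a}, \<phi>2)"
    | "(U, \<phi>) = (X - {None}, \<phi>1)" "(W, \<psi>) = (X - {Some a}, \<phi>2)"
    | "(U, \<phi>) = (X - {Some a}, \<phi>2)" "(W, \<psi>) = (X - {None}, \<phi>1)"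
    by blast
  then show ?thesis
  proof cases
    case 1
    then show ?thesis
      using trivial[OF X.transition_self] by simp
  next
    case 2
    then show ?thesis
      using trivial[OF X'.transition_self] by simp
  next
    case 3
    then have "p \<in> X - {None, Some a}"
      using assms(3) by blast
    then show ?thesis
      using 3 glue[OF X.\<phi>_nonzero X.transition_glue] by simp
  next
    case 4
    then have "p \<in> X - {Some a, None}"
      using assms(3) by blast
    then show ?thesis
      using 4 glue[OF X'.\<phi>_nonzero X'.transition_glue] by simp
  qed
qed

lemma closed_oriented_X: "closed_oriented_surface X.A"
  unfolding closed_oriented_surface_def oriented_surface_def
  using X.manifold X.compact transition_derivative_X by blast

text \<open>The second axis vector represents the imaginary unit, so the images of the axes are c e
  and i c e, an oriented basis of the required form.\<close>

lemma complex_multiple_tangent: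
  assumes "c \<noteq> 0" and D: "D = (\<lambda>v. scaleC (c * v2c v) e)"
  shows "\<exists>e. e \<noteq> 0 \<and> range D = cline scaleC e" and "complex_oriented scaleC (D (axis 1 1)) (D (axis 2 1))"
proof -
  have "e \<noteq> 0"
    using frame_simps(1) by auto
  moreover have "range D = cline scaleC e"
  proof (intro equalityI subsetI)
    fix y assume "y \<in> cline scaleC e"
    then obtain k where "y = scaleC k e"
      by (auto simp: cline_def)
    then have "y = D (c2v (k / c))"
      using assms(1) by (simp add: D)
    then show "y \<in> range D"
      by blast
  qed (auto simp: D cline_def)
  ultimately show "\<exists>e. e \<noteq> 0 \<and> range D = cline scaleC e"
    by blast
  have "D (axis 1 1) = scaleC c e" "D (axis 2 1) = scaleC \<i> (scaleC c e)"
    by (simp_all add: D v2c_def axis_def Complex_eq mult.commute)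
  moreover have "scaleC c e \<noteq> 0"
    using assms(1) \<open>e \<noteq> 0\<close> by simp
  ultimately show "complex_oriented scaleC (D (axis 1 1)) (D (axis 2 1))"
    unfolding complex_oriented_def
    by (intro exI[of _ "scaleC c e"] exI[of _ 1] exI[of _ 0]) simp
qed

lemma K1_has_derivative: "(K1 has_derivative (\<lambda>v. scaleC (v2c v) e)) (at x)"
proof -
  have "((\<lambda>x. scaleC (v2c x) e) has_derivative (\<lambda>v. scaleC (v2c v) e)) (at x)"
    by (intro bounded_linear.has_derivative[OF bounded_linear_scaleC_e]
        bounded_linear_imp_has_derivative bounded_linear_v2c)
  then show ?thesis
    unfolding K1_def by (auto intro!: derivative_eq_intros)
qed

lemma tangent_X:
  assumes "(U, \<phi>) \<in> X.A" "p \<in> U" "p \<noteq> None"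
  shows "\<exists>c. c \<noteq> 0 \<and> frechet_derivative (affine_rep U \<phi>) (at (\<phi> p)) =
    (\<lambda>v. scaleC (c * v2c v) e)"
  using assms(1) unfolding X.A_def insert_iff empty_iff
proof (elim disjE FalseE)
  assume "(U, \<phi>) = (X - {None}, \<phi>1)"
  then have U: "U = X - {None}" "\<phi> = \<phi>1" by auto
  have "affine_rep U \<phi> x = K1 x" for x
    using the_eq_K1[OF X.inv_chart(1)[of x]] X.inv_chart(2)[of x] by (simp add: local_rep_def U)
  then have "affine_rep U \<phi> = K1"
    by blast
  then show ?thesis
    using frechet_derivative_at[OF K1_has_derivative, symmetric] by (intro exI[of _ 1]) simp
next
  assume "(U, \<phi>) = (X - {Some a}, \<phi>2)"
  then have U: "U = X - {Some a}" "\<phi> = \<phi>2" by auto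
  have p: "p \<in> X - {Some a, None}"
    using assms(2,3) U by auto
  then have nz: "\<phi>2 p \<noteq> 0"
    by (rule X'.\<phi>_nonzero)
  \<comment> \<open>The chart at infinity uses 1/z, so its affine representative is
    \<open>K1\<close> after a reciprocal; the constant \<open>?c\<close> below is the derivative of
    the reciprocal.\<close>
  have rep: "affine_rep U \<phi> x = K1 (cnj_vec (invert x))" if "x \<noteq> 0" for x
  proof -
    obtain q where q: "q \<in> X - {Some a, None}" "x = \<phi>2 q"
      using X'.image_\<phi>_Int \<open>x \<noteq> 0\<close> by blast
    then have "inv_into U \<phi> x = q"
      using X'.inj_\<phi> by (auto simp: U)
    then show ?thesis
      using the_eq_K1[of q] X'.glue[OF q(1)] q by (simp add: local_rep_def)
  qed
  let ?c = "- inverse ((v2c (\<phi>2 p))\<^sup>2)"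
  have "((\<lambda>x. K1 (cnj_vec (invert x))) has_derivative (\<lambda>v. scaleC (v2c (c2v (?c * v2c v))) e)) (at (\<phi>2 p))"
    by (rule has_derivative_compose[OF cnj_vec_invert_has_derivative[OF nz] K1_has_derivative])
  then have "(affine_rep U \<phi> has_derivative
      (\<lambda>v. scaleC (v2c (c2v (?c * v2c v))) e)) (at (\<phi>2 p))"
    by (rule has_derivative_transform_within_open[of _ _ _ _ "UNIV - {0}"]) (use nz rep in auto)
  from frechet_derivative_at[OF this, symmetric] show ?thesis
    using nz by (intro exI[of _ ?c]) (simp add: U v2c_eq_0_iff)
qed

lemma pseudoholomorphically_embedded_X: "pseudoholomorphically_embedded scaleC X.A"
  unfolding pseudoholomorphically_embedded_def pseudoholomorphic_immersion_def Let_def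
proof (intro conjI embedded_X immersion_X, clarify)
  fix U \<phi> p y assume *: "(U, \<phi>) \<in> X.A" "p \<in> U" "id p = Some y"
  then obtain c where c: "c \<noteq> 0"
    "frechet_derivative (affine_rep U \<phi>) (at (\<phi> p)) = (\<lambda>v. scaleC (c * v2c v) e)"
    using tangent_X[OF *(1,2)] by auto
  let ?D = "frechet_derivative (affine_rep U \<phi>) (at (\<phi> p))"
  show "(\<exists>e. e \<noteq> 0 \<and> range ?D = cline scaleC e) \<and>
      complex_oriented scaleC (?D (axis 1 1)) (?D (axis 2 1))"
    using complex_multiple_tangent[OF c] by blast
qed

section \<open>The completed line and the two-sphere\<close>

definition "stereo q = (if q = None then axis 3 1 else inv_into (sphere 0 1 - {axis 3 1}) stereo_N (\<phi>1 q))"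

lemma stereo_N_stereo: "p \<noteq> None \<Longrightarrow> stereo p \<in> sphere 0 1 - {axis 3 1} \<and> stereo_N (stereo p) = \<phi>1 p"
  unfolding stereo_def using S2.inv_chart[of "\<phi>1 p"] by simp

lemma stereo_eq_S:
  assumes "p \<in> X"
  shows "stereo p = - axis 3 1 \<longleftrightarrow> p = Some a"
proof (cases "p = None")
  case True
  then show ?thesis
    using S2.PQ by (simp add: stereo_def)
next
  case False
  have "- axis 3 1 \<in> sphere 0 1 - {axis 3 1 :: real^3}"
    using S2.Q S2.PQ by (metis DiffI singletonD)
  then have "stereo p = - axis 3 1 \<longleftrightarrow> stereo_N (stereo p) = 0"
    using inj_on_eq_iff[OF S2.inj_\<phi>, of "stereo p" "- axis 3 1"] stereo_N_stereo[OF False] S2.\<phi>Q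
    by simp
  also have "\<dots> \<longleftrightarrow> \<phi>1 p = \<phi>1 (Some a)"
    using stereo_N_stereo[OF False] X.\<phi>Q by simp
  also have "\<dots> \<longleftrightarrow> p = Some a"
    using X.inj_\<phi> assms False a_in_X by (auto dest: inj_onD)
  finally show ?thesis .
qed

text \<open>\<open>stereo\<close> matches z with the stereographic coordinate from the north pole.
  The sphere charts are glued by plain inversion and those of the line by z -> 1/z, so a conjugation
  remains at the other pole.\<close>

lemma stereo_S_stereo:
  assumes "p \<in> X - {Some a}"
  shows "stereo_S (stereo p) = cnj_vec (\<phi>2 p)"
proof (cases "p = None")
  case True
  then show ?thesis
    using S2.\<psi>P by (simp add: stereo_def \<phi>2_def linear_0[OF linear_cnj_vec])
next
  case False
  then have "stereo p \<in> sphere 0 1 - {axis 3 1, - axis 3 1}"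
    using stereo_N_stereo[OF False] stereo_eq_S[of p] assms by auto
  then have "stereo_S (stereo p) = invert (stereo_N (stereo p))"
    by (rule S2.glue)
  then show ?thesis
    using stereo_N_stereo[OF False] False by (auto simp: \<phi>2_def)
qed

lemma bij_stereo: "bij_betw stereo X (sphere 0 1)"
proof -
  have "bij_betw (inv_into (sphere 0 1 - {axis 3 1}) stereo_N \<circ> \<phi>1) (X - {None}) (sphere 0 1 - {axis 3 1})"
    by (rule bij_betw_trans[OF X.bij bij_betw_inv_into[OF S2.bij]])
  then have "bij_betw stereo (X - {None}) (sphere 0 1 - {axis 3 1})"
    by (rule bij_betw_cong[THEN iffD1, rotated]) (auto simp: stereo_def)
  then have "bij_betw stereo ((X - {None}) \<union> {None}) ((sphere 0 1 - {axis 3 1}) \<union> {stereo None})"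
    by (intro notIn_Un_bij_betw) (auto simp: stereo_def)
  moreover have "(X - {None}) \<union> {None} = X" "(sphere 0 1 - {axis 3 1}) \<union> {stereo None} = sphere 0 1"
    using X.P S2.P by (auto simp: stereo_def)
  ultimately show ?thesis
    by simp
qed

text \<open>The explicit maps \<open>H1\<close>, \<open>K1\<close>, \<open>H2\<close>,
  \<open>K2\<close> relate the sphere charts to charts of S, not to charts of the line. The argument
  therefore applies to any immersed smooth structure on the point set \<open>X\<close>.\<close>

lemma diffeomorphic_S2:
  fixes A :: "('v option, real^2) atlas"
  assumes "smooth_atlas A" "immersion A S_atlas id" "carrier_of A = X"
  shows "diffeomorphic A S2_atlas"
proof -
  have "diffeomorphism A S2_atlas stereo"
  proof (rule diffeomorphism_of_submanifold[OF assms(1) S2.smooth_atlas assms(2)])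
    show "bij_betw stereo (carrier_of A) (carrier_of S2_atlas)"
      using bij_stereo by (simp add: assms(3) S2.carrier)
    fix W \<psi> assume "(W, \<psi>) \<in> S2_atlas"
    then consider "W = sphere 0 1 - {axis 3 1}" "\<psi> = stereo_N"
      | "W = sphere 0 1 - {- axis 3 1}" "\<psi> = stereo_S"
      by (auto simp: S2_atlas_def stereo_N_def[abs_def] stereo_S_def[abs_def])
    then show "\<exists>Y Z \<sigma> \<Omega> H K. (Z, \<sigma>) \<in> S_atlas \<and>
       openin (atlas_topology S_atlas) Y \<and> Y \<subseteq> Z \<and> open \<Omega> \<and> smooth_on H \<Omega> \<and>
       smooth_on K UNIV \<and> (\<forall>p\<in>carrier_of A. (stereo p \<in> W \<longleftrightarrow> p \<in> Y) \<and>
         (p \<in> Y \<longrightarrow> \<sigma> p \<in> \<Omega> \<and> H (\<sigma> p) = \<psi> (stereo p) \<and> K (\<psi> (stereo p)) = \<sigma> p))"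
    proof cases
      case 1
      have "(stereo p \<in> W \<longleftrightarrow> p \<in> UNIV - {None}) \<and> (p \<in> UNIV - {None} \<longrightarrow>
          the p \<in> UNIV \<and> H1 (the p) = \<psi> (stereo p) \<and> K1 (\<psi> (stereo p)) = the p)" if "p \<in> X" for p
      proof (cases "p = None")
        case False
        have "H1 (the p) = \<phi>1 p"
          by (simp add: H1_def \<phi>1_def)
        moreover have "K1 (\<phi>1 p) = the p"
          using the_eq_K1[of p] that False by simp
        ultimately show ?thesis
          using stereo_N_stereo[OF False] False by (simp add: 1)
      qed (simp add: 1 stereo_def)
      then show ?thesis
        unfolding assms(3)
        by (intro exI[of _ "UNIV - {None}"] exI[of _ the] exI[of _ UNIV] exI[of _ H1] exI[of _ K1] conjI
            S_charts openin_chart_domain[OF S.smooth_atlas S_charts(1)] smooth_H1 smooth_K1 ballI) auto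
    next
      case 2
      \<comment> \<open>\<open>Some a\<close> corresponds to the omitted south pole, and
        \<open>Some 0\<close> lies outside the domain of \<Phi>. On the line itself, avoiding
        \<open>Some a\<close> already avoids both.\<close>
      let ?Y = "UNIV - {Some 0} - {Some a}"
      have "Some a \<in> topspace (atlas_topology S_atlas)"
        by (simp add: S.topspace)
      then have "closedin (atlas_topology S_atlas) {Some a}"
        by (rule t1_space_closedin_singleton[THEN iffD1, OF Hausdorff_imp_t1_space[OF S.Hausdorff],
              THEN bspec])
      then have Y: "openin (atlas_topology S_atlas) ?Y"
        using openin_chart_domain[OF S.smooth_atlas S_charts(2)] by (rule openin_diff[rotated])
      have "(stereo p \<in> W \<longleftrightarrow> p \<in> ?Y) \<and> (p \<in> ?Y \<longrightarrow> inversion_chart p \<in> \<Omega>2 \<and>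
          H2 (inversion_chart p) = \<psi> (stereo p) \<and> K2 (\<psi> (stereo p)) = inversion_chart p)"
        if p: "p \<in> X" for p
      proof -
        have "stereo p \<in> sphere 0 1"
          using bij_stereo p bij_betwE by blast
        then have "stereo p \<in> W \<longleftrightarrow> p \<noteq> Some a"
          using stereo_eq_S[OF p] by (simp add: 2)
        moreover have "p \<noteq> Some a \<longleftrightarrow> p \<in> ?Y"
          using zero_notin[OF p] by auto
        moreover have "inversion_chart p \<in> \<Omega>2 \<and> H2 (inversion_chart p) = \<psi> (stereo p) \<and>
            K2 (\<psi> (stereo p)) = inversion_chart p" if "p \<noteq> Some a"
        proof -
          have eq: "inversion_chart p = K2 (\<psi> (stereo p))"
            using inversion_chart_eq_K2[of p] stereo_S_stereo[of p] p that by (simp add: 2)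
          show ?thesis
            unfolding eq H2_K2 using K2_in_\<Omega>2 by blast
        qed
        ultimately show ?thesis
          by blast
      qed
      then show ?thesis
        unfolding assms(3)
        by (intro exI[of _ ?Y] exI[of _ "UNIV - {Some 0}"] exI[of _ inversion_chart] exI[of _ \<Omega>2]
            exI[of _ H2] exI[of _ K2] conjI S_charts Y open_\<Omega>2 smooth_H2 smooth_K2 ballI) auto
    qed
  qed
  then show ?thesis
    by (auto simp: diffeomorphic_def)
qed

end

section \<open>Projective lines\<close>

context vector_space
begin

text \<open>A vector of \<open>W\<close> outside the span would give three independent vectors in a
  space spanned by two.\<close>

lemma two_dim_subset_span:
  assumes "dim W = 2" "p \<in> W" "q \<in> W" "p \<noteq> 0" "q \<notin> span {p}"
  shows "W \<subseteq> span {p, q}"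
proof
  fix v assume v: "v \<in> W"
  obtain B where B: "W \<subseteq> span B" "card B = 2"
    using basis_exists[of W] assms(1) by metis
  then have fin: "finite B"
    by (metis card.infinite zero_neq_numeral)
  show "v \<in> span {p, q}"
  proof (rule ccontr)
    assume nv: "v \<notin> span {p, q}"
    have "independent {p}"
      using assms(4) by simp
    then have "independent {q, p}"
      using assms(5) by (rule independent_insertI[rotated])
    moreover have "v \<notin> span {q, p}"
      using nv by (simp add: insert_commute)
    ultimately have "independent (insert v {q, p})"
      by (rule independent_insertI[rotated])
    then have "card (insert v {q, p}) \<le> card B"
      using independent_span_bound[OF fin] v assms(2,3) B(1) by blast
    moreover have "q \<noteq> p" "v \<noteq> p" "v \<noteq> q"
      using assms(5) nv span_base[of _ "{p, q}"] span_base[of p "{p}"] by auto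
    ultimately show False
      using B(2) by simp
  qed
qed

end

section \<open>Homogeneous equations of projective lines\<close>

context hermitian_plane
begin

interpretation VC: vector_space "scale_VC scaleC"
  by (rule vector_space_VC)

lemma proj_point_mem: "(y, z) \<in> proj_point scaleC y z"
  by (auto simp: proj_point_def cline_def scale_VC_def intro: range_eqI[of _ _ 1])

lemma proj_point_in_plane: "(y, z) \<noteq> (0, 0) \<Longrightarrow> proj_point scaleC y z \<in> proj_plane scaleC"
  unfolding proj_plane_def by blast

definition "lines_in W = {l \<in> proj_plane scaleC. l \<subseteq> W}"

text \<open>The homogenization of the affine equation \<open>herm y f = w\<close>. At
  \<open>t = 0\<close> it leaves the direction of the line, which is its single point on H.\<close>

definition "W_line f w = {(y, t). herm y f = t * w}"

lemma subspace_W_line: "VC.subspace (W_line f w)"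
  by (auto simp: VC.subspace_def W_line_def scale_VC_def herm_add_left herm_scale_left
      algebra_simps zero_prod_def)

lemma proj_point_subset_W_line:
  "proj_point scaleC y z \<subseteq> W_line f w \<longleftrightarrow> herm y f = z * w"
proof
  assume "herm y f = z * w"
  then show "proj_point scaleC y z \<subseteq> W_line f w"
    by (auto simp: proj_point_def cline_def scale_VC_def W_line_def herm_scale_left mult.assoc)
next
  assume "proj_point scaleC y z \<subseteq> W_line f w"
  then show "herm y f = z * w"
    using proj_point_mem[of y z] by (auto simp: W_line_def)
qed

lemma pr_W_line:
  assumes "unitary_frame e f"
  shows "pr scaleC ` lines_in (W_line f w) =
    insert None (Some ` {y. herm y f = w})"
proof (intro equalityI subsetI)
  fix s assume "s \<in> pr scaleC ` lines_in (W_line f w)"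
  then obtain y z where yz: "(y, z) \<noteq> (0, 0)" "proj_point scaleC y z \<subseteq> W_line f w"
    "s = pr scaleC (proj_point scaleC y z)"
    by (auto simp: proj_plane_def lines_in_def)
  have "herm y f = z * w"
    using yz(2) by (simp add: proj_point_subset_W_line)
  then show "s \<in> insert None (Some ` {y. herm y f = w})"
    unfolding yz(3) pr_proj_point[OF yz(1)] by (auto simp: herm_scale_left)
next
  fix s assume "s \<in> insert None (Some ` {y. herm y f = w})"
  then consider "s = None" | y where "s = Some y" "herm y f = w"
    by blast
  then show "s \<in> pr scaleC ` lines_in (W_line f w)"
  proof cases
    case 1
    have e: "(e, 0 :: complex) \<noteq> (0, 0)" "herm e f = 0"
      using assms by (auto simp: unitary_frame_def)
    then have "proj_point scaleC e 0 \<in> lines_in (W_line f w)"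
      using proj_point_in_plane[OF e(1)] by (simp add: proj_point_subset_W_line lines_in_def)
    moreover have "pr scaleC (proj_point scaleC e 0) = s"
      using pr_proj_point[OF e(1)] 1 by simp
    ultimately show ?thesis
      by blast
  next
    case 2
    have y: "(y, 1 :: complex) \<noteq> (0, 0)"
      by simp
    then have "proj_point scaleC y 1 \<in> lines_in (W_line f w)"
      using proj_point_in_plane[OF y] 2(2) by (simp add: proj_point_subset_W_line lines_in_def)
    moreover have "pr scaleC (proj_point scaleC y 1) = s"
      using pr_proj_point[OF y] 2(1) by simp
    ultimately show ?thesis
      by blast
  qed
qed

lemma W_line_not_at_infinity:
  assumes "unitary_frame e f"
  shows "lines_in (W_line f w) \<noteq> line_at_infinity scaleC"
proof
  assume eq: "lines_in (W_line f w) = line_at_infinity scaleC"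
  have "herm (scaleC w f) f = w"
    using assms by (simp add: unitary_frame_def herm_scale_left)
  then have "proj_point scaleC (scaleC w f) 1 \<in> lines_in (W_line f w)"
    using proj_point_in_plane[of "scaleC w f" 1] by (simp add: proj_point_subset_W_line lines_in_def)
  then obtain y where y: "proj_point scaleC (scaleC w f) 1 = proj_point scaleC y 0"
    unfolding eq line_at_infinity_def by blast
  have "(scaleC w f, 1) \<in> proj_point scaleC y 0"
    unfolding y[symmetric] by (rule proj_point_mem)
  then show False
    by (auto simp: proj_point_def cline_def scale_VC_def)
qed

text \<open>A basis consists of the direction of the affine line at height 0 and one of its points
  lifted to height 1.\<close>

lemma dim_W_line:
  assumes "unitary_frame e f"
  shows "VC.dim (W_line f w) = 2"
proof (rule VC.dim_unique[of "{(e, 0), (scaleC w f, 1)}"])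
  have fr: "herm e f = 0" "herm f f = 1" "herm e e = 1"
    "\<And>v. v = scaleC (herm v e) e + scaleC (herm v f) f"
    using assms by (auto simp: unitary_frame_def)
  then show "{(e, 0), (scaleC w f, 1)} \<subseteq> W_line f w"
    by (auto simp: W_line_def herm_scale_left)
  show "card {(e, 0 :: complex), (scaleC w f, 1)} = 2"
    by simp
  have e0: "e \<noteq> 0"
    using fr(3) by auto
  have "(scaleC w f, 1) \<notin> VC.span {(e, 0)}"
    by (auto simp: VC.span_singleton scale_VC_def)
  moreover have "VC.independent {(e, 0 :: complex)}"
    using e0 by (simp add: zero_prod_def)
  ultimately have "VC.independent {(scaleC w f, 1), (e, 0)}"
    by (rule VC.independent_insertI)
  then show "VC.independent {(e, 0), (scaleC w f, 1)}"
    by (simp add: insert_commute)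
  show "W_line f w \<subseteq> VC.span {(e, 0), (scaleC w f, 1)}"
  proof
    fix x assume "x \<in> W_line f w"
    then obtain y t where x: "x = (y, t)" "herm y f = t * w"
      by (auto simp: W_line_def)
    have x': "x = scale_VC scaleC (herm y e) (e, 0) + scale_VC scaleC t (scaleC w f, 1)"
      using fr(4)[of y] by (simp add: x scale_VC_def)
    show "x \<in> VC.span {(e, 0), (scaleC w f, 1)}"
      unfolding x' by (intro VC.span_add VC.span_scale VC.span_base) auto
  qed
qed

lemma projective_line_W_line:
  "unitary_frame e f \<Longrightarrow> projective_line scaleC (lines_in (W_line f w))"
  unfolding projective_line_def lines_in_def using subspace_W_line dim_W_line by blast

lemma line_at_infinity_eq:
  "line_at_infinity scaleC = {l \<in> proj_plane scaleC. l \<subseteq> UNIV \<times> {0}}"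
proof (intro equalityI subsetI)
  fix l assume "l \<in> line_at_infinity scaleC"
  then obtain y where y: "y \<noteq> 0" "l = proj_point scaleC y 0"
    by (auto simp: line_at_infinity_def)
  then have "l \<in> proj_plane scaleC"
    using proj_point_in_plane[of y 0] by simp
  then show "l \<in> {l \<in> proj_plane scaleC. l \<subseteq> UNIV \<times> {0}}"
    by (auto simp: y proj_point_def cline_def scale_VC_def)
next
  fix l assume "l \<in> {l \<in> proj_plane scaleC. l \<subseteq> UNIV \<times> {0}}"
  then obtain y z where "(y, z) \<noteq> (0, 0)" "l = proj_point scaleC y z" "l \<subseteq> UNIV \<times> {0}"
    by (auto simp: proj_plane_def)
  moreover from this have "z = 0"
    using proj_point_mem[of y z] by auto
  ultimately show "l \<in> line_at_infinity scaleC"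
    by (auto simp: line_at_infinity_def)
qed

text \<open>The hyperplane at height 0 is a copy of the complex plane, so a two-dimensional subspace
  inside it fills it. This identifies H among the projective lines.\<close>

lemma two_dim_at_infinity:
  assumes W: "VC.subspace W" "VC.dim W = 2" and sub: "W \<subseteq> UNIV \<times> {0}"
  shows "W = UNIV \<times> {0}"
proof -
  obtain B where B: "B \<subseteq> W" "VC.independent B" "card B = 2"
    using VC.basis_exists[of W] W(2) by metis
  then obtain b1 b2 where b: "B = {b1, b2}" "b1 \<noteq> b2"
    by (auto simp: card_2_iff)
  obtain u1 u2 where u: "b1 = (u1, 0)" "b2 = (u2, 0)" "(u1, 0) \<in> W" "(u2, 0) \<in> W"
    using B(1) b sub by (cases b1, cases b2) fastforce
  have "b1 \<noteq> 0" "b2 \<notin> VC.span {b1}"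
    using B(2) b VC.dependent_zero[of B] VC.independent_insert[of b2 "{b1}"]
    by (auto simp: insert_commute)
  then have "u1 \<noteq> 0" "u2 \<notin> span {u1}"
    by (auto simp: u zero_prod_def VC.span_singleton span_singleton scale_VC_def)
  then have sp: "UNIV \<subseteq> span (insert u1 {u2})"
    using two_dim_subset_span[OF dim_2] by simp
  have "(v, 0) \<in> W" for v
  proof -
    obtain k where "v - scaleC k u1 \<in> span {u2}"
      using sp unfolding span_insert by blast
    then obtain l where "v - scaleC k u1 = scaleC l u2"
      unfolding span_singleton by blast
    then have "(v, 0) = scale_VC scaleC k (u1, 0) + scale_VC scaleC l (u2, 0)"
      by (simp add: scale_VC_def algebra_simps)
    then show ?thesis
      using W(1) u(3,4) by (simp add: VC.subspace_add VC.subspace_scale)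
  qed
  then show ?thesis
    using sub by auto
qed

text \<open>A subspace not contained in height 0 has a vector at height 1, giving a point of the
  affine line; dimension two forces a nonzero vector at height 0, giving its direction. The constant
  is then the w-coordinate of that point.\<close>

lemma projective_line_cases:
  assumes L: "projective_line scaleC L" "L \<noteq> line_at_infinity scaleC"
  obtains e f w where "unitary_frame e f" "L = lines_in (W_line f w)"
proof -
  obtain W where W: "VC.subspace W" "VC.dim W = 2" "L = {l \<in> proj_plane scaleC. l \<subseteq> W}"
    using L(1) unfolding projective_line_def by blast
  have "\<not> W \<subseteq> UNIV \<times> {0}"
    using two_dim_at_infinity[OF W(1,2)] W(3) L(2) line_at_infinity_eq by auto
  then obtain y0 z0 where yz0: "(y0, z0) \<in> W" "z0 \<noteq> 0"
    by auto
  define a where "a = scaleC (inverse z0) y0"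
  have aW: "(a, 1) \<in> W"
    using VC.subspace_scale[OF W(1) yz0(1), of "inverse z0"] yz0(2) by (simp add: a_def scale_VC_def)
  obtain B where B: "B \<subseteq> W" "VC.independent B" "W \<subseteq> VC.span B" "card B = 2"
    using VC.basis_exists[of W] W(2) by metis
  \<comment> \<open>Subtracting the multiple of \<open>(a, 1)\<close> with the same height sends any
    vector of \<open>W\<close> to height 0. If only zero occurred there, \<open>W\<close> would be
    spanned by one vector.\<close>
  have "\<exists>u. u \<noteq> 0 \<and> (u, 0) \<in> W"
  proof (rule ccontr)
    assume no: "\<not> ?thesis"
    have "b \<in> VC.span {(a, 1)}" if b: "b \<in> W" for b
    proof -
      have "b - scale_VC scaleC (snd b) (a, 1) \<in> W"
        using W(1) b aW by (simp add: VC.subspace_diff VC.subspace_scale)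
      moreover have "b - scale_VC scaleC (snd b) (a, 1) = (fst b - scaleC (snd b) a, 0)"
        by (cases b) (simp add: scale_VC_def)
      ultimately have "fst b - scaleC (snd b) a = 0"
        using no by metis
      then have "fst b = scaleC (snd b) a"
        by simp
      then have "b = scale_VC scaleC (snd b) (a, 1)"
        by (cases b) (simp add: scale_VC_def)
      then show ?thesis
        by (metis VC.span_base VC.span_scale singletonI)
    qed
    then have "card B \<le> card {(a, 1 :: complex)}"
      using VC.independent_span_bound[of "{(a, 1)}" B] B(1,2) by blast
    then show False
      using B(4) by simp
  qed
  then obtain u where u: "u \<noteq> 0" "(u, 0) \<in> W"
    by blast
  define e where "e = u /\<^sub>R norm u"
  have "norm e = 1"
    using u(1) by (simp add: e_def)
  then obtain f where frame: "unitary_frame e f"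
    using exists_unitary_frame_with by blast
  have fr: "herm e f = 0" "herm e e = 1" "\<And>v. v = scaleC (herm v e) e + scaleC (herm v f) f"
    using frame by (auto simp: unitary_frame_def)
  have "(e, 0) = scale_VC scaleC (of_real (inverse (norm u))) (u, 0)"
    by (simp only: e_def scale_VC_def scaleC_of_real fst_conv snd_conv mult_zero_right)
  then have eW: "(e, 0) \<in> W"
    using VC.subspace_scale[OF W(1) u(2)] by simp
  have "(a, 1) \<notin> VC.span {(e, 0)}"
    by (auto simp: VC.span_singleton scale_VC_def)
  moreover have "(e, 0 :: complex) \<noteq> 0"
    using fr(2) by (auto simp: zero_prod_def)
  ultimately have span: "W \<subseteq> VC.span (insert (e, 0) {(a, 1)})"
    using VC.two_dim_subset_span[OF W(2) eW aW] by simp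
  have "W = W_line f (herm a f)"
  proof (intro equalityI subsetI)
    fix x assume "x \<in> W"
    then obtain k where "x - scale_VC scaleC k (e, 0) \<in> VC.span {(a, 1)}"
      using span unfolding VC.span_insert by blast
    then obtain l where "x - scale_VC scaleC k (e, 0) = scale_VC scaleC l (a, 1)"
      unfolding VC.span_singleton by blast
    then have "x = scale_VC scaleC k (e, 0) + scale_VC scaleC l (a, 1)"
      by (simp add: algebra_simps)
    then show "x \<in> W_line f (herm a f)"
      by (simp add: W_line_def scale_VC_def herm_add_left herm_scale_left fr)
  next
    fix x assume "x \<in> W_line f (herm a f)"
    then obtain y t where x: "x = (y, t)" "herm y f = t * herm a f"
      by (auto simp: W_line_def)
    then have "herm (y - scaleC t a) f = 0"
      by (simp add: herm_diff_left herm_scale_left)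
    then have "y - scaleC t a = scaleC (herm (y - scaleC t a) e) e"
      using fr(3)[of "y - scaleC t a"] by simp
    then have "x = scale_VC scaleC (herm (y - scaleC t a) e) (e, 0) + scale_VC scaleC t (a, 1)"
      by (simp add: x scale_VC_def algebra_simps)
    then show "x \<in> W"
      using W(1) eW aW by (simp add: VC.subspace_add VC.subspace_scale)
  qed
  then show ?thesis
    using that[OF frame] W(3) unfolding lines_in_def by blast
qed

lemma pr_projective_lines:
  "{pr scaleC ` L |L. projective_line scaleC L \<and> L \<noteq> line_at_infinity scaleC} =
   {insert None (Some ` {y. herm y f = w}) |e f w. unitary_frame e f}"
proof (intro equalityI subsetI)
  fix X assume "X \<in> {pr scaleC ` L |L. projective_line scaleC L \<and> L \<noteq> line_at_infinity scaleC}"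
  then obtain L where L: "X = pr scaleC ` L" "projective_line scaleC L" "L \<noteq> line_at_infinity scaleC"
    by blast
  obtain e f w where frame: "unitary_frame e f" and "L = lines_in (W_line f w)"
    using projective_line_cases[OF L(2,3)] .
  then have "X = insert None (Some ` {y. herm y f = w})"
    using L(1) pr_W_line[OF frame] by simp
  then show "X \<in> {insert None (Some ` {y. herm y f = w}) |e f w. unitary_frame e f}"
    using frame by blast
next
  fix X :: "'v option set"
  assume "X \<in> {insert None (Some ` {y. herm y f = w}) |e f w. unitary_frame e f}"
  then obtain e f w where frame: "unitary_frame e f" and "X = insert None (Some ` {y. herm y f = w})"
    by (elim CollectE exE conjE)
  then have "X = pr scaleC ` lines_in (W_line f w)"
    using pr_W_line[OF frame] by simp
  then show "X \<in> {pr scaleC ` L |L. projective_line scaleC L \<and> L \<noteq> line_at_infinity scaleC}"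
    using projective_line_W_line[OF frame, of w] W_line_not_at_infinity[OF frame, of w] by blast
qed

end

theorem theorem20p1:
  fixes scaleC :: "complex \<Rightarrow> 'v::euclidean_space \<Rightarrow> 'v"
    and herm :: "'v \<Rightarrow> 'v \<Rightarrow> complex"
  assumes "hermitian_plane scaleC herm"
  shows "(\<forall>A :: ('v option, real^2) atlas.
            closed_oriented_surface A \<and> pseudoholomorphically_embedded scaleC A \<longrightarrow>
              diffeomorphic A S2_atlas) \<and>
         {carrier_of A |A :: ('v option, real^2) atlas.
            closed_oriented_surface A \<and> pseudoholomorphically_embedded scaleC A} =
         {pr scaleC ` L |L. projective_line scaleC L \<and> L \<noteq> line_at_infinity scaleC}"
proof -
  interpret hermitian_plane scaleC herm by fact
  \<comment> \<open>The carrier determines only the set of points; the diffeomorphism concerns the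
    smooth structure of the given \<open>A\<close>, so both are obtained together.\<close>
  have surface: "\<exists>e f w. unitary_frame e f \<and> carrier_of A = insert None (Some ` {y. herm y f = w}) \<and>
      diffeomorphic A S2_atlas"
    if A: "closed_oriented_surface A" "pseudoholomorphically_embedded scaleC A"
    for A :: "('v option, real^2) atlas"
  proof -
    have "closed_holo_surface scaleC herm A"
      using A by unfold_locales
        (auto simp: closed_oriented_surface_def oriented_surface_def manifold_def
          pseudoholomorphically_embedded_def)
    then interpret A: closed_holo_surface scaleC herm A .
    obtain e f w where frame: "unitary_frame e f"
      and carrier: "carrier_of A = insert None (Some ` {y. herm y f = w})"
      using A.carrier_is_line .
    interpret L: complex_line scaleC herm e f w
      by unfold_locales (rule frame)
    have "diffeomorphic A S2_atlas"
      using A.smooth_A A.holo_A carrier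
      by (intro L.diffeomorphic_S2) (auto simp: pseudoholomorphic_immersion_def L.X_def)
    then show ?thesis
      using frame carrier by blast
  qed
  have line: "\<exists>A :: ('v option, real^2) atlas. closed_oriented_surface A \<and>
      pseudoholomorphically_embedded scaleC A \<and> carrier_of A = insert None (Some ` {y. herm y f = w})"
    if "unitary_frame e f" for e f w
  proof -
    interpret L: complex_line scaleC herm e f w
      by unfold_locales (rule that)
    show ?thesis
      using L.closed_oriented_X L.pseudoholomorphically_embedded_X L.X.carrier
      unfolding L.X_def by blast
  qed
  have "{carrier_of A |A :: ('v option, real^2) atlas.
      closed_oriented_surface A \<and> pseudoholomorphically_embedded scaleC A} =
    {insert None (Some ` {y. herm y f = w}) |e f w. unitary_frame e f}"
  proof (intro equalityI subsetI)
    fix X :: "'v option set"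
    assume "X \<in> {carrier_of A |A :: ('v option, real^2) atlas.
      closed_oriented_surface A \<and> pseudoholomorphically_embedded scaleC A}"
    then obtain A :: "('v option, real^2) atlas" where A: "X = carrier_of A"
      "closed_oriented_surface A" "pseudoholomorphically_embedded scaleC A"
      by blast
    show "X \<in> {insert None (Some ` {y. herm y f = w}) |e f w. unitary_frame e f}"
      using surface[OF A(2,3)] unfolding A(1) by blast
  next
    fix X :: "'v option set"
    assume "X \<in> {insert None (Some ` {y. herm y f = w}) |e f w. unitary_frame e f}"
    then obtain e f w where frame: "unitary_frame e f" and X: "X = insert None (Some ` {y. herm y f = w})"
      by (elim CollectE exE conjE)
    show "X \<in> {carrier_of A |A :: ('v option, real^2) atlas.
      closed_oriented_surface A \<and> pseudoholomorphically_embedded scaleC A}"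
      using line[OF frame, of w] unfolding X by force
  qed
  then show ?thesis
    unfolding pr_projective_lines using surface by (intro conjI allI impI) blast+
qed

end
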